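(* Let $A=\mathbb{K}Q/J^2$ be a radical square zero algebra and let $A_0=\mathbb{K}Q/J$ be the direct sum of all simple $A$-modules, one from each isomorphism class. Then $\phi\dim(A)\le \phi(A_0)+1$.
   Context: $\mathbb{K}$ is a field, $Q$ is a finite connected quiver, $J$ is the ideal of $\mathbb{K}Q$ generated by the arrows. Modules are finitely generated right modules. $K_0(A)$ is the abelian group generated by symbols $[M]$, one for each isomorphism class of finitely generated $A$-modules, modulo the relations $[M]-[M']-[M'']$ whenever $M\cong M'\oplus M''$ and $[P]$ for each projective $P$. The syzygy $\Omega$ induces a group endomorphism $\overline{\Omega}:K_0(A)\to K_0(A)$. For a module $M$, $\langle \mathrm{add}\, M\rangle$ is the subgroup of $K_0(A)$ generated by the classes of the indecomposable direct summands of $M$, and $\phi(M)=\min\{l\in\mathbb{N}: \overline{\Omega}|_{\overline{\Omega}^{l+s}\langle \mathrm{add}\, M\rangle}\text{ is injective for all } s\in\mathbb{N}\}$ ($0\in\mathbb{N}$). $\phi\dim(A)=\sup\{\phi(M): M\in \mathrm{mod}\,A\}$. *)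

theory Defs
  imports
    "HOL-Algebra.Free_Abelian_Groups"
    "HOL-Algebra.Generated_Groups"
    "HOL-Algebra.Ideal_Product"
    "HOL-Algebra.QuotRing"
    "HOL-Algebra.Module"
    "HOL-Library.Extended_Nat"
    "Graph_Theory.Digraph_Component"
begin

section \<open>Path algebras\<close>

text \<open>
  A quiver is a directed multigraph, loops allowed, as provided by \<^typ>\<open>('v, 'e) pre_digraph\<close>.
  The triple \<open>(u, p, v)\<close> stands for the path with arrows \<open>p\<close> from \<open>u\<close> to \<open>v\<close>; thus \<open>(v, [], v)\<close> is
  the trivial path at \<open>v\<close>.  Paths are composed from left to right.
\<close>

type_synonym ('v, 'e) qpath = "'v \<times> 'e list \<times> 'v"

definition qpaths :: "('v, 'e) pre_digraph \<Rightarrow> ('v, 'e) qpath set" where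
  "qpaths Q = {(u, p, v). pre_digraph.awalk Q u p v}"

text \<open>The bilinear extension of concatenation; non-composable paths multiply to \<open>0\<close>.\<close>

definition path_mult ::
  "(('v, 'e) qpath \<Rightarrow>\<^sub>0 'k::field) \<Rightarrow> (('v, 'e) qpath \<Rightarrow>\<^sub>0 'k) \<Rightarrow> (('v, 'e) qpath \<Rightarrow>\<^sub>0 'k)" where
  "path_mult f g =
     (\<Sum>(u, p, v) \<in> Poly_Mapping.keys f. \<Sum>(v', q, w) \<in> Poly_Mapping.keys g.
        if v = v'
        then Poly_Mapping.single (u, p @ q, w)
               (Poly_Mapping.lookup f (u, p, v) * Poly_Mapping.lookup g (v', q, w))
        else 0)"

definition path_algebra :: "('v, 'e) pre_digraph \<Rightarrow> (('v, 'e) qpath \<Rightarrow>\<^sub>0 'k::field) ring" where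
  "path_algebra Q =
     \<lparr>carrier = {f. Poly_Mapping.keys f \<subseteq> qpaths Q},
      monoid.mult = path_mult,
      one = (\<Sum>v \<in> verts Q. Poly_Mapping.single (v, [], v) 1),
      zero = 0,
      add = (+)\<rparr>"

definition arrow_ideal :: "('v, 'e) pre_digraph \<Rightarrow> (('v, 'e) qpath \<Rightarrow>\<^sub>0 'k::field) set" where
  "arrow_ideal Q =
     genideal (path_algebra Q)
       ((\<lambda>a. Poly_Mapping.single (tail Q a, [a], head Q a) 1) ` arcs Q)"

definition rad_sq_zero_algebra ::
  "('v, 'e) pre_digraph \<Rightarrow> (('v, 'e) qpath \<Rightarrow>\<^sub>0 'k::field) set ring" where
  "rad_sq_zero_algebra Q =
     path_algebra Q Quot ideal_prod (path_algebra Q) (arrow_ideal Q) (arrow_ideal Q)"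


section \<open>Finitely generated right modules\<close>

text \<open>
  The library's \<^locale>\<open>module\<close> is restricted to commutative rings, so only its record type is used
  here, and \<open>a \<odot>\<^bsub>M\<^esub> x\<close> denotes the right action \<open>x a\<close>; note the order in \<open>smult_mult\<close>.
  The fields \<^const>\<open>monoid.mult\<close> and \<^const>\<open>one\<close> of the record carry no meaning.
\<close>

locale right_module = A?: ring A + M?: abelian_group M
  for A :: "('a, 'x) ring_scheme" (structure) and M :: "('a, 'm) module" (structure) +
  assumes smult_closed: "\<lbrakk>a \<in> carrier A; x \<in> carrier M\<rbrakk> \<Longrightarrow> a \<odot>\<^bsub>M\<^esub> x \<in> carrier M"
    and smult_add: "\<lbrakk>a \<in> carrier A; b \<in> carrier A; x \<in> carrier M\<rbrakk> \<Longrightarrow>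
      (a \<oplus>\<^bsub>A\<^esub> b) \<odot>\<^bsub>M\<^esub> x = a \<odot>\<^bsub>M\<^esub> x \<oplus>\<^bsub>M\<^esub> b \<odot>\<^bsub>M\<^esub> x"
    and smult_add_right: "\<lbrakk>a \<in> carrier A; x \<in> carrier M; y \<in> carrier M\<rbrakk> \<Longrightarrow>
      a \<odot>\<^bsub>M\<^esub> (x \<oplus>\<^bsub>M\<^esub> y) = a \<odot>\<^bsub>M\<^esub> x \<oplus>\<^bsub>M\<^esub> a \<odot>\<^bsub>M\<^esub> y"
    and smult_mult: "\<lbrakk>a \<in> carrier A; b \<in> carrier A; x \<in> carrier M\<rbrakk> \<Longrightarrow>
      (a \<otimes>\<^bsub>A\<^esub> b) \<odot>\<^bsub>M\<^esub> x = b \<odot>\<^bsub>M\<^esub> (a \<odot>\<^bsub>M\<^esub> x)"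
    and smult_one: "x \<in> carrier M \<Longrightarrow> \<one>\<^bsub>A\<^esub> \<odot>\<^bsub>M\<^esub> x = x"

definition fin_gen :: "('a, 'x) ring_scheme \<Rightarrow> ('a, 'm) module \<Rightarrow> bool" where
  "fin_gen A M \<longleftrightarrow>
     (\<exists>S. finite S \<and> S \<subseteq> carrier M \<and> (\<forall>U. submodule U A M \<and> S \<subseteq> U \<longrightarrow> U = carrier M))"

text \<open>
  The category of finitely generated right modules.  A module on \<open>n\<close> generators has at most as many
  elements as there are coefficient vectors of length \<open>n\<close>, so up to isomorphism all finitely
  generated modules, on whatever carrier type, occur here; see \<open>mod_cat_representative\<close> below.
\<close>

definition mod_cat :: "('a, 'x) ring_scheme \<Rightarrow> ('a, nat \<Rightarrow> 'a) module set" where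
  "mod_cat A = {M. right_module A M \<and> fin_gen A M}"

definition mod_hom ::
  "('a, 'x) ring_scheme \<Rightarrow> ('a, 'm) module \<Rightarrow> ('a, 'n) module \<Rightarrow> ('m \<Rightarrow> 'n) set" where
  "mod_hom A M N =
     {f \<in> carrier M \<rightarrow> carrier N.
        (\<forall>x \<in> carrier M. \<forall>y \<in> carrier M. f (x \<oplus>\<^bsub>M\<^esub> y) = f x \<oplus>\<^bsub>N\<^esub> f y) \<and>
        (\<forall>a \<in> carrier A. \<forall>x \<in> carrier M. f (a \<odot>\<^bsub>M\<^esub> x) = a \<odot>\<^bsub>N\<^esub> f x)}"

definition mod_iso :: "('a, 'x) ring_scheme \<Rightarrow> ('a, 'm) module \<Rightarrow> ('a, 'n) module \<Rightarrow> bool" where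
  "mod_iso A M N \<longleftrightarrow> (\<exists>f \<in> mod_hom A M N. bij_betw f (carrier M) (carrier N))"

definition mod_sum :: "('a, 'm) module \<Rightarrow> ('a, 'n) module \<Rightarrow> ('a, 'm \<times> 'n) module" where
  "mod_sum M N =
     \<lparr>carrier = carrier M \<times> carrier N,
      monoid.mult = undefined,
      one = undefined,
      zero = (\<zero>\<^bsub>M\<^esub>, \<zero>\<^bsub>N\<^esub>),
      add = (\<lambda>(x, y) (x', y'). (x \<oplus>\<^bsub>M\<^esub> x', y \<oplus>\<^bsub>N\<^esub> y')),
      smult = (\<lambda>a (x, y). (a \<odot>\<^bsub>M\<^esub> x, a \<odot>\<^bsub>N\<^esub> y))\<rparr>"

definition mod_kernel :: "('a, 'm) module \<Rightarrow> ('a, 'n) module \<Rightarrow> ('m \<Rightarrow> 'n) \<Rightarrow> 'm set" where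
  "mod_kernel M N f = {x \<in> carrier M. f x = \<zero>\<^bsub>N\<^esub>}"

definition indecomposable :: "('a, 'x) ring_scheme \<Rightarrow> ('a, nat \<Rightarrow> 'a) module \<Rightarrow> bool" where
  "indecomposable A N \<longleftrightarrow>
     carrier N \<noteq> {\<zero>\<^bsub>N\<^esub>} \<and>
     (\<forall>N' \<in> mod_cat A. \<forall>N'' \<in> mod_cat A. mod_iso A N (mod_sum N' N'') \<longrightarrow>
        carrier N' = {\<zero>\<^bsub>N'\<^esub>} \<or> carrier N'' = {\<zero>\<^bsub>N''\<^esub>})"

definition direct_summand ::
  "('a, 'x) ring_scheme \<Rightarrow> ('a, nat \<Rightarrow> 'a) module \<Rightarrow> ('a, 'm) module \<Rightarrow> bool" where
  "direct_summand A N M \<longleftrightarrow> (\<exists>N' \<in> mod_cat A. mod_iso A M (mod_sum N N'))"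

text \<open>Projective objects of \<^const>\<open>mod_cat\<close>, by the lifting property against epimorphisms.\<close>

definition projective :: "('a, 'x) ring_scheme \<Rightarrow> ('a, nat \<Rightarrow> 'a) module \<Rightarrow> bool" where
  "projective A P \<longleftrightarrow>
     P \<in> mod_cat A \<and>
     (\<forall>M \<in> mod_cat A. \<forall>N \<in> mod_cat A. \<forall>g \<in> mod_hom A M N. \<forall>f \<in> mod_hom A P N.
        g ` carrier M = carrier N \<longrightarrow> (\<exists>h \<in> mod_hom A P M. \<forall>x \<in> carrier P. g (h x) = f x))"

definition projective_cover ::
  "('a, 'x) ring_scheme \<Rightarrow> ('a, 'm) module \<Rightarrow> ('a, nat \<Rightarrow> 'a) module \<Rightarrow> ((nat \<Rightarrow> 'a) \<Rightarrow> 'm) \<Rightarrow> bool"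
where
  "projective_cover A M P p \<longleftrightarrow>
     projective A P \<and> p \<in> mod_hom A P M \<and> p ` carrier P = carrier M \<and>
     (\<forall>U. submodule U A P \<and> U <+>\<^bsub>P\<^esub> mod_kernel P M p = carrier P \<longrightarrow> U = carrier P)"

text \<open>
  Projective covers are unique up to isomorphism, and over a finite dimensional algebra every
  finitely generated module has one.
\<close>

definition syzygy :: "('a, 'x) ring_scheme \<Rightarrow> ('a, 'm) module \<Rightarrow> ('a, nat \<Rightarrow> 'a) module" where
  "syzygy A M =
     (let (P, p) = (SOME (P, p). projective_cover A M P p)
      in P\<lparr>carrier := mod_kernel P M p\<rparr>)"


section \<open>The group \<open>K\<^sub>0\<close> and the Igusa-Todorov function\<close>

definition iso_class ::
  "('a, 'x) ring_scheme \<Rightarrow> ('a, 'm) module \<Rightarrow> ('a, nat \<Rightarrow> 'a) module set" where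
  "iso_class A M = {N \<in> mod_cat A. mod_iso A M N}"

definition K0_free ::
  "('a, 'x) ring_scheme \<Rightarrow> (('a, nat \<Rightarrow> 'a) module set \<Rightarrow>\<^sub>0 int) monoid" where
  "K0_free A = free_Abelian_group (iso_class A ` mod_cat A)"

definition K0_relations ::
  "('a, 'x) ring_scheme \<Rightarrow> (('a, nat \<Rightarrow> 'a) module set \<Rightarrow>\<^sub>0 int) set" where
  "K0_relations A =
     {frag_of (iso_class A M) - frag_of (iso_class A M') - frag_of (iso_class A M'') | M M' M''.
        M \<in> mod_cat A \<and> M' \<in> mod_cat A \<and> M'' \<in> mod_cat A \<and> mod_iso A M (mod_sum M' M'')} \<union>
     {frag_of (iso_class A P) | P. projective A P}"

definition K0 ::
  "('a, 'x) ring_scheme \<Rightarrow> (('a, nat \<Rightarrow> 'a) module set \<Rightarrow>\<^sub>0 int) set monoid" where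
  "K0 A = K0_free A Mod generate (K0_free A) (K0_relations A)"

definition K0_class ::
  "('a, 'x) ring_scheme \<Rightarrow> ('a, 'm) module \<Rightarrow> (('a, nat \<Rightarrow> 'a) module set \<Rightarrow>\<^sub>0 int) set" where
  "K0_class A M =
     generate (K0_free A) (K0_relations A) #>\<^bsub>K0_free A\<^esub> frag_of (iso_class A M)"

text \<open>
  As the classes of modules generate \<^const>\<open>K0\<close>, the endomorphism is determined on its carrier.
\<close>

definition Omega_bar ::
  "('a, 'x) ring_scheme \<Rightarrow>
   (('a, nat \<Rightarrow> 'a) module set \<Rightarrow>\<^sub>0 int) set \<Rightarrow> (('a, nat \<Rightarrow> 'a) module set \<Rightarrow>\<^sub>0 int) set" where
  "Omega_bar A =
     (SOME h. h \<in> hom (K0 A) (K0 A) \<and>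
        (\<forall>M \<in> mod_cat A. h (K0_class A M) = K0_class A (syzygy A M)))"

definition add_subgroup ::
  "('a, 'x) ring_scheme \<Rightarrow> ('a, 'm) module \<Rightarrow> (('a, nat \<Rightarrow> 'a) module set \<Rightarrow>\<^sub>0 int) set set" where
  "add_subgroup A M =
     generate (K0 A)
       {K0_class A N | N. N \<in> mod_cat A \<and> indecomposable A N \<and> direct_summand A N M}"

text \<open>
  The minimum exists: for modules with finitely many classes of indecomposable summands,
  \<^const>\<open>add_subgroup\<close> is a finitely generated abelian group, so the kernels of the powers of
  \<^const>\<open>Omega_bar\<close> on it form a stationary chain.
\<close>

definition phi :: "('a, 'x) ring_scheme \<Rightarrow> ('a, 'm) module \<Rightarrow> nat" where
  "phi A M =
     (LEAST l. \<forall>s. inj_on (Omega_bar A) ((Omega_bar A ^^ (l + s)) ` add_subgroup A M))"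

definition phi_dim :: "('a, 'x) ring_scheme \<Rightarrow> enat" where
  "phi_dim A = (SUP M \<in> mod_cat A. enat (phi A M))"

text \<open>
  The right module \<open>KQ/J\<close> over \<open>KQ/J\<^sup>2\<close>.  The ring homomorphism from \<open>KQ/J\<^sup>2\<close> to \<open>KQ/J\<close> maps a coset
  \<open>a\<close> of \<open>J\<^sup>2\<close> to the coset \<open>J + a\<close> of \<open>J\<close>.
\<close>

definition semisimple_quotient ::
  "('v, 'e) pre_digraph \<Rightarrow>
   ((('v, 'e) qpath \<Rightarrow>\<^sub>0 'k::field) set, (('v, 'e) qpath \<Rightarrow>\<^sub>0 'k) set) module" where
  "semisimple_quotient Q =
     (let R = path_algebra Q; J = arrow_ideal Q; S = R Quot J
      in \<lparr>carrier = carrier S,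
          monoid.mult = monoid.mult S,
          one = \<one>\<^bsub>S\<^esub>,
          zero = \<zero>\<^bsub>S\<^esub>,
          add = add S,
          smult = (\<lambda>a x. x \<otimes>\<^bsub>S\<^esub> (J <+>\<^bsub>R\<^esub> a))\<rparr>)"


section \<open>Every finitely generated module is represented in \<^const>\<open>mod_cat\<close>\<close>

context right_module
begin

lemma smult_zero_left: "x \<in> carrier M \<Longrightarrow> \<zero>\<^bsub>A\<^esub> \<odot>\<^bsub>M\<^esub> x = \<zero>\<^bsub>M\<^esub>"
  by (metis A.r_zero A.zero_closed M.add.l_cancel_one smult_add smult_closed)

lemma smult_zero_right: "a \<in> carrier A \<Longrightarrow> a \<odot>\<^bsub>M\<^esub> \<zero>\<^bsub>M\<^esub> = \<zero>\<^bsub>M\<^esub>"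
  by (metis M.r_zero M.zero_closed M.add.l_cancel_one smult_add_right smult_closed)

lemma a_inv_eq_smult: "x \<in> carrier M \<Longrightarrow> \<ominus>\<^bsub>M\<^esub> x = (\<ominus>\<^bsub>A\<^esub> \<one>\<^bsub>A\<^esub>) \<odot>\<^bsub>M\<^esub> x"
  by (metis A.a_inv_closed A.l_neg A.one_closed M.minus_equality smult_add smult_closed smult_one
      smult_zero_left)

lemma smult_finsum:
  assumes "finite I" "a \<in> carrier A" "f \<in> I \<rightarrow> carrier M"
  shows "a \<odot>\<^bsub>M\<^esub> finsum M f I = finsum M (\<lambda>i. a \<odot>\<^bsub>M\<^esub> f i) I"
  using assms
proof (induction I rule: finite_induct)
  case empty
  then show ?case by (simp add: smult_zero_right)
next
  case (insert i I)
  then have "f \<in> I \<rightarrow> carrier M" "f i \<in> carrier M" "(\<lambda>i. a \<odot>\<^bsub>M\<^esub> f i) \<in> I \<rightarrow> carrier M"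
    by (auto intro: smult_closed)
  with insert show ?case
    by (simp add: smult_add_right smult_closed)
qed

lemma fin_gen_coefficients:
  assumes "fin_gen A M"
  obtains n :: nat and s where "s \<in> {..<n} \<rightarrow> carrier M"
    "\<And>m. m \<in> carrier M \<Longrightarrow>
       \<exists>x \<in> {..<n} \<rightarrow> carrier A. m = finsum M (\<lambda>i. x i \<odot>\<^bsub>M\<^esub> s i) {..<n}"
proof -
  obtain S where S: "finite S" "S \<subseteq> carrier M"
    and gen: "\<And>U. submodule U A M \<Longrightarrow> S \<subseteq> U \<Longrightarrow> U = carrier M"
    using assms unfolding fin_gen_def by blast
  obtain n :: nat and s where s: "S = s ` {..<n}"
    using finite_imp_nat_seg_image_inj_on[OF S(1)] unfolding lessThan_def by metis
  have sc: "s i \<in> carrier M" if "i < n" for i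
    using S(2) s that by auto
  let ?c = "\<lambda>x. finsum M (\<lambda>i. x i \<odot>\<^bsub>M\<^esub> s i) {..<n}"
  let ?X = "{..<n} \<rightarrow> carrier A"
  have cc: "(\<lambda>i. x i \<odot>\<^bsub>M\<^esub> s i) \<in> {..<n} \<rightarrow> carrier M" if "x \<in> ?X" for x
    using that sc by (auto intro!: smult_closed)
  have smult: "a \<odot>\<^bsub>M\<^esub> ?c x = ?c (\<lambda>i. x i \<otimes>\<^bsub>A\<^esub> a)" if "a \<in> carrier A" "x \<in> ?X" for a x
  proof -
    have "a \<odot>\<^bsub>M\<^esub> ?c x = finsum M (\<lambda>i. a \<odot>\<^bsub>M\<^esub> (x i \<odot>\<^bsub>M\<^esub> s i)) {..<n}"
      using smult_finsum[OF _ that(1) cc[OF that(2)]] by simp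
    also have "\<dots> = ?c (\<lambda>i. x i \<otimes>\<^bsub>A\<^esub> a)"
      using that sc by (intro M.add.finprod_cong') (auto simp: smult_mult Pi_iff intro!: smult_closed)
    finally show ?thesis .
  qed
  have add: "?c x \<oplus>\<^bsub>M\<^esub> ?c y = ?c (\<lambda>i. x i \<oplus>\<^bsub>A\<^esub> y i)" if "x \<in> ?X" "y \<in> ?X" for x y
  proof -
    have "?c x \<oplus>\<^bsub>M\<^esub> ?c y = finsum M (\<lambda>i. x i \<odot>\<^bsub>M\<^esub> s i \<oplus>\<^bsub>M\<^esub> y i \<odot>\<^bsub>M\<^esub> s i) {..<n}"
      using M.finsum_addf[OF cc[OF that(1)] cc[OF that(2)]] by simp
    also have "\<dots> = ?c (\<lambda>i. x i \<oplus>\<^bsub>A\<^esub> y i)"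
      using that sc by (intro M.add.finprod_cong') (auto simp: smult_add Pi_iff intro!: smult_closed)
    finally show ?thesis .
  qed
  have closed: "?c x \<in> carrier M" if "x \<in> ?X" for x
    using M.finsum_closed[OF cc[OF that]] .
  have smult_mem: "a \<odot>\<^bsub>M\<^esub> u \<in> ?c ` ?X" if "a \<in> carrier A" "u \<in> ?c ` ?X" for a u
  proof -
    from that(2) obtain x where x: "x \<in> ?X" "u = ?c x" by blast
    have "(\<lambda>i. x i \<otimes>\<^bsub>A\<^esub> a) \<in> ?X"
      using x(1) that(1) by auto
    with smult[OF that(1) x(1)] x(2) show ?thesis by (auto intro: image_eqI)
  qed
  have add_mem: "u \<oplus>\<^bsub>M\<^esub> v \<in> ?c ` ?X" if "u \<in> ?c ` ?X" "v \<in> ?c ` ?X" for u v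
  proof -
    from that obtain x y where xy: "x \<in> ?X" "u = ?c x" "y \<in> ?X" "v = ?c y" by blast
    have "(\<lambda>i. x i \<oplus>\<^bsub>A\<^esub> y i) \<in> ?X"
      using xy by auto
    with add[OF xy(1) xy(3)] xy(2,4) show ?thesis by (auto intro: image_eqI)
  qed
  have sub: "submodule (?c ` ?X) A M"
  proof (intro submodule.intro submodule_axioms.intro M.add.subgroupI)
    show "?c ` ?X \<subseteq> carrier M"
      using closed by auto
    show "?c ` ?X \<noteq> {}"
      using A.zero_closed by blast
    show "\<ominus>\<^bsub>M\<^esub> u \<in> ?c ` ?X" if "u \<in> ?c ` ?X" for u
    proof -
      have "u \<in> carrier M" using that closed by blast
      then have "\<ominus>\<^bsub>M\<^esub> u = (\<ominus>\<^bsub>A\<^esub> \<one>\<^bsub>A\<^esub>) \<odot>\<^bsub>M\<^esub> u"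
        using a_inv_eq_smult by simp
      then show ?thesis using smult_mem[OF _ that] by simp
    qed
  qed (use add_mem smult_mem in auto)
  have "S \<subseteq> ?c ` ?X"
  proof
    fix m assume "m \<in> S"
    then obtain j where j: "j < n" "m = s j" using s by auto
    let ?d = "\<lambda>i. if j = i then \<one>\<^bsub>A\<^esub> else \<zero>\<^bsub>A\<^esub>"
    have "?c ?d = finsum M (\<lambda>i. if j = i then s i else \<zero>\<^bsub>M\<^esub>) {..<n}"
      using sc by (intro M.add.finprod_cong') (auto simp: smult_one smult_zero_left)
    also have "\<dots> = m"
      using j sc M.add.finprod_singleton[of j "{..<n}" s] by auto
    finally have "?c ?d = m" .
    moreover have "?d \<in> ?X" by auto
    ultimately show "m \<in> ?c ` ?X" by (intro image_eqI[where x = ?d]) simp_all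
  qed
  from gen[OF sub this] have "carrier M = ?c ` ?X" by simp
  then show thesis
    using that[of s n] sc by blast
qed

end

definition transport_module :: "('m \<Rightarrow> 'n) \<Rightarrow> ('a, 'm) module \<Rightarrow> ('a, 'n) module" where
  "transport_module g M =
     (let k = inv_into (carrier M) g
      in \<lparr>carrier = g ` carrier M,
          monoid.mult = undefined,
          one = undefined,
          zero = g \<zero>\<^bsub>M\<^esub>,
          add = (\<lambda>x y. g (k x \<oplus>\<^bsub>M\<^esub> k y)),
          smult = (\<lambda>a x. g (a \<odot>\<^bsub>M\<^esub> k x))\<rparr>)"

lemma (in right_module) transport:
  assumes inj: "inj_on g (carrier M)"
  shows "right_module A (transport_module g M)"
    and "g \<in> mod_hom A M (transport_module g M)"
    and "fin_gen A M \<Longrightarrow> fin_gen A (transport_module g M)"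
proof -
  let ?N = "transport_module g M"
  have carr: "carrier ?N = g ` carrier M" and zero: "\<zero>\<^bsub>?N\<^esub> = g \<zero>\<^bsub>M\<^esub>"
    by (simp_all add: transport_module_def Let_def)
  have add: "g x \<oplus>\<^bsub>?N\<^esub> g y = g (x \<oplus>\<^bsub>M\<^esub> y)" if "x \<in> carrier M" "y \<in> carrier M" for x y
    using that inj by (simp add: transport_module_def Let_def)
  have smult: "a \<odot>\<^bsub>?N\<^esub> g x = g (a \<odot>\<^bsub>M\<^esub> x)" if "x \<in> carrier M" for a x
    using that inj by (simp add: transport_module_def Let_def)
  have grp: "abelian_group ?N"
  proof (rule abelian_groupI)
    show "\<exists>y \<in> carrier ?N. y \<oplus>\<^bsub>?N\<^esub> x = \<zero>\<^bsub>?N\<^esub>" if x: "x \<in> carrier ?N" for x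
    proof -
      obtain u where u: "u \<in> carrier M" "x = g u" using x carr by auto
      have "g (\<ominus>\<^bsub>M\<^esub> u) \<oplus>\<^bsub>?N\<^esub> x = \<zero>\<^bsub>?N\<^esub>"
        using u by (simp add: add zero M.l_neg)
      then show ?thesis using u carr by blast
    qed
    show "x \<oplus>\<^bsub>?N\<^esub> y = y \<oplus>\<^bsub>?N\<^esub> x" if "x \<in> carrier ?N" "y \<in> carrier ?N" for x y
      using that M.a_comm by (auto simp: carr add)
  qed (auto simp: carr zero add M.a_assoc)
  show "right_module A ?N"
    by (intro right_module.intro right_module_axioms.intro grp A.ring_axioms)
      (auto simp: carr add smult smult_closed smult_add smult_add_right smult_mult smult_one)
  show hom: "g \<in> mod_hom A M ?N"
    by (auto simp: mod_hom_def carr add smult)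
  interpret N: right_module A ?N by fact
  show "fin_gen A ?N" if fg: "fin_gen A M"
  proof -
    obtain S where S: "finite S" "S \<subseteq> carrier M"
      and gen: "\<And>U. submodule U A M \<Longrightarrow> S \<subseteq> U \<Longrightarrow> U = carrier M"
      using fg unfolding fin_gen_def by blast
    have "U = carrier ?N" if U: "submodule U A ?N" "g ` S \<subseteq> U" for U
    proof -
      let ?V = "{x \<in> carrier M. g x \<in> U}"
      interpret U: submodule U A ?N by fact
      have Uadd: "x \<oplus>\<^bsub>?N\<^esub> y \<in> U" if "x \<in> U" "y \<in> U" for x y
        using U.m_closed[OF that] by simp
      have Uzero: "\<zero>\<^bsub>?N\<^esub> \<in> U" using U.one_closed by simp
      have "submodule ?V A M"
      proof (intro submodule.intro submodule_axioms.intro M.add.subgroupI)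
        show "?V \<noteq> {}" using Uzero zero by auto
        show "\<ominus>\<^bsub>M\<^esub> x \<in> ?V" if "x \<in> ?V" for x
        proof -
          have x: "x \<in> carrier M" "g x \<in> U" using that by auto
          have "\<ominus>\<^bsub>M\<^esub> x = (\<ominus>\<^bsub>A\<^esub> \<one>\<^bsub>A\<^esub>) \<odot>\<^bsub>M\<^esub> x"
            using a_inv_eq_smult x by simp
          moreover have "g ((\<ominus>\<^bsub>A\<^esub> \<one>\<^bsub>A\<^esub>) \<odot>\<^bsub>M\<^esub> x) \<in> U"
            using U.smult_closed[of "\<ominus>\<^bsub>A\<^esub> \<one>\<^bsub>A\<^esub>" "g x"] x smult by simp
          ultimately show ?thesis using x smult_closed by simp
        qed
        show "x \<oplus>\<^bsub>M\<^esub> y \<in> ?V" if "x \<in> ?V" "y \<in> ?V" for x y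
          using that Uadd[of "g x" "g y"] add[of x y] by auto
        show "a \<odot>\<^bsub>M\<^esub> x \<in> ?V" if "a \<in> carrier A" "x \<in> ?V" for a x
          using that U.smult_closed[of a "g x"] smult[of x a] smult_closed by auto
      qed auto
      from gen[OF this] have "?V = carrier M" using U(2) S(2) by auto
      moreover have "U \<subseteq> carrier ?N" using U.subset by simp
      ultimately show ?thesis using carr by auto
    qed
    moreover have "finite (g ` S)" "g ` S \<subseteq> carrier ?N"
      using S carr by auto
    ultimately show ?thesis unfolding fin_gen_def by blast
  qed
qed

theorem mod_cat_representative:
  assumes "right_module A M" and "fin_gen A M"
  shows "\<exists>N \<in> mod_cat A. mod_iso A M N"
proof -
  interpret right_module A M by fact
  obtain n :: nat and s where
    ex: "\<And>m. m \<in> carrier M \<Longrightarrow>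
      \<exists>x \<in> {..<n} \<rightarrow> carrier A. m = finsum M (\<lambda>i. x i \<odot>\<^bsub>M\<^esub> s i) {..<n}"
    using fin_gen_coefficients[OF assms(2)] by metis
  then obtain g where g: "\<And>m. m \<in> carrier M \<Longrightarrow> m = finsum M (\<lambda>i. g m i \<odot>\<^bsub>M\<^esub> s i) {..<n}"
    by metis
  have inj: "inj_on g (carrier M)"
    by (rule inj_onI) (metis g)
  have "bij_betw g (carrier M) (carrier (transport_module g M))"
    using inj by (simp add: bij_betw_def transport_module_def Let_def)
  then show ?thesis
    using transport[OF inj] assms(2) unfolding mod_cat_def mod_iso_def by blast
qed

end

theory Submission
  imports Defs
begin

text \<open>
  Over \<open>A = KQ/J\<^sup>2\<close> the syzygy of every module lies in the radical of its projective cover, hence is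
  annihilated by the radical and therefore a direct sum of simple modules.  So \<open>\<Omega>\<close> maps all of \<open>K\<^sub>0(A)\<close> into the
  subgroup \<open>H\<close> generated by the simple modules, which is \<open>\<langle>add A\<^sub>0\<rangle>\<close>, and \<open>\<Omega>\<^bsup>l+1+s\<^esup>\<langle>add M\<rangle> \<subseteq> \<Omega>\<^bsup>l+s\<^esup>\<langle>add A\<^sub>0\<rangle>\<close>
  gives \<open>\<phi>(M) \<le> \<phi>(A\<^sub>0) + 1\<close> as soon as the minimum defining \<open>\<phi>(A\<^sub>0)\<close> is attained.  It is, because \<open>H\<close> is finitely
  generated, so that the kernels of the powers of \<open>\<Omega>\<close> on \<open>H\<close> become stationary.
\<close>

section \<open>Chains of subgroups of a finitely generated abelian group\<close>

text \<open>\<open>syzygy\<close> and \<open>Omega_bar\<close> are fixed by choice operators, so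
  neither has any property until something meeting its description is exhibited. This shapes the
  proof: every finitely generated module needs a projective cover, its kernel must again be finitely
  generated and be determined up to isomorphism, and covers must be additive over direct sums; only
  then does an endomorphism of \<open>K0 A\<close> with the required values exist. For the covers
  the path algebra itself is inconvenient, being infinite dimensional as soon as the quiver has an
  oriented cycle. The module theory therefore runs over an abstract ring with a square-zero ideal
  \<open>I\<close> and idempotents \<open>e v\<close> such that an element of \<open>e v A\<close>
  outside \<open>I\<close> can be multiplied back to \<open>e v\<close> modulo \<open>I\<close>.
  Square zero gives Nakayama's lemma directly, and the inversion makes modules killed by
  \<open>I\<close> behave like vector spaces, with exchange of generators in place of dimensions. A
  second constraint is the carrier type of \<open>mod_cat\<close>: direct sums and complements
  inside \<open>A0\<close> live on other types and are brought back by isomorphic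
  representatives.\<close>

lemma int_subgroup_chain_stationary:
  fixes I :: "nat \<Rightarrow> int set"
  assumes zero: "\<And>n. 0 \<in> I n"
    and diff: "\<And>n x y. x \<in> I n \<Longrightarrow> y \<in> I n \<Longrightarrow> x - y \<in> I n"
    and mult: "\<And>n x z. x \<in> I n \<Longrightarrow> x * z \<in> I n"
    and mono: "\<And>m n. m \<le> n \<Longrightarrow> I m \<subseteq> I n"
  shows "\<exists>l. \<forall>m\<ge>l. I m = I l"
proof (cases "\<exists>n. \<exists>d \<in> I n. d \<noteq> 0")
  case False
  then have "I n = {0}" for n using zero by auto
  then show ?thesis by auto
next
  case True
  then obtain n d where nd: "d \<in> I n" "d \<noteq> 0" by blast
  then have "\<bar>d\<bar> \<in> I n" using mult[of d n "sgn d"] by (simp add: abs_sgn)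
  then have "\<exists>k::nat. k > 0 \<and> (\<exists>n. int k \<in> I n)"
    using nd(2) by (intro exI[of _ "nat \<bar>d\<bar>"]) auto
  \<comment> \<open>The least positive integer in the union of the chain generates that union, so
    the chain is constant from any index \<open>l\<close> at which \<open>k\<close> has
    appeared.\<close>
  then obtain k :: nat where k: "k > 0" "\<exists>n. int k \<in> I n"
    and least: "\<And>j. j < k \<Longrightarrow> \<not> (j > 0 \<and> (\<exists>n. int j \<in> I n))"
    using exists_least_iff[of "\<lambda>k::nat. k > 0 \<and> (\<exists>n. int k \<in> I n)"] by blast
  then obtain l where l: "int k \<in> I l" by blast
  have "I m \<subseteq> I l" if "m \<ge> l" for m
  proof
    fix x assume x: "x \<in> I m"
    have "int k \<in> I m" using mono[OF that] l by blast
    \<comment> \<open>A nonzero remainder would be a smaller positive member of the chain.\<close>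
    from diff[OF x mult[OF this, of "x div int k"]] have "x mod int k \<in> I m"
      by (simp add: minus_mult_div_eq_mod)
    moreover have "x mod int k = int (nat (x mod int k))" "nat (x mod int k) < k"
      using k(1) by (simp_all add: nat_less_iff)
    ultimately have "x mod int k = 0"
      using least[of "nat (x mod int k)"] by (metis gr0I of_nat_0)
    then show "x \<in> I l" using mult[OF l, of "x div int k"] by (simp add: mod_0_imp_dvd)
  qed
  then show ?thesis using mono by blast
qed

text \<open>By commutativity the products \<open>g [^] k \<otimes> h\<close> already form a
  subgroup. The exponent \<open>k\<close> is the integer coordinate along the new generator in the
  induction that follows.\<close>

lemma (in comm_group) generate_insert_subset:
  assumes "g \<in> carrier G" "S \<subseteq> carrier G"
  shows "generate G (insert g S) \<subseteq> {g [^] (k::int) \<otimes> h | k h. h \<in> generate G S}" (is "_ \<subseteq> ?R")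
proof (rule generate_subgroup_incl)
  have S: "subgroup (generate G S) G" using generate_is_subgroup[OF assms(2)] .
  have gc: "h \<in> carrier G" if "h \<in> generate G S" for h
    using generate_in_carrier[OF assms(2) that] .
  show "insert g S \<subseteq> ?R"
  proof
    fix x assume "x \<in> insert g S"
    then show "x \<in> ?R"
    proof
      assume "x = g"
      then show ?thesis using assms subgroup.one_closed[OF S]
        by (intro CollectI exI[of _ "1::int"] exI[of _ "\<one>"]) auto
    next
      assume "x \<in> S"
      then show ?thesis using assms generate.incl[of x S G]
        by (intro CollectI exI[of _ "0::int"] exI[of _ x]) auto
    qed
  qed
  show "subgroup ?R G"
  proof (rule subgroupI)
    show "?R \<subseteq> carrier G" using gc assms by auto
    show "?R \<noteq> {}" using subgroup.one_closed[OF S] by blast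
    show "inv x \<in> ?R" if "x \<in> ?R" for x
    proof -
      from that obtain k :: int and h where x: "x = g [^] k \<otimes> h" "h \<in> generate G S" by blast
      then have "inv x = g [^] (- k) \<otimes> inv h"
        using assms gc by (simp add: inv_mult int_pow_neg)
      then show ?thesis using subgroup.m_inv_closed[OF S x(2)] by blast
    qed
    show "x \<otimes> y \<in> ?R" if "x \<in> ?R" "y \<in> ?R" for x y
    proof -
      from that obtain k k' :: int and h h' where x: "x = g [^] k \<otimes> h" "h \<in> generate G S"
        and y: "y = g [^] k' \<otimes> h'" "h' \<in> generate G S" by blast
      then have "x \<otimes> y = g [^] (k + k') \<otimes> (h \<otimes> h')"
        using assms gc by (simp add: int_pow_mult m_ac)
      then show ?thesis using subgroup.m_closed[OF S x(2) y(2)] by blast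
    qed
  qed
qed

text \<open>Finitely generated abelian groups are noetherian. When \<open>g\<close> joins
  \<open>S\<close>, a subgroup \<open>C n\<close> is controlled by two pieces: its intersection with
  \<open>generate G S\<close>, settled by induction, and the integers that occur as exponents of
  \<open>g\<close>, settled by the chain condition for the integers.\<close>

lemma (in comm_group) subgroup_chain_stationary:
  assumes "finite S" "S \<subseteq> carrier G" "\<And>n. subgroup (C n) G" "\<And>n. C n \<subseteq> generate G S"
    and "\<And>m n. m \<le> n \<Longrightarrow> C m \<subseteq> C n"
  shows "\<exists>l. \<forall>m\<ge>l. C m = C (l::nat)"
  using assms
proof (induction S arbitrary: C rule: finite_induct)
  case empty
  then have "C n = {\<one>}" for n
    using subgroup.one_closed[OF empty(2)] generate_empty by blast
  then show ?case by auto
next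
  case (insert g S)
  then have g: "g \<in> carrier G" and S: "S \<subseteq> carrier G" by auto
  let ?H = "generate G S"
  have H: "subgroup ?H G" using generate_is_subgroup[OF S] .
  have gc: "h \<in> carrier G" if "h \<in> ?H" for h using generate_in_carrier[OF S that] .
  have Cc: "c \<in> carrier G" if "c \<in> C n" for c n using subgroup.mem_carrier[OF insert.prems(2) that] .
  have "\<exists>l. \<forall>m\<ge>l. C m \<inter> ?H = C l \<inter> ?H"
  proof (rule insert.IH[OF S])
    show "C m \<inter> ?H \<subseteq> C n \<inter> ?H" if "m \<le> n" for m n
      using insert.prems(4)[OF that] by blast
  qed (use insert.prems(2) H in \<open>auto intro!: subgroups_Inter_pair\<close>)
  then obtain l1 where l1: "\<And>m. m \<ge> l1 \<Longrightarrow> C m \<inter> ?H = C l1 \<inter> ?H" by blast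
  \<comment> \<open>The exponent in a representation \<open>g [^] k \<otimes> h\<close> is not
    unique; collecting all of them makes \<open>I n\<close> an ideal of the integers.\<close>
  define I where "I n = {k::int. \<exists>h \<in> ?H. g [^] k \<otimes> h \<in> C n}" for n
  have "\<exists>l. \<forall>m\<ge>l. I m = I l"
  proof (rule int_subgroup_chain_stationary)
    show "0 \<in> I n" for n
      unfolding I_def using subgroup.one_closed[OF H] subgroup.one_closed[OF insert.prems(2)] g
      by (intro CollectI bexI[of _ "\<one>"]) auto
    show "x - y \<in> I n" if "x \<in> I n" "y \<in> I n" for n x y
    proof -
      from that obtain h h' where h: "h \<in> ?H" "g [^] x \<otimes> h \<in> C n" "h' \<in> ?H" "g [^] y \<otimes> h' \<in> C n"
        unfolding I_def by blast
      have "g [^] (x - y) \<otimes> (h \<otimes> inv h') = (g [^] x \<otimes> h) \<otimes> inv (g [^] y \<otimes> h')"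
        using g gc h by (simp add: inv_mult int_pow_diff m_ac)
      then show ?thesis unfolding I_def using h H insert.prems(2)[of n]
        by (auto intro!: bexI[of _ "h \<otimes> inv h'"] simp: subgroup.m_closed subgroup.m_inv_closed)
    qed
    show "x * z \<in> I n" if "x \<in> I n" for n x z
    proof -
      from that obtain h where h: "h \<in> ?H" "g [^] x \<otimes> h \<in> C n" unfolding I_def by blast
      have "g [^] (x * z) \<otimes> (h [^] z) = (g [^] x \<otimes> h) [^] z"
        using g gc h by (simp add: int_pow_distrib int_pow_pow)
      then show ?thesis unfolding I_def using h H insert.prems(2)[of n]
        by (auto intro!: bexI[of _ "h [^] z"] simp: subgroup_int_pow_closed)
    qed
    show "I m \<subseteq> I n" if "m \<le> n" for m n
      unfolding I_def using insert.prems(4)[OF that] by blast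
  qed
  then obtain l2 where l2: "\<And>m. m \<ge> l2 \<Longrightarrow> I m = I l2" by blast
  define l where "l = max l1 l2"
  have "C m \<subseteq> C l" if m: "m \<ge> l" for m
  proof
    fix c assume c: "c \<in> C m"
    then have "c \<in> generate G (insert g S)" using insert.prems(3) by blast
    then obtain k :: int and h where kh: "c = g [^] k \<otimes> h" "h \<in> ?H"
      using generate_insert_subset[OF g S] by blast
    then have "k \<in> I m" unfolding I_def using c by blast
    then have "k \<in> I l" using l2[of m] l2[of l] m l_def by simp
    then obtain h' where h': "h' \<in> ?H" "g [^] k \<otimes> h' \<in> C l" unfolding I_def by blast
    \<comment> \<open>Two elements with the same exponent of \<open>g\<close> differ by an element
      of \<open>?H\<close>. It lies in \<open>C m\<close>, hence in \<open>C l\<close>, since the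
      intersections with \<open>?H\<close> are stationary.\<close>
    have "(g [^] k \<otimes> h) \<otimes> inv (g [^] k \<otimes> h') = (g [^] k \<otimes> inv (g [^] k)) \<otimes> (h \<otimes> inv h')"
      using g gc kh h' by (simp add: inv_mult m_ac del: r_inv)
    then have eq: "h \<otimes> inv h' = c \<otimes> inv (g [^] k \<otimes> h')"
      using g gc kh h' by simp
    have "h \<otimes> inv h' \<in> C m"
      unfolding eq using c h' insert.prems(2)[of m] insert.prems(4)[OF m]
      by (blast intro: subgroup.m_closed subgroup.m_inv_closed)
    moreover have "h \<otimes> inv h' \<in> ?H"
      using kh h' H by (simp add: subgroup.m_closed subgroup.m_inv_closed)
    ultimately have d: "h \<otimes> inv h' \<in> C l"
      using l1[of m] l1[of l] m l_def by auto
    have "c = (h \<otimes> inv h') \<otimes> (g [^] k \<otimes> h')"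
      unfolding eq using c h' Cc by (simp add: m_assoc)
    then show "c \<in> C l" using subgroup.m_closed[OF insert.prems(2) d h'(2)] by simp
  qed
  then show ?case using insert.prems(4) by blast
qed

text \<open>The kernels of the powers of \<open>h\<close> on \<open>generate G S\<close> ascend and
  stop at some \<open>l\<close>. Beyond \<open>l\<close>, if \<open>x\<close> and \<open>y\<close>
  are the images of \<open>a\<close> and \<open>b\<close> under \<open>h ^^ (l + s)\<close> and
  \<open>h x = h y\<close>, then \<open>a \<otimes> inv b\<close> lies in the next kernel, which is
  the same kernel, so \<open>x = y\<close>.\<close>

lemma (in comm_group) endomorphism_eventually_injective:
  assumes h: "h \<in> hom G G" and S: "finite S" "S \<subseteq> carrier G"
  shows "\<exists>l. \<forall>s. inj_on h ((h ^^ (l + s)) ` generate G S)"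
proof -
  let ?H = "generate G S"
  have H: "subgroup ?H G" using generate_is_subgroup[OF S(2)] .
  have pow: "(h ^^ n) \<in> hom G G" for n
    by (induction n) (use h in \<open>auto simp: hom_def Pi_iff\<close>)
  define C where "C n = {x \<in> ?H. (h ^^ n) x = \<one>}" for n
  have gh: "group_hom G G (h ^^ n)" for n
    using pow by unfold_locales
  have "\<exists>l. \<forall>m\<ge>l. C m = C l"
  proof (rule subgroup_chain_stationary[OF S])
    show "subgroup (C n) G" for n
    proof -
      have "C n = ?H \<inter> kernel G G (h ^^ n)"
        using subgroup.subset[OF H] by (auto simp: C_def kernel_def)
      then show ?thesis
        using subgroups_Inter_pair[OF H group_hom.subgroup_kernel[OF gh[of n]]] by simp
    qed
    show "C m \<subseteq> C n" if "m \<le> n" for m n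
    proof
      fix x assume "x \<in> C m"
      then have x: "x \<in> ?H" "(h ^^ m) x = \<one>" by (auto simp: C_def)
      have "(h ^^ n) x = (h ^^ (n - m)) ((h ^^ m) x)"
        using that by (metis funpow_add comp_apply le_add_diff_inverse2)
      then show "x \<in> C n" using x group_hom.hom_one[OF gh] by (simp add: C_def)
    qed
  qed (auto simp: C_def)
  then obtain l where l: "\<And>m. m \<ge> l \<Longrightarrow> C m = C l" by blast
  have "inj_on h ((h ^^ (l + s)) ` ?H)" for s
  proof (rule inj_onI)
    fix x y assume "x \<in> (h ^^ (l + s)) ` ?H" "y \<in> (h ^^ (l + s)) ` ?H" and eq: "h x = h y"
    then obtain a b where ab: "a \<in> ?H" "x = (h ^^ (l + s)) a" "b \<in> ?H" "y = (h ^^ (l + s)) b"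
      by blast
    then have c: "a \<in> carrier G" "b \<in> carrier G" using subgroup.mem_carrier[OF H] by auto
    have "(h ^^ Suc (l + s)) (a \<otimes> inv b) = \<one>"
    proof -
      have e: "(h ^^ Suc (l + s)) a = (h ^^ Suc (l + s)) b" using eq ab by simp
      show ?thesis
        using group_hom.hom_mult[OF gh[of "Suc (l+s)"], of a "inv b"]
          group_hom.hom_inv[OF gh[of "Suc (l+s)"], of b] group_hom.hom_closed[OF gh[of "Suc (l+s)"], of b]
          e c by (simp del: funpow.simps)
    qed
    then have "a \<otimes> inv b \<in> C (Suc (l + s))"
      using ab H by (simp add: C_def subgroup.m_closed subgroup.m_inv_closed del: funpow.simps)
    then have "a \<otimes> inv b \<in> C (l + s)" using l[of "Suc (l + s)"] l[of "l + s"] by simp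
    then have "x \<otimes> inv y = \<one>"
      using group_hom.hom_mult[OF gh[of "l+s"], of a "inv b"]
          group_hom.hom_inv[OF gh[of "l+s"], of b] c ab by (simp add: C_def)
    then show "x = y"
      using ab c group_hom.hom_closed[OF gh[of "l+s"]] by (metis inv_closed inv_equality inv_inv)
  qed
  then show ?thesis by blast
qed

section \<open>Submodules, homomorphisms and direct sums\<close>

lemma mem_set_add: "x \<in> U <+>\<^bsub>M\<^esub> W \<longleftrightarrow> (\<exists>u \<in> U. \<exists>w \<in> W. x = u \<oplus>\<^bsub>M\<^esub> w)"
  by (simp add: set_add_def')

definition submodule_hull :: "('a, 'x) ring_scheme \<Rightarrow> ('a, 'm) module \<Rightarrow> 'm set \<Rightarrow> 'm set" where
  "submodule_hull A M S = \<Inter>{U. submodule U A M \<and> S \<subseteq> U}"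

lemma submodule_hull_superset: "S \<subseteq> submodule_hull A M S"
  by (auto simp: submodule_hull_def)

lemma submodule_hull_least: "submodule U A M \<Longrightarrow> S \<subseteq> U \<Longrightarrow> submodule_hull A M S \<subseteq> U"
  by (auto simp: submodule_hull_def)

definition cyclic :: "('a, 'x) ring_scheme \<Rightarrow> ('a, 'm) module \<Rightarrow> 'm \<Rightarrow> 'm set" where
  "cyclic A M x = (\<lambda>a. a \<odot>\<^bsub>M\<^esub> x) ` carrier A"

lemma mod_homD:
  assumes "f \<in> mod_hom A M N"
  shows "x \<in> carrier M \<Longrightarrow> f x \<in> carrier N"
    and "x \<in> carrier M \<Longrightarrow> y \<in> carrier M \<Longrightarrow> f (x \<oplus>\<^bsub>M\<^esub> y) = f x \<oplus>\<^bsub>N\<^esub> f y"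
    and "a \<in> carrier A \<Longrightarrow> x \<in> carrier M \<Longrightarrow> f (a \<odot>\<^bsub>M\<^esub> x) = a \<odot>\<^bsub>N\<^esub> f x"
  using assms by (auto simp: mod_hom_def)

lemma mod_homI:
  assumes "\<And>x. x \<in> carrier M \<Longrightarrow> f x \<in> carrier N"
    and "\<And>x y. x \<in> carrier M \<Longrightarrow> y \<in> carrier M \<Longrightarrow> f (x \<oplus>\<^bsub>M\<^esub> y) = f x \<oplus>\<^bsub>N\<^esub> f y"
    and "\<And>a x. a \<in> carrier A \<Longrightarrow> x \<in> carrier M \<Longrightarrow> f (a \<odot>\<^bsub>M\<^esub> x) = a \<odot>\<^bsub>N\<^esub> f x"
  shows "f \<in> mod_hom A M N"
  using assms by (auto simp: mod_hom_def)

lemma mod_hom_compose: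
  "f \<in> mod_hom A M N \<Longrightarrow> g \<in> mod_hom A N L \<Longrightarrow> (\<lambda>x. g (f x)) \<in> mod_hom A M L"
  by (intro mod_homI) (simp_all add: mod_homD)

lemma mod_hom_id: "(\<lambda>x. x) \<in> mod_hom A M M"
  by (intro mod_homI) auto

lemma mod_iso_trans: "mod_iso A M N \<Longrightarrow> mod_iso A N L \<Longrightarrow> mod_iso A M L"
  unfolding mod_iso_def using mod_hom_compose bij_betw_trans unfolding comp_def by blast

lemma mod_iso_refl: "mod_iso A M M"
  unfolding mod_iso_def using mod_hom_id[of A M] by (intro bexI[of _ "\<lambda>x. x"]) (auto simp: bij_betw_def)

lemma mod_catD: "M \<in> mod_cat A \<Longrightarrow> right_module A M" "M \<in> mod_cat A \<Longrightarrow> fin_gen A M"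
  by (auto simp: mod_cat_def)

lemma bij_mod_hom_inverse:
  assumes M: "right_module A M" and f: "f \<in> mod_hom A M N" and b: "bij_betw f (carrier M) (carrier N)"
  shows "inv_into (carrier M) f \<in> mod_hom A N M"
    and "bij_betw (inv_into (carrier M) f) (carrier N) (carrier M)"
proof -
  interpret right_module A M by fact
  let ?g = "inv_into (carrier M) f"
  have g: "?g y \<in> carrier M" "f (?g y) = y" if "y \<in> carrier N" for y
    using b that by (auto simp: bij_betw_def inv_into_into f_inv_into_f)
  have gf: "?g (f x) = x" if "x \<in> carrier M" for x
    using b that by (auto simp: bij_betw_def)
  show "?g \<in> mod_hom A N M"
  proof (rule mod_homI)
    show "?g (x \<oplus>\<^bsub>N\<^esub> y) = ?g x \<oplus>\<^bsub>M\<^esub> ?g y" if "x \<in> carrier N" "y \<in> carrier N" for x y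
      using gf[of "?g x \<oplus>\<^bsub>M\<^esub> ?g y"] mod_homD(2)[OF f, of "?g x" "?g y"] g that by simp
    show "?g (a \<odot>\<^bsub>N\<^esub> x) = a \<odot>\<^bsub>M\<^esub> ?g x" if "a \<in> carrier A" "x \<in> carrier N" for a x
      using gf[of "a \<odot>\<^bsub>M\<^esub> ?g x"] mod_homD(3)[OF f, of a "?g x"] g that smult_closed by simp
  qed (use g in auto)
  show "bij_betw ?g (carrier N) (carrier M)" using b by (rule bij_betw_inv_into)
qed

lemma mod_iso_sym: "right_module A M \<Longrightarrow> mod_iso A M N \<Longrightarrow> mod_iso A N M"
  unfolding mod_iso_def using bij_mod_hom_inverse by blast

section \<open>Submodules, hulls and finite generation\<close>

context right_module
begin

lemma right_submoduleI:
  assumes "U \<subseteq> carrier M" "\<zero>\<^bsub>M\<^esub> \<in> U" "\<And>x y. x \<in> U \<Longrightarrow> y \<in> U \<Longrightarrow> x \<oplus>\<^bsub>M\<^esub> y \<in> U"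
    and "\<And>a x. a \<in> carrier A \<Longrightarrow> x \<in> U \<Longrightarrow> a \<odot>\<^bsub>M\<^esub> x \<in> U"
  shows "submodule U A M"
proof (intro submodule.intro submodule_axioms.intro M.add.subgroupI)
  show "\<ominus>\<^bsub>M\<^esub> x \<in> U" if "x \<in> U" for x
    using assms that a_inv_eq_smult[of x] by (metis A.a_inv_closed A.one_closed subsetD)
qed (use assms in auto)

lemma right_submoduleD:
  assumes "submodule U A M"
  shows "x \<in> U \<Longrightarrow> x \<in> carrier M" "U \<subseteq> carrier M" "\<zero>\<^bsub>M\<^esub> \<in> U"
    "x \<in> U \<Longrightarrow> y \<in> U \<Longrightarrow> x \<oplus>\<^bsub>M\<^esub> y \<in> U"
    "x \<in> U \<Longrightarrow> \<ominus>\<^bsub>M\<^esub> x \<in> U" "x \<in> U \<Longrightarrow> y \<in> U \<Longrightarrow> x \<ominus>\<^bsub>M\<^esub> y \<in> U"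
    "a \<in> carrier A \<Longrightarrow> x \<in> U \<Longrightarrow> a \<odot>\<^bsub>M\<^esub> x \<in> U"
proof -
  interpret U: submodule U A M by fact
  show s: "U \<subseteq> carrier M" using U.subset by simp
  then show "x \<in> U \<Longrightarrow> x \<in> carrier M" by blast
  show "\<zero>\<^bsub>M\<^esub> \<in> U" using U.one_closed by simp
  show add: "x \<oplus>\<^bsub>M\<^esub> y \<in> U" if "x \<in> U" "y \<in> U" for x y using U.m_closed that by simp
  show sm: "a \<odot>\<^bsub>M\<^esub> x \<in> U" if "a \<in> carrier A" "x \<in> U" for a x using that by simp
  have inv: "\<ominus>\<^bsub>M\<^esub> x \<in> U" if "x \<in> U" for x
    using a_inv_eq_smult[of x] that s sm by auto
  then show "x \<in> U \<Longrightarrow> \<ominus>\<^bsub>M\<^esub> x \<in> U" .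
  show "x \<ominus>\<^bsub>M\<^esub> y \<in> U" if "x \<in> U" "y \<in> U"
    unfolding a_minus_def using add inv that by blast
qed

lemma smult_a_inv_left:
  "a \<in> carrier A \<Longrightarrow> x \<in> carrier M \<Longrightarrow> (\<ominus>\<^bsub>A\<^esub> a) \<odot>\<^bsub>M\<^esub> x = \<ominus>\<^bsub>M\<^esub> (a \<odot>\<^bsub>M\<^esub> x)"
  by (metis A.a_inv_closed A.l_neg M.minus_equality smult_add smult_closed smult_zero_left)

lemma smult_diff:
  "a \<in> carrier A \<Longrightarrow> b \<in> carrier A \<Longrightarrow> x \<in> carrier M \<Longrightarrow>
    (a \<ominus>\<^bsub>A\<^esub> b) \<odot>\<^bsub>M\<^esub> x = a \<odot>\<^bsub>M\<^esub> x \<ominus>\<^bsub>M\<^esub> b \<odot>\<^bsub>M\<^esub> x"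
  by (simp add: a_minus_def smult_add smult_a_inv_left)

lemma diff_eq_zero_iff:
  "x \<in> carrier M \<Longrightarrow> y \<in> carrier M \<Longrightarrow> x \<ominus>\<^bsub>M\<^esub> y = \<zero>\<^bsub>M\<^esub> \<longleftrightarrow> x = y"
  by (metis M.a_inv_closed M.minus_equality M.minus_minus M.r_neg a_minus_def)

lemma add_eq_imp_diff_eq:
  assumes "x \<in> carrier M" "y \<in> carrier M" "z \<in> carrier M" "w \<in> carrier M"
    and "x \<oplus>\<^bsub>M\<^esub> y = z \<oplus>\<^bsub>M\<^esub> w"
  shows "x \<ominus>\<^bsub>M\<^esub> z = w \<ominus>\<^bsub>M\<^esub> y"
proof -
  have "x \<ominus>\<^bsub>M\<^esub> z = (x \<oplus>\<^bsub>M\<^esub> y) \<oplus>\<^bsub>M\<^esub> (\<ominus>\<^bsub>M\<^esub> z \<ominus>\<^bsub>M\<^esub> y)"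
    using assms(1-4) by (simp add: a_minus_def M.a_ac M.r_neg M.r_neg1 M.r_neg2)
  also have "\<dots> = w \<ominus>\<^bsub>M\<^esub> y"
    unfolding assms(5) using assms(1-4) by (simp add: a_minus_def M.a_ac M.r_neg M.r_neg1 M.r_neg2)
  finally show ?thesis .
qed

lemma submodule_carrier: "submodule (carrier M) A M"
  by (rule right_submoduleI) (auto intro: smult_closed)

lemma submodule_zero: "submodule {\<zero>\<^bsub>M\<^esub>} A M"
  by (rule right_submoduleI) (auto simp: smult_zero_right)

lemma submodule_Int: "submodule U A M \<Longrightarrow> submodule W A M \<Longrightarrow> submodule (U \<inter> W) A M"
  by (rule right_submoduleI) (auto dest: right_submoduleD)

lemma submodule_hull_submodule:
  assumes "S \<subseteq> carrier M" shows "submodule (submodule_hull A M S) A M"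
proof -
  have mem: "x \<in> submodule_hull A M S \<longleftrightarrow> (\<forall>U. submodule U A M \<and> S \<subseteq> U \<longrightarrow> x \<in> U)" for x
    by (auto simp: submodule_hull_def)
  show ?thesis
  proof (rule right_submoduleI)
    show "submodule_hull A M S \<subseteq> carrier M"
      using submodule_hull_least[OF submodule_carrier assms] .
    show "\<zero>\<^bsub>M\<^esub> \<in> submodule_hull A M S" unfolding mem using right_submoduleD(3) by blast
    show "x \<oplus>\<^bsub>M\<^esub> y \<in> submodule_hull A M S"
      if "x \<in> submodule_hull A M S" "y \<in> submodule_hull A M S" for x y
      using that right_submoduleD(4) unfolding mem by metis
    show "a \<odot>\<^bsub>M\<^esub> x \<in> submodule_hull A M S"
      if "a \<in> carrier A" "x \<in> submodule_hull A M S" for a x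
      using that right_submoduleD(7) unfolding mem by metis
  qed
qed

lemma submodule_hull_mono:
  "S \<subseteq> T \<Longrightarrow> submodule_hull A M S \<subseteq> submodule_hull A M T"
  by (auto simp: submodule_hull_def)

lemma submodule_hull_empty: "submodule_hull A M {} = {\<zero>\<^bsub>M\<^esub>}"
  using submodule_hull_least[OF submodule_zero, of "{}"]
    right_submoduleD(3)[OF submodule_hull_submodule[of "{}"]] by auto

text \<open>\<open>fin_gen\<close> quantifies over all submodules containing the generators; the
  hull turns this into one equation.\<close>

lemma fin_gen_iff_hull:
  "fin_gen A M \<longleftrightarrow> (\<exists>S. finite S \<and> S \<subseteq> carrier M \<and> submodule_hull A M S = carrier M)"
proof
  assume "fin_gen A M"
  then obtain S where S: "finite S" "S \<subseteq> carrier M"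
    "\<And>U. submodule U A M \<Longrightarrow> S \<subseteq> U \<Longrightarrow> U = carrier M"
    unfolding fin_gen_def by blast
  then show "\<exists>S. finite S \<and> S \<subseteq> carrier M \<and> submodule_hull A M S = carrier M"
    using S(3)[OF submodule_hull_submodule[OF S(2)] submodule_hull_superset] by blast
next
  assume "\<exists>S. finite S \<and> S \<subseteq> carrier M \<and> submodule_hull A M S = carrier M"
  then obtain S where S: "finite S" "S \<subseteq> carrier M" "submodule_hull A M S = carrier M" by blast
  have "U = carrier M" if "submodule U A M" "S \<subseteq> U" for U
    using submodule_hull_least[OF that] right_submoduleD(2)[OF that(1)] S(3) by simp
  then show "fin_gen A M"
    unfolding fin_gen_def using S(1,2) by blast
qed

lemma submodule_sum:
  assumes "submodule U A M" "submodule W A M"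
  shows "submodule (U <+>\<^bsub>M\<^esub> W) A M"
proof (rule right_submoduleI)
  note U = right_submoduleD[OF assms(1)] and W = right_submoduleD[OF assms(2)]
  show "U <+>\<^bsub>M\<^esub> W \<subseteq> carrier M" using U W by (auto simp: set_add_def')
  show "\<zero>\<^bsub>M\<^esub> \<in> U <+>\<^bsub>M\<^esub> W" using U(3) W(3) M.r_zero[OF M.zero_closed] unfolding mem_set_add by metis
  show "x \<oplus>\<^bsub>M\<^esub> y \<in> U <+>\<^bsub>M\<^esub> W" if "x \<in> U <+>\<^bsub>M\<^esub> W" "y \<in> U <+>\<^bsub>M\<^esub> W" for x y
  proof -
    from that obtain u w u' w' where uw: "u \<in> U" "w \<in> W" "x = u \<oplus>\<^bsub>M\<^esub> w" "u' \<in> U" "w' \<in> W" "y = u' \<oplus>\<^bsub>M\<^esub> w'"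
      by (auto simp: set_add_def')
    then have "x \<oplus>\<^bsub>M\<^esub> y = (u \<oplus>\<^bsub>M\<^esub> u') \<oplus>\<^bsub>M\<^esub> (w \<oplus>\<^bsub>M\<^esub> w')"
      using U(1) W(1) by (simp add: M.a_ac)
    then show ?thesis using U(4)[OF uw(1,4)] W(4)[OF uw(2,5)] unfolding mem_set_add by blast
  qed
  show "a \<odot>\<^bsub>M\<^esub> x \<in> U <+>\<^bsub>M\<^esub> W" if "a \<in> carrier A" "x \<in> U <+>\<^bsub>M\<^esub> W" for a x
  proof -
    from that(2) obtain u w where uw: "u \<in> U" "w \<in> W" "x = u \<oplus>\<^bsub>M\<^esub> w"
      by (auto simp: set_add_def')
    then have "a \<odot>\<^bsub>M\<^esub> x = a \<odot>\<^bsub>M\<^esub> u \<oplus>\<^bsub>M\<^esub> a \<odot>\<^bsub>M\<^esub> w"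
      using that(1) U(1) W(1) by (simp add: smult_add_right)
    then show ?thesis using U(7)[OF that(1) uw(1)] W(7)[OF that(1) uw(2)] unfolding mem_set_add by blast
  qed
qed

lemma subset_submodule_sum:
  assumes "submodule U A M" "submodule W A M"
  shows "U \<subseteq> U <+>\<^bsub>M\<^esub> W" "W \<subseteq> U <+>\<^bsub>M\<^esub> W"
proof -
  note U = right_submoduleD[OF assms(1)] and W = right_submoduleD[OF assms(2)]
  show "U \<subseteq> U <+>\<^bsub>M\<^esub> W"
  proof
    fix x assume "x \<in> U"
    then show "x \<in> U <+>\<^bsub>M\<^esub> W" using U(1) W(3) M.r_zero[of x] unfolding mem_set_add by metis
  qed
  show "W \<subseteq> U <+>\<^bsub>M\<^esub> W"
  proof
    fix x assume "x \<in> W"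
    then show "x \<in> U <+>\<^bsub>M\<^esub> W" using W(1) U(3) M.l_zero[of x] unfolding mem_set_add by metis
  qed
qed

lemma cyclic_submodule:
  assumes x: "x \<in> carrier M"
  shows "submodule (cyclic A M x) A M"
proof (rule right_submoduleI)
  show "cyclic A M x \<subseteq> carrier M" using x by (auto simp: cyclic_def smult_closed)
  show "\<zero>\<^bsub>M\<^esub> \<in> cyclic A M x" using smult_zero_left[OF x] by (metis cyclic_def A.zero_closed image_eqI)
  show "u \<oplus>\<^bsub>M\<^esub> v \<in> cyclic A M x" if "u \<in> cyclic A M x" "v \<in> cyclic A M x" for u v
    using that x by (auto simp: cyclic_def smult_add[symmetric])
  show "b \<odot>\<^bsub>M\<^esub> u \<in> cyclic A M x" if "b \<in> carrier A" "u \<in> cyclic A M x" for b u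
    using that x by (auto simp: cyclic_def smult_mult[symmetric])
qed

lemma mem_cyclic: "x \<in> carrier M \<Longrightarrow> x \<in> cyclic A M x"
  unfolding cyclic_def using smult_one[of x] by (metis A.one_closed image_eqI)

lemma cyclic_subset: "submodule U A M \<Longrightarrow> x \<in> U \<Longrightarrow> cyclic A M x \<subseteq> U"
  by (auto simp: cyclic_def right_submoduleD)

text \<open>This is how a single generator is peeled off in the later inductions over finite
  generating sets.\<close>

lemma submodule_hull_insert:
  assumes "x \<in> carrier M" "S \<subseteq> carrier M"
  shows "submodule_hull A M (insert x S) = cyclic A M x <+>\<^bsub>M\<^esub> submodule_hull A M S"
proof
  let ?H = "submodule_hull A M"
  have H: "submodule (?H S) A M" and H': "submodule (?H (insert x S)) A M"
    using assms by (auto intro: submodule_hull_submodule)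
  note C = cyclic_submodule[OF assms(1)]
  show "?H (insert x S) \<subseteq> cyclic A M x <+>\<^bsub>M\<^esub> ?H S"
    by (rule submodule_hull_least[OF submodule_sum[OF C H]])
      (use subset_submodule_sum[OF C H] mem_cyclic[OF assms(1)] submodule_hull_superset[of S A M] in auto)
  have "cyclic A M x \<subseteq> ?H (insert x S)"
    by (rule cyclic_subset[OF H']) (use submodule_hull_superset[of "insert x S" A M] in auto)
  moreover have "?H S \<subseteq> ?H (insert x S)" by (rule submodule_hull_mono) auto
  ultimately show "cyclic A M x <+>\<^bsub>M\<^esub> ?H S \<subseteq> ?H (insert x S)"
    using right_submoduleD(4)[OF H'] by (auto simp: set_add_def')
qed

lemma right_module_submodule:
  assumes "submodule U A M" shows "right_module A (M\<lparr>carrier := U\<rparr>)"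
proof -
  note U = right_submoduleD[OF assms]
  have "abelian_group (M\<lparr>carrier := U\<rparr>)"
  proof (rule abelian_groupI)
    show "\<exists>y \<in> carrier (M\<lparr>carrier := U\<rparr>). y \<oplus>\<^bsub>M\<lparr>carrier := U\<rparr>\<^esub> x = \<zero>\<^bsub>M\<lparr>carrier := U\<rparr>\<^esub>"
      if "x \<in> carrier (M\<lparr>carrier := U\<rparr>)" for x
      using that U(1,5) by (auto intro!: bexI[of _ "\<ominus>\<^bsub>M\<^esub> x"] simp: M.l_neg)
  qed (use U(1,3,4) in \<open>auto simp: M.a_ac\<close>)
  then show ?thesis
    by (intro right_module.intro right_module_axioms.intro A.ring_axioms)
      (use U(1,7) in \<open>auto simp: smult_add smult_add_right smult_mult smult_one\<close>)
qed

text \<open>The restricted record shares all operations with \<open>M\<close>; this moves hulls and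
  finite generation between a submodule and its ambient module.\<close>

lemma submodule_restrict_iff:
  assumes "submodule U A M"
  shows "submodule W A (M\<lparr>carrier := U\<rparr>) \<longleftrightarrow> submodule W A M \<and> W \<subseteq> U"
proof -
  interpret U: right_module A "M\<lparr>carrier := U\<rparr>" using right_module_submodule[OF assms] .
  show ?thesis
  proof
    assume W: "submodule W A (M\<lparr>carrier := U\<rparr>)"
    note D = U.right_submoduleD[OF W]
    show "submodule W A M \<and> W \<subseteq> U"
      using D right_submoduleD(2)[OF assms] by (auto intro!: right_submoduleI)
  next
    assume "submodule W A M \<and> W \<subseteq> U"
    then show "submodule W A (M\<lparr>carrier := U\<rparr>)"
      by (intro U.right_submoduleI) (auto dest: right_submoduleD)
  qed
qed

lemma submodule_hull_restrict:
  assumes "submodule U A M" "S \<subseteq> U"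
  shows "submodule_hull A (M\<lparr>carrier := U\<rparr>) S = submodule_hull A M S"
proof
  interpret U: right_module A "M\<lparr>carrier := U\<rparr>" using right_module_submodule[OF assms(1)] .
  have SM: "S \<subseteq> carrier M" using assms right_submoduleD(2) by blast
  show "submodule_hull A (M\<lparr>carrier := U\<rparr>) S \<subseteq> submodule_hull A M S"
    by (rule submodule_hull_least)
      (use submodule_hull_submodule[OF SM] submodule_hull_least[OF assms] submodule_hull_superset[of S A M]
        in \<open>auto simp: submodule_restrict_iff[OF assms(1)]\<close>)
  show "submodule_hull A M S \<subseteq> submodule_hull A (M\<lparr>carrier := U\<rparr>) S"
    by (rule submodule_hull_least)
      (use U.submodule_hull_submodule[of S] submodule_hull_superset[of S A "M\<lparr>carrier := U\<rparr>"] assms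
        in \<open>auto simp: submodule_restrict_iff[OF assms(1)]\<close>)
qed

lemma fin_gen_submodule_iff:
  assumes "submodule U A M"
  shows "fin_gen A (M\<lparr>carrier := U\<rparr>) \<longleftrightarrow> (\<exists>S. finite S \<and> S \<subseteq> U \<and> submodule_hull A M S = U)"
proof -
  interpret U: right_module A "M\<lparr>carrier := U\<rparr>" using right_module_submodule[OF assms] .
  show ?thesis unfolding U.fin_gen_iff_hull using submodule_hull_restrict[OF assms] by auto
qed

lemma fin_gen_zero: "fin_gen A (M\<lparr>carrier := {\<zero>\<^bsub>M\<^esub>}\<rparr>)"
  unfolding fin_gen_submodule_iff[OF submodule_zero] by (intro exI[of _ "{}"]) (simp add: submodule_hull_empty)

lemma cyclic_eq_hull:
  assumes "x \<in> carrier M" shows "submodule_hull A M {x} = cyclic A M x"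
  using submodule_hull_least[OF cyclic_submodule[OF assms], of "{x}"] mem_cyclic[OF assms]
    cyclic_subset[OF submodule_hull_submodule[of "{x}"], of x] assms submodule_hull_superset[of "{x}" A M]
  by blast

lemma fin_gen_cyclic:
  assumes "x \<in> carrier M" shows "fin_gen A (M\<lparr>carrier := cyclic A M x\<rparr>)"
  unfolding fin_gen_submodule_iff[OF cyclic_submodule[OF assms]]
  by (intro exI[of _ "{x}"]) (simp add: cyclic_eq_hull mem_cyclic assms)

end

lemma mod_cat_submodule:
  assumes "M \<in> mod_cat A" "submodule U A M" "fin_gen A (M\<lparr>carrier := U\<rparr>)"
  shows "M\<lparr>carrier := U\<rparr> \<in> mod_cat A"
  using assms right_module.right_module_submodule by (auto simp: mod_cat_def)

section \<open>Homomorphisms of right modules\<close>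

locale module_hom = dom: right_module A M + cod: right_module A N
  for A :: "('a, 'x) ring_scheme" and M :: "('a, 'm) module" and N :: "('a, 'n) module" +
  fixes f assumes hom: "f \<in> mod_hom A M N"
begin

lemma hom_closed: "x \<in> carrier M \<Longrightarrow> f x \<in> carrier N" by (rule mod_homD(1)[OF hom])
lemma hom_add: "x \<in> carrier M \<Longrightarrow> y \<in> carrier M \<Longrightarrow> f (x \<oplus>\<^bsub>M\<^esub> y) = f x \<oplus>\<^bsub>N\<^esub> f y"
  by (rule mod_homD(2)[OF hom])
lemma hom_smult: "a \<in> carrier A \<Longrightarrow> x \<in> carrier M \<Longrightarrow> f (a \<odot>\<^bsub>M\<^esub> x) = a \<odot>\<^bsub>N\<^esub> f x"
  by (rule mod_homD(3)[OF hom])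

lemma hom_zero: "f \<zero>\<^bsub>M\<^esub> = \<zero>\<^bsub>N\<^esub>"
  using hom_smult[of "\<zero>\<^bsub>A\<^esub>" "\<zero>\<^bsub>M\<^esub>"] hom_closed[of "\<zero>\<^bsub>M\<^esub>"]
  by (simp add: dom.smult_zero_left cod.smult_zero_left)

lemma hom_a_inv: "x \<in> carrier M \<Longrightarrow> f (\<ominus>\<^bsub>M\<^esub> x) = \<ominus>\<^bsub>N\<^esub> f x"
  by (simp add: dom.a_inv_eq_smult cod.a_inv_eq_smult hom_smult hom_closed)

lemma hom_diff: "x \<in> carrier M \<Longrightarrow> y \<in> carrier M \<Longrightarrow> f (x \<ominus>\<^bsub>M\<^esub> y) = f x \<ominus>\<^bsub>N\<^esub> f y"
  by (simp add: a_minus_def hom_add hom_a_inv)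

lemma submodule_image:
  assumes "submodule U A M" shows "submodule (f ` U) A N"
proof -
  note U = dom.right_submoduleD[OF assms]
  show ?thesis
  proof (rule cod.right_submoduleI)
    show "\<zero>\<^bsub>N\<^esub> \<in> f ` U" using U(3) hom_zero by (metis image_eqI)
  qed (use U(1,4,7) hom_closed in \<open>auto simp: hom_add[symmetric] hom_smult[symmetric]\<close>)
qed

lemma submodule_preimage:
  assumes "submodule W A N" shows "submodule {x \<in> carrier M. f x \<in> W} A M"
  by (rule dom.right_submoduleI)
    (use cod.right_submoduleD[OF assms] in \<open>auto simp: hom_zero hom_add hom_smult dom.smult_closed\<close>)

lemma submodule_kernel: "submodule (mod_kernel M N f) A M"
  using submodule_preimage[OF cod.submodule_zero] by (simp add: mod_kernel_def)

lemma mem_kernel: "x \<in> mod_kernel M N f \<longleftrightarrow> x \<in> carrier M \<and> f x = \<zero>\<^bsub>N\<^esub>"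
  by (simp add: mod_kernel_def)

lemma fin_gen_image:
  assumes "fin_gen A M" "f ` carrier M = carrier N" shows "fin_gen A N"
proof -
  obtain S where S: "finite S" "S \<subseteq> carrier M"
    and gen: "\<And>U. submodule U A M \<Longrightarrow> S \<subseteq> U \<Longrightarrow> U = carrier M"
    using assms(1) unfolding fin_gen_def by blast
  have "U = carrier N" if "submodule U A N" "f ` S \<subseteq> U" for U
  proof -
    have "{x \<in> carrier M. f x \<in> U} = carrier M"
      by (rule gen[OF submodule_preimage[OF that(1)]]) (use S that in auto)
    then have "f ` carrier M \<subseteq> U" by blast
    then show ?thesis using assms(2) cod.right_submoduleD(2)[OF that(1)] by simp
  qed
  then show ?thesis unfolding fin_gen_def using S hom_closed by (intro exI[of _ "f ` S"]) auto
qed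

lemma restrict_hom:
  assumes "submodule U A M" "submodule W A N" "f ` U \<subseteq> W"
  shows "f \<in> mod_hom A (M\<lparr>carrier := U\<rparr>) (N\<lparr>carrier := W\<rparr>)"
  using assms dom.right_submoduleD(1)[OF assms(1)]
  by (intro mod_homI) (auto simp: hom_add hom_smult)

end

lemma fin_gen_iso:
  assumes "right_module A M" "right_module A N" "mod_iso A M N" "fin_gen A M"
  shows "fin_gen A N"
proof -
  obtain f where f: "f \<in> mod_hom A M N" "bij_betw f (carrier M) (carrier N)"
    using assms(3) unfolding mod_iso_def by blast
  then interpret module_hom A M N f using assms by (simp add: module_hom_def module_hom_axioms_def)
  show ?thesis using fin_gen_image assms f by (simp add: bij_betw_def)
qed

section \<open>External and internal direct sums\<close>

lemma mod_sum_simps: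
  "carrier (mod_sum M N) = carrier M \<times> carrier N"
  "\<zero>\<^bsub>mod_sum M N\<^esub> = (\<zero>\<^bsub>M\<^esub>, \<zero>\<^bsub>N\<^esub>)"
  "(x, y) \<oplus>\<^bsub>mod_sum M N\<^esub> (x', y') = (x \<oplus>\<^bsub>M\<^esub> x', y \<oplus>\<^bsub>N\<^esub> y')"
  "a \<odot>\<^bsub>mod_sum M N\<^esub> (x, y) = (a \<odot>\<^bsub>M\<^esub> x, a \<odot>\<^bsub>N\<^esub> y)"
  by (simp_all add: mod_sum_def)

lemma right_module_mod_sum:
  assumes "right_module A M" "right_module A N"
  shows "right_module A (mod_sum M N)"
proof -
  interpret M: right_module A M by fact
  interpret N: right_module A N by fact
  have "abelian_group (mod_sum M N)"
  proof (rule abelian_groupI)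
    show "\<exists>y \<in> carrier (mod_sum M N). y \<oplus>\<^bsub>mod_sum M N\<^esub> x = \<zero>\<^bsub>mod_sum M N\<^esub>"
      if "x \<in> carrier (mod_sum M N)" for x
      using that by (auto simp: mod_sum_simps M.M.l_neg N.M.l_neg
          intro!: bexI[of _ "\<ominus>\<^bsub>M\<^esub> fst x"] bexI[of _ "\<ominus>\<^bsub>N\<^esub> snd x"])
  qed (auto simp: mod_sum_simps M.M.a_ac N.M.a_ac)
  then show ?thesis
    by (intro right_module.intro right_module_axioms.intro M.A.ring_axioms)
      (auto simp: mod_sum_simps M.smult_closed N.smult_closed M.smult_add N.smult_add
        M.smult_add_right N.smult_add_right M.smult_mult N.smult_mult M.smult_one N.smult_one)
qed

lemma mod_hom_inclusions:
  assumes "right_module A M" "right_module A N"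
  shows "(\<lambda>x. (x, \<zero>\<^bsub>N\<^esub>)) \<in> mod_hom A M (mod_sum M N)" "(\<lambda>y. (\<zero>\<^bsub>M\<^esub>, y)) \<in> mod_hom A N (mod_sum M N)"
proof -
  interpret M: right_module A M by fact
  interpret N: right_module A N by fact
  show "(\<lambda>x. (x, \<zero>\<^bsub>N\<^esub>)) \<in> mod_hom A M (mod_sum M N)" "(\<lambda>y. (\<zero>\<^bsub>M\<^esub>, y)) \<in> mod_hom A N (mod_sum M N)"
    by (auto intro!: mod_homI simp: mod_sum_simps M.smult_zero_right N.smult_zero_right)
qed

lemma mod_hom_projections:
  "fst \<in> mod_hom A (mod_sum M N) M" "snd \<in> mod_hom A (mod_sum M N) N"
  by (auto intro!: mod_homI simp: mod_sum_simps)

lemma mod_sum_submodule_eq_carrier: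
  assumes "right_module A M" "right_module A N" "submodule U A (mod_sum M N)"
    and "\<And>x. x \<in> carrier M \<Longrightarrow> (x, \<zero>\<^bsub>N\<^esub>) \<in> U" "\<And>y. y \<in> carrier N \<Longrightarrow> (\<zero>\<^bsub>M\<^esub>, y) \<in> U"
  shows "U = carrier (mod_sum M N)"
proof -
  interpret M: right_module A M by fact
  interpret N: right_module A N by fact
  interpret S: right_module A "mod_sum M N" using right_module_mod_sum assms by blast
  have "(x, y) \<in> U" if "x \<in> carrier M" "y \<in> carrier N" for x y
    using S.right_submoduleD(4)[OF assms(3) assms(4)[OF that(1)] assms(5)[OF that(2)]] that
    by (simp add: mod_sum_simps)
  then show ?thesis using S.right_submoduleD(2)[OF assms(3)] by (auto simp: mod_sum_simps)
qed

lemma fin_gen_mod_sum: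
  assumes "right_module A M" "right_module A N" "fin_gen A M" "fin_gen A N"
  shows "fin_gen A (mod_sum M N)"
proof -
  interpret M: right_module A M by fact
  interpret N: right_module A N by fact
  interpret S: right_module A "mod_sum M N" using right_module_mod_sum assms by blast
  interpret i: module_hom A M "mod_sum M N" "\<lambda>x. (x, \<zero>\<^bsub>N\<^esub>)"
    by unfold_locales (rule mod_hom_inclusions[OF assms(1,2)])
  interpret j: module_hom A N "mod_sum M N" "\<lambda>y. (\<zero>\<^bsub>M\<^esub>, y)"
    by unfold_locales (rule mod_hom_inclusions[OF assms(1,2)])
  obtain S T where S: "finite S" "S \<subseteq> carrier M" "\<And>U. submodule U A M \<Longrightarrow> S \<subseteq> U \<Longrightarrow> U = carrier M"
    and T: "finite T" "T \<subseteq> carrier N" "\<And>U. submodule U A N \<Longrightarrow> T \<subseteq> U \<Longrightarrow> U = carrier N"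
    using assms(3,4) unfolding fin_gen_def by metis
  let ?G = "(\<lambda>x. (x, \<zero>\<^bsub>N\<^esub>)) ` S \<union> (\<lambda>y. (\<zero>\<^bsub>M\<^esub>, y)) ` T"
  have "U = carrier (mod_sum M N)" if U: "submodule U A (mod_sum M N)" "?G \<subseteq> U" for U
  proof (rule mod_sum_submodule_eq_carrier[OF assms(1,2) U(1)])
    have "S \<subseteq> {x \<in> carrier M. (x, \<zero>\<^bsub>N\<^esub>) \<in> U}" "T \<subseteq> {y \<in> carrier N. (\<zero>\<^bsub>M\<^esub>, y) \<in> U}"
      using U(2) S(2) T(2) by auto
    note eq = S(3)[OF i.submodule_preimage[OF U(1)] this(1)] T(3)[OF j.submodule_preimage[OF U(1)] this(2)]
    show "(x, \<zero>\<^bsub>N\<^esub>) \<in> U" if "x \<in> carrier M" for x using that eq(1) by blast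
    show "(\<zero>\<^bsub>M\<^esub>, y) \<in> U" if "y \<in> carrier N" for y using that eq(2) by blast
  qed
  moreover have "finite ?G" "?G \<subseteq> carrier (mod_sum M N)"
    using S T by (auto simp: mod_sum_simps)
  ultimately show ?thesis unfolding fin_gen_def by blast
qed

lemma mod_iso_mod_sum:
  assumes "mod_iso A M M'" "mod_iso A N N'"
  shows "mod_iso A (mod_sum M N) (mod_sum M' N')"
proof -
  obtain f g where f: "f \<in> mod_hom A M M'" "bij_betw f (carrier M) (carrier M')"
    and g: "g \<in> mod_hom A N N'" "bij_betw g (carrier N) (carrier N')"
    using assms unfolding mod_iso_def by blast
  have "map_prod f g \<in> mod_hom A (mod_sum M N) (mod_sum M' N')"
    by (rule mod_homI) (auto simp: mod_sum_simps mod_homD[OF f(1)] mod_homD[OF g(1)])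
  moreover have "bij_betw (map_prod f g) (carrier (mod_sum M N)) (carrier (mod_sum M' N'))"
    using bij_betw_map_prod[OF f(2) g(2)] by (simp add: mod_sum_simps)
  ultimately show ?thesis unfolding mod_iso_def by blast
qed

text \<open>The isomorphism is built as the addition map out of the external sum and then inverted;
  injectivity comes from the trivial intersection, surjectivity from the sum.\<close>

lemma (in right_module) internal_direct_sum:
  assumes "submodule U A M" "submodule W A M" "U \<inter> W = {\<zero>\<^bsub>M\<^esub>}" "U <+>\<^bsub>M\<^esub> W = carrier M"
  shows "mod_iso A M (mod_sum (M\<lparr>carrier := U\<rparr>) (M\<lparr>carrier := W\<rparr>))"
proof -
  note U = right_submoduleD[OF assms(1)] and W = right_submoduleD[OF assms(2)]
  let ?S = "mod_sum (M\<lparr>carrier := U\<rparr>) (M\<lparr>carrier := W\<rparr>)"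
  let ?f = "\<lambda>(u, w). u \<oplus>\<^bsub>M\<^esub> w"
  have S: "right_module A ?S"
    by (intro right_module_mod_sum right_module_submodule assms)
  have hom: "?f \<in> mod_hom A ?S M"
    by (rule mod_homI) (auto simp: mod_sum_simps U(1) W(1) M.a_ac smult_add_right)
  have "inj_on ?f (carrier ?S)"
  proof (rule inj_onI)
    fix p q assume pq: "p \<in> carrier ?S" "q \<in> carrier ?S" "?f p = ?f q"
    then obtain u w u' w' where uw: "p = (u, w)" "q = (u', w')" "u \<in> U" "w \<in> W" "u' \<in> U" "w' \<in> W"
      by (auto simp: mod_sum_simps)
    then have eq: "u \<ominus>\<^bsub>M\<^esub> u' = w' \<ominus>\<^bsub>M\<^esub> w"
      using pq(3) by (intro add_eq_imp_diff_eq) (auto simp: U(1) W(1))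
    then have "u \<ominus>\<^bsub>M\<^esub> u' \<in> U \<inter> W" using U(6)[of u u'] W(6)[of w' w] uw by simp
    then have "u \<ominus>\<^bsub>M\<^esub> u' = \<zero>\<^bsub>M\<^esub>" using assms(3) by auto
    with eq show "p = q" using uw U(1) W(1) diff_eq_zero_iff by metis
  qed
  moreover have "?f ` carrier ?S = carrier M"
  proof -
    have "?f ` carrier ?S = U <+>\<^bsub>M\<^esub> W" unfolding mod_sum_simps set_add_def' by force
    then show ?thesis using assms(4) by simp
  qed
  ultimately have "mod_iso A ?S M"
    unfolding mod_iso_def using hom by (auto simp: bij_betw_def)
  then show ?thesis by (rule mod_iso_sym[OF S])
qed

section \<open>Projective covers\<close>

text \<open>
  The lifting property and superfluity make sense for modules on any carrier type; direct sums leave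
  the carrier type of \<^const>\<open>mod_cat\<close>.
\<close>

definition lifts_epis :: "('a, 'x) ring_scheme \<Rightarrow> ('a, 'm) module \<Rightarrow> bool" where
  "lifts_epis A P \<longleftrightarrow>
     (\<forall>M \<in> mod_cat A. \<forall>N \<in> mod_cat A. \<forall>g \<in> mod_hom A M N. \<forall>f \<in> mod_hom A P N.
        g ` carrier M = carrier N \<longrightarrow> (\<exists>h \<in> mod_hom A P M. \<forall>x \<in> carrier P. g (h x) = f x))"

definition superfluous :: "('a, 'x) ring_scheme \<Rightarrow> ('a, 'm) module \<Rightarrow> 'm set \<Rightarrow> bool" where
  "superfluous A M K \<longleftrightarrow> (\<forall>U. submodule U A M \<and> U <+>\<^bsub>M\<^esub> K = carrier M \<longrightarrow> U = carrier M)"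

lemma projective_iff: "projective A P \<longleftrightarrow> P \<in> mod_cat A \<and> lifts_epis A P"
  by (simp add: projective_def lifts_epis_def)

lemma projective_cover_iff:
  "projective_cover A M P p \<longleftrightarrow>
     projective A P \<and> p \<in> mod_hom A P M \<and> p ` carrier P = carrier M \<and> superfluous A P (mod_kernel P M p)"
  by (simp add: projective_cover_def superfluous_def)

lemma lifts_episD:
  assumes "lifts_epis A P" "M \<in> mod_cat A" "N \<in> mod_cat A" "g \<in> mod_hom A M N" "f \<in> mod_hom A P N"
    and "g ` carrier M = carrier N"
  obtains h where "h \<in> mod_hom A P M" "\<And>x. x \<in> carrier P \<Longrightarrow> g (h x) = f x"
  using assms(1)[unfolded lifts_epis_def, rule_format, OF assms(2-)] that by blast

lemma module_hom_intro: "right_module A M \<Longrightarrow> right_module A N \<Longrightarrow> f \<in> mod_hom A M N \<Longrightarrow> module_hom A M N f"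
  by (simp add: module_hom_def module_hom_axioms_def)

lemma lifts_epis_iso:
  assumes "right_module A P" "mod_iso A P P'" "lifts_epis A P"
  shows "lifts_epis A P'"
  unfolding lifts_epis_def
proof (intro ballI impI)
  fix M N g f assume M: "M \<in> mod_cat A" "N \<in> mod_cat A" and g: "g \<in> mod_hom A M N"
    and f: "f \<in> mod_hom A P' N" and s: "g ` carrier M = carrier N"
  obtain k where k: "k \<in> mod_hom A P P'" "bij_betw k (carrier P) (carrier P')"
    using assms(2) unfolding mod_iso_def by blast
  note inv = bij_mod_hom_inverse[OF assms(1) k]
  obtain h where h: "h \<in> mod_hom A P M" "\<And>x. x \<in> carrier P \<Longrightarrow> g (h x) = f (k x)"
    using lifts_episD[OF assms(3) M g mod_hom_compose[OF k(1) f] s] by blast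
  show "\<exists>h \<in> mod_hom A P' M. \<forall>x \<in> carrier P'. g (h x) = f x"
  proof (intro bexI[OF _ mod_hom_compose[OF inv(1) h(1)]] ballI)
    fix x assume x: "x \<in> carrier P'"
    then show "g (h (inv_into (carrier P) k x)) = f x"
      using h(2)[OF mod_homD(1)[OF inv(1) x]] bij_betw_inv_into_right[OF k(2) x] by simp
  qed
qed

text \<open>The restrictions to the two summands are lifted separately and the lifts are
  added.\<close>

lemma lifts_epis_mod_sum:
  assumes "right_module A P" "right_module A P'" "lifts_epis A P" "lifts_epis A P'"
  shows "lifts_epis A (mod_sum P P')"
  unfolding lifts_epis_def
proof (intro ballI impI)
  fix M N g f assume M: "M \<in> mod_cat A" and N: "N \<in> mod_cat A" and g: "g \<in> mod_hom A M N"
    and f: "f \<in> mod_hom A (mod_sum P P') N" and s: "g ` carrier M = carrier N"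
  interpret P: right_module A P by fact
  interpret P': right_module A P' by fact
  interpret M: right_module A M using mod_catD(1)[OF M] .
  note i = mod_hom_inclusions[OF assms(1,2)]
  obtain h where h: "h \<in> mod_hom A P M" "\<And>x. x \<in> carrier P \<Longrightarrow> g (h x) = f (x, \<zero>\<^bsub>P'\<^esub>)"
    using lifts_episD[OF assms(3) M N g mod_hom_compose[OF i(1) f] s] by blast
  obtain h' where h': "h' \<in> mod_hom A P' M" "\<And>x. x \<in> carrier P' \<Longrightarrow> g (h' x) = f (\<zero>\<^bsub>P\<^esub>, x)"
    using lifts_episD[OF assms(4) M N g mod_hom_compose[OF i(2) f] s] by blast
  note H = mod_homD[OF h(1)] and H' = mod_homD[OF h'(1)]
  have "(\<lambda>(x, y). h x \<oplus>\<^bsub>M\<^esub> h' y) \<in> mod_hom A (mod_sum P P') M"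
    by (rule mod_homI) (auto simp: mod_sum_simps H H' M.M.a_ac M.smult_add_right M.smult_closed)
  moreover have "g (h x \<oplus>\<^bsub>M\<^esub> h' y) = f (x, y)" if "x \<in> carrier P" "y \<in> carrier P'" for x y
    using that mod_homD(2)[OF f, of "(x, \<zero>\<^bsub>P'\<^esub>)" "(\<zero>\<^bsub>P\<^esub>, y)"]
    by (simp add: mod_homD(2)[OF g] H H' h h' mod_sum_simps)
  ultimately show "\<exists>h \<in> mod_hom A (mod_sum P P') M. \<forall>x \<in> carrier (mod_sum P P'). g (h x) = f x"
    by (intro bexI[of _ "\<lambda>(x, y). h x \<oplus>\<^bsub>M\<^esub> h' y"]) (auto simp: mod_sum_simps)
qed

text \<open>Uniqueness of projective covers, stated over an isomorphism of the covered modules so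
  that it serves at once for independence of the chosen cover and of the representative of an
  isomorphism class. Superfluity enters twice: it makes the comparison map \<open>h\<close>
  surjective, and then makes its section \<open>s\<close> surjective, whence \<open>h\<close> is
  bijective.\<close>

lemma projective_cover_kernel_iso:
  assumes M: "M \<in> mod_cat A" "M' \<in> mod_cat A" and iso: "mod_iso A M M'"
    and P: "projective_cover A M P p" and P': "projective_cover A M' P' p'"
  shows "mod_iso A (P\<lparr>carrier := mod_kernel P M p\<rparr>) (P'\<lparr>carrier := mod_kernel P' M' p'\<rparr>)"
proof -
  from P have p: "P \<in> mod_cat A" "lifts_epis A P" "p \<in> mod_hom A P M" "p ` carrier P = carrier M"
    "superfluous A P (mod_kernel P M p)" by (auto simp: projective_cover_iff projective_iff)
  from P' have p': "P' \<in> mod_cat A" "lifts_epis A P'" "p' \<in> mod_hom A P' M'" "p' ` carrier P' = carrier M'"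
    "superfluous A P' (mod_kernel P' M' p')" by (auto simp: projective_cover_iff projective_iff)
  obtain c where c: "c \<in> mod_hom A M M'" "bij_betw c (carrier M) (carrier M')"
    using iso unfolding mod_iso_def by blast
  interpret p: module_hom A P M p using p M mod_catD(1) by (blast intro: module_hom_intro)
  interpret p': module_hom A P' M' p' using p' M mod_catD(1) by (blast intro: module_hom_intro)
  interpret c: module_hom A M M' c using c M mod_catD(1) by (blast intro: module_hom_intro)
  have cinj: "inj_on c (carrier M)" "c ` carrier M = carrier M'" using c(2) by (auto simp: bij_betw_def)
  obtain h where h: "h \<in> mod_hom A P P'" and ph: "\<And>x. x \<in> carrier P \<Longrightarrow> p' (h x) = c (p x)"
    using lifts_episD[OF p(2) p'(1) M(2) p'(3) mod_hom_compose[OF p(3) c(1)] p'(4)] by blast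
  interpret h: module_hom A P P' h using p p' h mod_catD(1) by (blast intro: module_hom_intro)
  \<comment> \<open>As \<open>c\<close> is injective, \<open>p' (h x) = c (p x)\<close> vanishes
    exactly when \<open>p x\<close> does, so \<open>h\<close> matches the two kernels in both
    directions.\<close>
  have ker: "h x \<in> mod_kernel P' M' p' \<longleftrightarrow> x \<in> mod_kernel P M p" if "x \<in> carrier P" for x
    using that c.hom_zero inj_on_eq_iff[OF cinj(1) p.hom_closed[OF that] p.cod.M.zero_closed]
    by (auto simp: p.mem_kernel p'.mem_kernel ph h.hom_closed)
  have hsurj: "h ` carrier P = carrier P'"
  proof -
    have "h ` carrier P <+>\<^bsub>P'\<^esub> mod_kernel P' M' p' = carrier P'"
    proof (intro equalityI subsetI)
      fix y assume "y \<in> h ` carrier P <+>\<^bsub>P'\<^esub> mod_kernel P' M' p'"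
      then show "y \<in> carrier P'" by (auto simp: mem_set_add p'.mem_kernel h.hom_closed)
    next
      fix y assume y: "y \<in> carrier P'"
      then have "p' y \<in> c ` p ` carrier P" using p'.hom_closed cinj(2) p(4) by simp
      then obtain x where x: "x \<in> carrier P" "p' y = c (p x)" by blast
      have "y \<ominus>\<^bsub>P'\<^esub> h x \<in> mod_kernel P' M' p'"
        using x y by (simp add: p'.mem_kernel p'.hom_diff h.hom_closed ph p'.cod.diff_eq_zero_iff
            c.hom_closed p.hom_closed)
      moreover have "y = h x \<oplus>\<^bsub>P'\<^esub> (y \<ominus>\<^bsub>P'\<^esub> h x)"
        using x y h.hom_closed
        by (simp add: a_minus_def p'.dom.M.a_ac p'.dom.M.r_neg p'.dom.M.r_neg1 p'.dom.M.r_neg2)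
      ultimately show "y \<in> h ` carrier P <+>\<^bsub>P'\<^esub> mod_kernel P' M' p'"
        using x(1) by (auto simp only: mem_set_add intro!: bexI)
    qed
    then show ?thesis
      using p'(5) h.submodule_image[OF p.dom.submodule_carrier] unfolding superfluous_def by blast
  qed
  \<comment> \<open>\<open>h\<close> is onto, so the identity of \<open>P'\<close> lifts along
    it.\<close>
  obtain s where s: "s \<in> mod_hom A P' P" and hs: "\<And>y. y \<in> carrier P' \<Longrightarrow> h (s y) = y"
    using lifts_episD[OF p'(2) p(1) p'(1) h mod_hom_id hsurj] by blast
  interpret s: module_hom A P' P s using p p' s mod_catD(1) by (blast intro: module_hom_intro)
  have ssurj: "s ` carrier P' = carrier P"
  proof -
    have "s ` carrier P' <+>\<^bsub>P\<^esub> mod_kernel P M p = carrier P"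
    proof (intro equalityI subsetI)
      fix y assume "y \<in> s ` carrier P' <+>\<^bsub>P\<^esub> mod_kernel P M p"
      then show "y \<in> carrier P" by (auto simp: mem_set_add p.mem_kernel s.hom_closed)
    next
      fix x assume x: "x \<in> carrier P"
      \<comment> \<open>The defect \<open>?d\<close> lies in the kernel of \<open>h\<close>, which
        is contained in the kernel of \<open>p\<close>.\<close>
      let ?d = "x \<ominus>\<^bsub>P\<^esub> s (h x)"
      have "h ?d = \<zero>\<^bsub>P'\<^esub>" "?d \<in> carrier P"
        using x by (simp_all add: h.hom_diff h.hom_closed s.hom_closed hs p'.dom.diff_eq_zero_iff)
      then have "?d \<in> mod_kernel P M p"
        using ker[of ?d] p'.hom_zero by (simp add: p'.mem_kernel)
      moreover have "x = s (h x) \<oplus>\<^bsub>P\<^esub> ?d"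
        using x h.hom_closed s.hom_closed
        by (simp add: a_minus_def p.dom.M.a_ac p.dom.M.r_neg p.dom.M.r_neg1 p.dom.M.r_neg2)
      ultimately show "x \<in> s ` carrier P' <+>\<^bsub>P\<^esub> mod_kernel P M p"
        using h.hom_closed[OF x] by (auto simp only: mem_set_add intro!: bexI)
    qed
    then show ?thesis
      using p(5) s.submodule_image[OF p'.dom.submodule_carrier] unfolding superfluous_def by blast
  qed
  have hinj: "inj_on h (carrier P)"
    unfolding ssurj[symmetric] by (rule inj_onI) (auto simp: hs)
  have "h ` mod_kernel P M p = mod_kernel P' M' p'"
  proof (intro equalityI subsetI)
    fix y assume "y \<in> h ` mod_kernel P M p"
    then show "y \<in> mod_kernel P' M' p'" using ker by (auto simp: p.mem_kernel)
  next
    fix y assume y: "y \<in> mod_kernel P' M' p'"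
    then obtain x where "x \<in> carrier P" "y = h x" using hsurj by (auto simp: p'.mem_kernel)
    then show "y \<in> h ` mod_kernel P M p" using ker y by blast
  qed
  then show ?thesis
    unfolding mod_iso_def
    using h.restrict_hom[OF p.submodule_kernel p'.submodule_kernel] hinj
    by (intro bexI[of _ h]) (auto simp: bij_betw_def inj_on_def p.mem_kernel)
qed

lemma superfluous_mod_sum:
  assumes "right_module A P" "right_module A P'" and K: "submodule K A P" "submodule K' A P'"
    and sup: "superfluous A P K" "superfluous A P' K'"
  shows "superfluous A (mod_sum P P') (K \<times> K')"
  unfolding superfluous_def
proof (intro allI impI, elim conjE)
  fix U assume U: "submodule U A (mod_sum P P')" and eq: "U <+>\<^bsub>mod_sum P P'\<^esub> K \<times> K' = carrier (mod_sum P P')"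
  interpret P: right_module A P by fact
  interpret P': right_module A P' by fact
  interpret S: right_module A "mod_sum P P'" using right_module_mod_sum assms by blast
  interpret i: module_hom A P "mod_sum P P'" "\<lambda>x. (x, \<zero>\<^bsub>P'\<^esub>)"
    by unfold_locales (rule mod_hom_inclusions[OF assms(1,2)])
  interpret j: module_hom A P' "mod_sum P P'" "\<lambda>y. (\<zero>\<^bsub>P\<^esub>, y)"
    by unfold_locales (rule mod_hom_inclusions[OF assms(1,2)])
  note D = S.right_submoduleD[OF U] and KD = P.right_submoduleD[OF K(1)] and KD' = P'.right_submoduleD[OF K(2)]
  define W where "W = U <+>\<^bsub>mod_sum P P'\<^esub> (\<lambda>y. (\<zero>\<^bsub>P\<^esub>, y)) ` K'"
  have W: "submodule W A (mod_sum P P')"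
    unfolding W_def by (intro S.submodule_sum U j.submodule_image K)
  have memW: "z \<in> W \<longleftrightarrow> (\<exists>u \<in> U. \<exists>l \<in> K'. z = u \<oplus>\<^bsub>mod_sum P P'\<^esub> (\<zero>\<^bsub>P\<^esub>, l))" for z
    by (auto simp: W_def mem_set_add)
  have dec: "\<exists>u \<in> U. \<exists>k \<in> K. \<exists>l \<in> K'. z = u \<oplus>\<^bsub>mod_sum P P'\<^esub> (k, l)" if "z \<in> carrier (mod_sum P P')" for z
    using that unfolding eq[symmetric] by (auto simp: mem_set_add)
  have 1: "{x \<in> carrier P. (x, \<zero>\<^bsub>P'\<^esub>) \<in> W} = carrier P"
  proof -
    let ?V = "{x \<in> carrier P. (x, \<zero>\<^bsub>P'\<^esub>) \<in> W}"
    have "?V <+>\<^bsub>P\<^esub> K = carrier P"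
    proof (intro equalityI subsetI)
      fix x assume "x \<in> ?V <+>\<^bsub>P\<^esub> K"
      then show "x \<in> carrier P" using KD(1) by (auto simp: mem_set_add)
    next
      fix x assume x: "x \<in> carrier P"
      then obtain u k l where ukl: "u \<in> U" "k \<in> K" "l \<in> K'" "(x, \<zero>\<^bsub>P'\<^esub>) = u \<oplus>\<^bsub>mod_sum P P'\<^esub> (k, l)"
        using dec[of "(x, \<zero>\<^bsub>P'\<^esub>)"] by (auto simp: mod_sum_simps)
      obtain a b where ab: "u = (a, b)" "a \<in> carrier P" "b \<in> carrier P'"
        using D(1)[OF ukl(1)] by (auto simp: mod_sum_simps)
      then have e: "x = a \<oplus>\<^bsub>P\<^esub> k" "b \<oplus>\<^bsub>P'\<^esub> l = \<zero>\<^bsub>P'\<^esub>" using ukl(4) by (auto simp: mod_sum_simps)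
      have "(a, \<zero>\<^bsub>P'\<^esub>) \<in> W"
        unfolding memW using ukl ab e KD'(1)
        by (intro bexI[OF _ ukl(1)] bexI[OF _ ukl(3)]) (simp add: mod_sum_simps)
      then show "x \<in> ?V <+>\<^bsub>P\<^esub> K" unfolding mem_set_add using ab e ukl(2) by blast
    qed
    then show ?thesis using sup(1) i.submodule_preimage[OF W] unfolding superfluous_def by blast
  qed
  have 2: "{y \<in> carrier P'. (\<zero>\<^bsub>P\<^esub>, y) \<in> U} = carrier P'"
  proof -
    let ?V = "{y \<in> carrier P'. (\<zero>\<^bsub>P\<^esub>, y) \<in> U}"
    have "?V <+>\<^bsub>P'\<^esub> K' = carrier P'"
    proof (intro equalityI subsetI)
      fix x assume "x \<in> ?V <+>\<^bsub>P'\<^esub> K'"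
      then show "x \<in> carrier P'" using KD'(1) by (auto simp: mem_set_add)
    next
      fix y assume y: "y \<in> carrier P'"
      then obtain u k l where ukl: "u \<in> U" "k \<in> K" "l \<in> K'" "(\<zero>\<^bsub>P\<^esub>, y) = u \<oplus>\<^bsub>mod_sum P P'\<^esub> (k, l)"
        using dec[of "(\<zero>\<^bsub>P\<^esub>, y)"] by (auto simp: mod_sum_simps)
      obtain a b where ab: "u = (a, b)" "a \<in> carrier P" "b \<in> carrier P'"
        using D(1)[OF ukl(1)] by (auto simp: mod_sum_simps)
      then have e: "y = b \<oplus>\<^bsub>P'\<^esub> l" "a \<oplus>\<^bsub>P\<^esub> k = \<zero>\<^bsub>P\<^esub>" using ukl(4) by (auto simp: mod_sum_simps)
      \<comment> \<open>An element of \<open>U\<close> with first coordinate \<open>k\<close>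
        cancels the first coordinate \<open>a\<close> of \<open>u\<close>; this changes the second
        coordinate only by an element of \<open>K'\<close>.\<close>
      have "(k, \<zero>\<^bsub>P'\<^esub>) \<in> W" using 1 ukl(2) KD(1) by blast
      then obtain u' l' where u': "u' \<in> U" "l' \<in> K'" "(k, \<zero>\<^bsub>P'\<^esub>) = u' \<oplus>\<^bsub>mod_sum P P'\<^esub> (\<zero>\<^bsub>P\<^esub>, l')"
        unfolding memW by blast
      obtain a' b' where ab': "u' = (a', b')" "a' \<in> carrier P" "b' \<in> carrier P'"
        using D(1)[OF u'(1)] by (auto simp: mod_sum_simps)
      then have e': "k = a'" "b' \<oplus>\<^bsub>P'\<^esub> l' = \<zero>\<^bsub>P'\<^esub>" using u'(3) by (auto simp: mod_sum_simps)
      have "(\<zero>\<^bsub>P\<^esub>, b \<oplus>\<^bsub>P'\<^esub> b') \<in> U"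
        using D(4)[OF ukl(1) u'(1)] ab ab' e e' by (simp add: mod_sum_simps)
      moreover have "y = (b \<oplus>\<^bsub>P'\<^esub> b') \<oplus>\<^bsub>P'\<^esub> (l \<oplus>\<^bsub>P'\<^esub> l')"
      proof -
        have "(b \<oplus>\<^bsub>P'\<^esub> b') \<oplus>\<^bsub>P'\<^esub> (l \<oplus>\<^bsub>P'\<^esub> l') = (b \<oplus>\<^bsub>P'\<^esub> l) \<oplus>\<^bsub>P'\<^esub> (b' \<oplus>\<^bsub>P'\<^esub> l')"
          using ab ab' KD'(1) ukl u' by (simp add: P'.M.a_ac)
        then show ?thesis using e e' ab KD'(1) ukl by simp
      qed
      moreover have "l \<oplus>\<^bsub>P'\<^esub> l' \<in> K'" using KD'(4) ukl u' by blast
      ultimately show "y \<in> ?V <+>\<^bsub>P'\<^esub> K'" unfolding mem_set_add using ab ab' by blast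
    qed
    then show ?thesis using sup(2) j.submodule_preimage[OF U] unfolding superfluous_def by blast
  qed
  \<comment> \<open>Now \<open>0 \<times> K'\<close> lies in \<open>U\<close>, so the enlargement
    \<open>W\<close> is \<open>U\<close> itself, and \<open>U\<close> contains
    \<open>P \<times> 0\<close> as well.\<close>
  have "(\<lambda>y. (\<zero>\<^bsub>P\<^esub>, y)) ` K' \<subseteq> U" using 2 KD'(1) by blast
  then have "W \<subseteq> U" using D(4) unfolding subset_iff memW by blast
  then show "U = carrier (mod_sum P P')"
    using 1 2 by (intro mod_sum_submodule_eq_carrier[OF assms(1,2) U]) blast+
qed

text \<open>Moves superfluity from the pair type of a direct sum to a representative in
  \<open>mod_cat\<close>.\<close>

lemma superfluous_bij:
  assumes "module_hom A N D g" "bij_betw g (carrier N) (carrier D)" "superfluous A D K" "K \<subseteq> carrier D"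
  shows "superfluous A N {x \<in> carrier N. g x \<in> K}"
  unfolding superfluous_def
proof (intro allI impI, elim conjE)
  interpret g: module_hom A N D g by fact
  have gb: "inj_on g (carrier N)" "g ` carrier N = carrier D" using assms(2) by (auto simp: bij_betw_def)
  fix U assume U: "submodule U A N" and eq: "U <+>\<^bsub>N\<^esub> {x \<in> carrier N. g x \<in> K} = carrier N"
  note D = g.dom.right_submoduleD[OF U]
  have "g ` U <+>\<^bsub>D\<^esub> K = carrier D"
  proof (intro equalityI subsetI)
    fix y assume "y \<in> g ` U <+>\<^bsub>D\<^esub> K"
    then show "y \<in> carrier D" using assms(4) D(1) g.hom_closed by (auto simp: mem_set_add)
  next
    fix y assume "y \<in> carrier D"
    then obtain x where x: "x \<in> carrier N" "y = g x" using gb(2) by blast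
    then have "x \<in> U <+>\<^bsub>N\<^esub> {x \<in> carrier N. g x \<in> K}" using eq by simp
    then obtain u k where "u \<in> U" "k \<in> carrier N" "g k \<in> K" "x = u \<oplus>\<^bsub>N\<^esub> k"
      unfolding mem_set_add by blast
    then show "y \<in> g ` U <+>\<^bsub>D\<^esub> K" unfolding mem_set_add using D(1) x by (auto simp: g.hom_add)
  qed
  then have "g ` U = carrier D"
    using assms(3) g.submodule_image[OF U] unfolding superfluous_def by blast
  then show "U = carrier N" using gb D(2) by (metis inj_on_image_eq_iff order_refl)
qed

text \<open>The direct sum of two covers covers the direct sum, but it lives on a pair type, while
  \<open>projective_cover\<close> asks for an object of \<open>mod_cat\<close>. The cover is
  therefore taken on a representative \<open>N\<close>, with isomorphisms composed at both ends; its
  kernel corresponds to the product of the two kernels. Additivity of syzygies follows.\<close>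

lemma projective_cover_mod_sum:
  assumes M: "M \<in> mod_cat A" "M' \<in> mod_cat A" "M'' \<in> mod_cat A" and iso: "mod_iso A M (mod_sum M' M'')"
    and P': "projective_cover A M' P' p'" and P'': "projective_cover A M'' P'' p''"
  shows "\<exists>P p. projective_cover A M P p \<and> mod_iso A (P\<lparr>carrier := mod_kernel P M p\<rparr>)
    (mod_sum (P'\<lparr>carrier := mod_kernel P' M' p'\<rparr>) (P''\<lparr>carrier := mod_kernel P'' M'' p''\<rparr>))"
proof -
  from P' have p': "P' \<in> mod_cat A" "lifts_epis A P'" "p' \<in> mod_hom A P' M'" "p' ` carrier P' = carrier M'"
    "superfluous A P' (mod_kernel P' M' p')" by (auto simp: projective_cover_iff projective_iff)
  from P'' have p'': "P'' \<in> mod_cat A" "lifts_epis A P''" "p'' \<in> mod_hom A P'' M''" "p'' ` carrier P'' = carrier M''"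
    "superfluous A P'' (mod_kernel P'' M'' p'')" by (auto simp: projective_cover_iff projective_iff)
  interpret p': module_hom A P' M' p' using p' M mod_catD(1) by (blast intro: module_hom_intro)
  interpret p'': module_hom A P'' M'' p'' using p'' M mod_catD(1) by (blast intro: module_hom_intro)
  let ?D = "mod_sum P' P''" and ?S = "mod_sum M' M''"
  have D: "right_module A ?D" "fin_gen A ?D"
    using right_module_mod_sum fin_gen_mod_sum mod_catD p' p'' by blast+
  have S: "right_module A ?S" using right_module_mod_sum mod_catD M by blast
  obtain N where N: "N \<in> mod_cat A" "mod_iso A ?D N" using mod_cat_representative[OF D] by blast
  then obtain g where g: "g \<in> mod_hom A N ?D" "bij_betw g (carrier N) (carrier ?D)"
    using mod_iso_sym[OF D(1)] unfolding mod_iso_def by blast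
  obtain c where c: "c \<in> mod_hom A ?S M" "bij_betw c (carrier ?S) (carrier M)"
    using mod_iso_sym[OF mod_catD(1)[OF M(1)] iso] unfolding mod_iso_def by blast
  have q: "map_prod p' p'' \<in> mod_hom A ?D ?S"
    by (rule mod_homI) (auto simp: mod_sum_simps p'.hom_closed p''.hom_closed p'.hom_add p''.hom_add
        p'.hom_smult p''.hom_smult)
  interpret g: module_hom A N ?D g using g D N mod_catD(1) by (blast intro: module_hom_intro)
  interpret c: module_hom A ?S M c using c S M mod_catD(1) by (blast intro: module_hom_intro)
  define p where "p x = c (map_prod p' p'' (g x))" for x
  have p: "p \<in> mod_hom A N M"
    unfolding p_def by (rule mod_hom_compose[OF mod_hom_compose[OF g(1) q] c(1)])
  let ?K = "mod_kernel P' M' p' \<times> mod_kernel P'' M'' p''"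
  have K: "?K \<subseteq> carrier ?D" by (auto simp: mod_sum_simps p'.mem_kernel p''.mem_kernel)
  have inj: "inj_on c (carrier ?S)" "c ` carrier ?S = carrier M" using c(2) by (auto simp: bij_betw_def)
  have gb: "inj_on g (carrier N)" "g ` carrier N = carrier ?D" using g(2) by (auto simp: bij_betw_def)
  have ker: "mod_kernel N M p = {x \<in> carrier N. g x \<in> ?K}"
  proof -
    have "p x = \<zero>\<^bsub>M\<^esub> \<longleftrightarrow> g x \<in> ?K" if x: "x \<in> carrier N" for x
    proof -
      have gx: "g x \<in> carrier ?D" using g.hom_closed x .
      then have "map_prod p' p'' (g x) \<in> carrier ?S" using mod_homD(1)[OF q] by blast
      then have "p x = \<zero>\<^bsub>M\<^esub> \<longleftrightarrow> map_prod p' p'' (g x) = \<zero>\<^bsub>?S\<^esub>"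
        unfolding p_def using inj(1) c.hom_zero c.dom.M.zero_closed by (metis inj_onD)
      then show ?thesis using gx by (auto simp: mod_sum_simps p'.mem_kernel p''.mem_kernel)
    qed
    then show ?thesis by (auto simp: mod_kernel_def)
  qed
  have "p ` carrier N = c ` map_prod p' p'' ` g ` carrier N"
    by (simp add: p_def[abs_def] image_image)
  then have surj: "p ` carrier N = carrier M"
    using gb(2) inj(2) p'(4) p''(4) by (simp add: mod_sum_simps map_prod_surj_on)
  have "superfluous A N (mod_kernel N M p)"
    unfolding ker
    by (rule superfluous_bij[OF g.module_hom_axioms g(2) superfluous_mod_sum K])
      (use p' p'' mod_catD p'.submodule_kernel p''.submodule_kernel in auto)
  moreover have "projective A N"
    unfolding projective_iff
    using N lifts_epis_iso[OF D(1) N(2) lifts_epis_mod_sum] p' p'' mod_catD(1) by blast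
  ultimately have cover: "projective_cover A M N p"
    using p surj by (simp add: projective_cover_iff)
  interpret p: module_hom A N M p using p N M mod_catD(1) by (blast intro: module_hom_intro)
  let ?T = "mod_sum (P'\<lparr>carrier := mod_kernel P' M' p'\<rparr>) (P''\<lparr>carrier := mod_kernel P'' M'' p''\<rparr>)"
  have "g \<in> mod_hom A (N\<lparr>carrier := mod_kernel N M p\<rparr>) ?T"
  proof (rule mod_homI)
    show "g x \<in> carrier ?T" if "x \<in> carrier (N\<lparr>carrier := mod_kernel N M p\<rparr>)" for x
      using that by (simp add: ker mod_sum_simps)
    show "g (x \<oplus>\<^bsub>N\<lparr>carrier := mod_kernel N M p\<rparr>\<^esub> y) = g x \<oplus>\<^bsub>?T\<^esub> g y"
      if "x \<in> carrier (N\<lparr>carrier := mod_kernel N M p\<rparr>)" "y \<in> carrier (N\<lparr>carrier := mod_kernel N M p\<rparr>)" for x y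
      using that g.hom_add[of x y] by (cases "g x"; cases "g y") (simp add: ker mod_sum_simps)
    show "g (a \<odot>\<^bsub>N\<lparr>carrier := mod_kernel N M p\<rparr>\<^esub> x) = a \<odot>\<^bsub>?T\<^esub> g x"
      if "a \<in> carrier A" "x \<in> carrier (N\<lparr>carrier := mod_kernel N M p\<rparr>)" for a x
      using that g.hom_smult[of a x] by (cases "g x") (simp add: ker mod_sum_simps)
  qed
  moreover have "bij_betw g (carrier (N\<lparr>carrier := mod_kernel N M p\<rparr>)) (carrier ?T)"
  proof -
    have "inj_on g (mod_kernel N M p)" using gb(1) by (auto simp: ker inj_on_def)
    moreover have "g ` mod_kernel N M p = ?K"
    proof (intro equalityI subsetI)
      fix y assume "y \<in> ?K"
      then have "y \<in> g ` carrier N" using K gb(2) by (simp only: subset_iff)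
      then obtain x where "x \<in> carrier N" "y = g x" by (elim imageE)
      then show "y \<in> g ` mod_kernel N M p" using \<open>y \<in> ?K\<close> by (simp add: ker)
    qed (auto simp: ker)
    ultimately show ?thesis by (simp add: bij_betw_def mod_sum_simps)
  qed
  ultimately have "mod_iso A (N\<lparr>carrier := mod_kernel N M p\<rparr>) ?T" unfolding mod_iso_def by blast
  with cover show ?thesis by blast
qed

section \<open>The group \<open>K\<^sub>0\<close> and the syzygy endomorphism\<close>

lemma iso_class_eq: "right_module A M \<Longrightarrow> mod_iso A M N \<Longrightarrow> iso_class A M = iso_class A N"
  unfolding iso_class_def using mod_iso_sym[of A M N] mod_iso_trans[of A M N] mod_iso_trans[of A N M] by blast

lemma K0_class_iso: "right_module A M \<Longrightarrow> mod_iso A M N \<Longrightarrow> K0_class A M = K0_class A N"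
  unfolding K0_class_def using iso_class_eq by metis

lemma K0_free_comm_group: "comm_group (K0_free A)"
  unfolding K0_free_def by (rule abelian_free_Abelian_group)

lemma frag_of_iso_class: "M \<in> mod_cat A \<Longrightarrow> frag_of (iso_class A M) \<in> carrier (K0_free A)"
  unfolding K0_free_def by simp

lemma K0_free_diff:
  "x \<in> carrier (K0_free A) \<Longrightarrow> y \<in> carrier (K0_free A) \<Longrightarrow> x - y \<in> carrier (K0_free A)"
  unfolding K0_free_def using keys_diff[of x y] by auto

lemma K0_relations_subset: "K0_relations A \<subseteq> carrier (K0_free A)"
proof
  fix r assume "r \<in> K0_relations A"
  then show "r \<in> carrier (K0_free A)"
    unfolding K0_relations_def by (auto simp: projective_def intro!: K0_free_diff frag_of_iso_class)
qed

lemma K0_relations_normal: "generate (K0_free A) (K0_relations A) \<lhd> K0_free A"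
  using comm_group.subgroup_imp_normal[OF K0_free_comm_group]
    group.generate_is_subgroup[OF comm_group.axioms(2)[OF K0_free_comm_group] K0_relations_subset] by blast

lemma K0_comm_group: "comm_group (K0 A)"
  unfolding K0_def
  by (rule comm_group.abelian_FactGroup[OF K0_free_comm_group])
    (rule group.generate_is_subgroup[OF comm_group.axioms(2)[OF K0_free_comm_group] K0_relations_subset])

definition K0_proj ::
  "('a, 'x) ring_scheme \<Rightarrow> (('a, nat \<Rightarrow> 'a) module set \<Rightarrow>\<^sub>0 int) \<Rightarrow> (('a, nat \<Rightarrow> 'a) module set \<Rightarrow>\<^sub>0 int) set" where
  "K0_proj A x = generate (K0_free A) (K0_relations A) #>\<^bsub>K0_free A\<^esub> x"

lemma K0_class_proj: "K0_class A M = K0_proj A (frag_of (iso_class A M))"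
  by (simp add: K0_class_def K0_proj_def)

lemma K0_proj_hom: "K0_proj A \<in> hom (K0_free A) (K0 A)"
  unfolding K0_proj_def K0_def using normal.r_coset_hom_Mod[OF K0_relations_normal] .

lemma K0_proj_group_hom: "group_hom (K0_free A) (K0 A) (K0_proj A)"
  using K0_proj_hom K0_comm_group K0_free_comm_group
  by (intro group_hom.intro group_hom_axioms.intro) (auto simp: comm_group_def)

lemma K0_proj_surj: "carrier (K0 A) = K0_proj A ` carrier (K0_free A)"
  unfolding K0_def K0_proj_def by (auto simp: FactGroup_def RCOSETS_def)

text \<open>Stated for differences because both the relations and
  \<open>free_Abelian_group_induct\<close> are written with subtraction.\<close>

lemma K0_proj_diff:
  assumes "x \<in> carrier (K0_free A)" "y \<in> carrier (K0_free A)"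
  shows "K0_proj A (x - y) = K0_proj A x \<otimes>\<^bsub>K0 A\<^esub> inv\<^bsub>K0 A\<^esub> K0_proj A y"
proof -
  interpret group_hom "K0_free A" "K0 A" "K0_proj A" by (rule K0_proj_group_hom)
  have "x - y = x \<otimes>\<^bsub>K0_free A\<^esub> inv\<^bsub>K0_free A\<^esub> y"
    using assms by (simp add: K0_free_def)
  then show ?thesis using assms by (simp del: mult_free_Abelian_group)
qed

lemma K0_proj_relation:
  assumes "r \<in> K0_relations A" shows "K0_proj A r = \<one>\<^bsub>K0 A\<^esub>"
proof -
  interpret F: comm_group "K0_free A" by (rule K0_free_comm_group)
  have "r \<in> generate (K0_free A) (K0_relations A)" using assms by (rule generate.incl)
  then show ?thesis
    unfolding K0_proj_def K0_def
    using F.coset_join2[OF subsetD[OF K0_relations_subset assms] F.generate_is_subgroup[OF K0_relations_subset]]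
    by simp
qed

lemma K0_class_closed: "M \<in> mod_cat A \<Longrightarrow> K0_class A M \<in> carrier (K0 A)"
  unfolding K0_class_proj K0_proj_surj using frag_of_iso_class by blast

lemma K0_class_mod_sum:
  assumes "M \<in> mod_cat A" "M' \<in> mod_cat A" "M'' \<in> mod_cat A" "mod_iso A M (mod_sum M' M'')"
  shows "K0_class A M = K0_class A M' \<otimes>\<^bsub>K0 A\<^esub> K0_class A M''"
proof -
  interpret K: comm_group "K0 A" by (rule K0_comm_group)
  have "frag_of (iso_class A M) - frag_of (iso_class A M') - frag_of (iso_class A M'') \<in> K0_relations A"
    using assms unfolding K0_relations_def by blast
  from K0_proj_relation[OF this]
  have "K0_class A M \<otimes>\<^bsub>K0 A\<^esub> inv\<^bsub>K0 A\<^esub> K0_class A M' \<otimes>\<^bsub>K0 A\<^esub> inv\<^bsub>K0 A\<^esub> K0_class A M'' = \<one>\<^bsub>K0 A\<^esub>"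
    using assms by (simp add: K0_proj_diff K0_free_diff frag_of_iso_class K0_class_proj)
  then show ?thesis
    using K.inv_solve_right[of "\<one>\<^bsub>K0 A\<^esub>" "K0_class A M \<otimes>\<^bsub>K0 A\<^esub> inv\<^bsub>K0 A\<^esub> K0_class A M'" "K0_class A M''"]
      K.inv_solve_right[of "K0_class A M''" "K0_class A M" "K0_class A M'"]
      K0_class_closed[OF assms(1)] K0_class_closed[OF assms(2)] K0_class_closed[OF assms(3)]
    by (simp add: K.m_comm)
qed

lemma K0_class_projective: "projective A P \<Longrightarrow> K0_class A P = \<one>\<^bsub>K0 A\<^esub>"
  unfolding K0_class_proj by (rule K0_proj_relation) (auto simp: K0_relations_def)

text \<open>The zero module is projective, every lift being zero, so it is killed by the second kind
  of relation.\<close>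

lemma K0_class_zero:
  assumes "M \<in> mod_cat A" "carrier M = {\<zero>\<^bsub>M\<^esub>}"
  shows "K0_class A M = \<one>\<^bsub>K0 A\<^esub>"
proof (rule K0_class_projective)
  show "projective A M"
    unfolding projective_iff lifts_epis_def
  proof (intro conjI ballI impI assms(1))
    fix L N g f assume L: "L \<in> mod_cat A" "N \<in> mod_cat A" and g: "g \<in> mod_hom A L N"
      and f: "f \<in> mod_hom A M N"
    interpret g: module_hom A L N g using g L mod_catD(1) by (blast intro: module_hom_intro)
    interpret f: module_hom A M N f using f L assms mod_catD(1) by (blast intro: module_hom_intro)
    have "(\<lambda>_. \<zero>\<^bsub>L\<^esub>) \<in> mod_hom A M L" by (rule mod_homI) (auto simp: g.dom.smult_zero_right)
    then show "\<exists>h \<in> mod_hom A M L. \<forall>x \<in> carrier M. g (h x) = f x"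
      using assms(2) g.hom_zero f.hom_zero by auto
  qed
qed

text \<open>The quotient map carries the basis of the free group to the classes of modules, so these
  generate \<open>K0 A\<close>.\<close>

lemma K0_induct:
  assumes H: "subgroup H (K0 A)" and cls: "\<And>M. M \<in> mod_cat A \<Longrightarrow> K0_class A M \<in> H"
  shows "carrier (K0 A) \<subseteq> H"
proof
  fix x assume "x \<in> carrier (K0 A)"
  then obtain c where c: "c \<in> carrier (K0_free A)" "x = K0_proj A c" unfolding K0_proj_surj by blast
  have "K0_proj A c \<in> H"
  proof (rule free_Abelian_group_induct[of c "iso_class A ` mod_cat A"])
    show "Poly_Mapping.keys c \<subseteq> iso_class A ` mod_cat A" using c(1) by (simp add: K0_free_def)
    interpret group_hom "K0_free A" "K0 A" "K0_proj A" by (rule K0_proj_group_hom)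
    show "K0_proj A 0 \<in> H" using hom_one subgroup.one_closed[OF H] by (simp add: K0_free_def)
    show "K0_proj A (x - y) \<in> H"
      if "Poly_Mapping.keys x \<subseteq> iso_class A ` mod_cat A" "Poly_Mapping.keys y \<subseteq> iso_class A ` mod_cat A"
        "K0_proj A x \<in> H" "K0_proj A y \<in> H" for x y
      using that K0_proj_diff[of x A y] subgroup.m_closed[OF H] subgroup.m_inv_closed[OF H]
      by (simp add: K0_free_def)
    show "K0_proj A (frag_of a) \<in> H" if "a \<in> iso_class A ` mod_cat A" for a
      using that cls by (auto simp: K0_class_proj)
  qed
  then show "x \<in> H" using c(2) by simp
qed

text \<open>Finite generation of the kernel is asked for together with the cover, as over a general
  ring the syzygy of a finitely generated module can leave \<open>mod_cat\<close>. Under this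
  assumption \<open>Omega_bar\<close> can be shown to exist.\<close>

locale syzygy_ring = ring A for A :: "('a, 'x) ring_scheme" (structure) +
  assumes covers: "M \<in> mod_cat A \<Longrightarrow>
    \<exists>P p. projective_cover A M P p \<and> fin_gen A (P\<lparr>carrier := mod_kernel P M p\<rparr>)"
begin

text \<open>The choice in \<open>syzygy\<close> is unfolded here once and for all; afterwards it
  enters only as the kernel of some projective cover.\<close>

lemma syzygy_cover:
  fixes M :: "('a, nat \<Rightarrow> 'a) module"
  assumes "M \<in> mod_cat A"
  obtains P p where "projective_cover A M P p" "syzygy A M = P\<lparr>carrier := mod_kernel P M p\<rparr>"
proof -
  obtain P p where "projective_cover A M P p" using covers[OF assms] by blast
  then have "\<exists>x. case x of (P, p) \<Rightarrow> projective_cover A M P p" by auto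
  then have "case (SOME (P, p). projective_cover A M P p) of (P, p) \<Rightarrow> projective_cover A M P p"
    by (rule someI_ex)
  then show thesis using that unfolding syzygy_def
    by (cases "SOME (P, p). projective_cover A M P p") simp
qed

lemma syzygy_right_module:
  assumes "M \<in> mod_cat A" shows "right_module A (syzygy A M)"
proof -
  obtain P p where P: "projective_cover A M P p" "syzygy A M = P\<lparr>carrier := mod_kernel P M p\<rparr>"
    using syzygy_cover[OF assms] .
  then interpret module_hom A P M p
    using assms mod_catD(1) by (auto simp: projective_cover_iff projective_iff intro: module_hom_intro)
  show ?thesis unfolding P(2) by (rule dom.right_module_submodule[OF submodule_kernel])
qed

lemma syzygy_iso_kernel:
  assumes "M \<in> mod_cat A" "N \<in> mod_cat A" "mod_iso A M N" "projective_cover A N P p"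
  shows "mod_iso A (syzygy A M) (P\<lparr>carrier := mod_kernel P N p\<rparr>)"
  using syzygy_cover[OF assms(1)] projective_cover_kernel_iso[OF assms(1-3) _ assms(4)] by metis

lemma syzygy_mod_cat:
  assumes "M \<in> mod_cat A" shows "syzygy A M \<in> mod_cat A"
proof -
  obtain P p where P: "projective_cover A M P p" "fin_gen A (P\<lparr>carrier := mod_kernel P M p\<rparr>)"
    using covers[OF assms] by blast
  then interpret module_hom A P M p
    using assms mod_catD(1) by (auto simp: projective_cover_iff projective_iff intro: module_hom_intro)
  note r = dom.right_module_submodule[OF submodule_kernel]
  have "fin_gen A (syzygy A M)"
    by (rule fin_gen_iso[OF r syzygy_right_module[OF assms] mod_iso_sym P(2)])
      (use syzygy_right_module syzygy_iso_kernel[OF assms assms mod_iso_refl P(1)] assms in auto)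
  then show ?thesis using syzygy_right_module[OF assms] by (simp add: mod_cat_def)
qed

lemma K0_class_syzygy_iso:
  assumes "M \<in> mod_cat A" "N \<in> mod_cat A" "mod_iso A M N"
  shows "K0_class A (syzygy A M) = K0_class A (syzygy A N)"
proof -
  obtain P p where P: "projective_cover A N P p" "syzygy A N = P\<lparr>carrier := mod_kernel P N p\<rparr>"
    using syzygy_cover[OF assms(2)] .
  show ?thesis unfolding P(2)
    by (rule K0_class_iso[OF syzygy_right_module[OF assms(1)] syzygy_iso_kernel[OF assms P(1)]])
qed

lemma K0_class_syzygy_mod_sum:
  assumes "M \<in> mod_cat A" "M' \<in> mod_cat A" "M'' \<in> mod_cat A" "mod_iso A M (mod_sum M' M'')"
  shows "K0_class A (syzygy A M) = K0_class A (syzygy A M') \<otimes>\<^bsub>K0 A\<^esub> K0_class A (syzygy A M'')"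
proof -
  obtain P' p' where P': "projective_cover A M' P' p'" "syzygy A M' = P'\<lparr>carrier := mod_kernel P' M' p'\<rparr>"
    using syzygy_cover[OF assms(2)] .
  obtain P'' p'' where P'': "projective_cover A M'' P'' p''" "syzygy A M'' = P''\<lparr>carrier := mod_kernel P'' M'' p''\<rparr>"
    using syzygy_cover[OF assms(3)] .
  obtain P p where P: "projective_cover A M P p"
    "mod_iso A (P\<lparr>carrier := mod_kernel P M p\<rparr>) (mod_sum (syzygy A M') (syzygy A M''))"
    using projective_cover_mod_sum[OF assms P'(1) P''(1)] unfolding P'(2) P''(2) by blast
  have "mod_iso A (syzygy A M) (mod_sum (syzygy A M') (syzygy A M''))"
    using syzygy_iso_kernel[OF assms(1,1) mod_iso_refl P(1)] P(2) mod_iso_trans by blast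
  then show ?thesis using K0_class_mod_sum syzygy_mod_cat assms by blast
qed

text \<open>The identity is a projective cover of a projective module, and its kernel is
  zero.\<close>

lemma K0_class_syzygy_projective:
  assumes "projective A P" shows "K0_class A (syzygy A P) = \<one>\<^bsub>K0 A\<^esub>"
proof -
  have P: "P \<in> mod_cat A" using assms by (simp add: projective_def)
  interpret right_module A P using mod_catD(1)[OF P] .
  have ker: "mod_kernel P P (\<lambda>x. x) = {\<zero>\<^bsub>P\<^esub>}" by (auto simp: mod_kernel_def)
  have "superfluous A P {\<zero>\<^bsub>P\<^esub>}"
  proof -
    have "U <+>\<^bsub>P\<^esub> {\<zero>\<^bsub>P\<^esub>} = U" if "submodule U A P" for U
      using right_submoduleD(1)[OF that] by (auto simp: set_add_def')
    then show ?thesis unfolding superfluous_def by metis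
  qed
  then have "projective_cover A P P (\<lambda>x. x)"
    using assms by (simp add: projective_cover_iff mod_hom_id ker)
  from syzygy_iso_kernel[OF P P mod_iso_refl this]
  have "K0_class A (syzygy A P) = K0_class A (P\<lparr>carrier := {\<zero>\<^bsub>P\<^esub>}\<rparr>)"
    unfolding ker using K0_class_iso[OF syzygy_right_module[OF P]] by blast
  also have "\<dots> = \<one>\<^bsub>K0 A\<^esub>"
    using mod_cat_submodule[OF P submodule_zero fin_gen_zero] by (intro K0_class_zero) auto
  finally show ?thesis .
qed

text \<open>The choice in \<open>Omega_bar\<close> is met by a map built in three stages: on
  isomorphism classes through representatives, on the free group by its universal property, and on
  the quotient, since additivity of syzygies and their triviality on projectives kill both kinds of
  relations.\<close>

lemma Omega_bar:
  shows "Omega_bar A \<in> hom (K0 A) (K0 A)"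
    and "M \<in> mod_cat A \<Longrightarrow> Omega_bar A (K0_class A M) = K0_class A (syzygy A M)"
proof -
  interpret K: comm_group "K0 A" by (rule K0_comm_group)
  let ?rep = "\<lambda>X. SOME M. M \<in> mod_cat A \<and> iso_class A M = X"
  define f where "f X = K0_class A (syzygy A (?rep X))" for X
  have rep: "?rep (iso_class A M) \<in> mod_cat A" "mod_iso A M (?rep (iso_class A M))" if M: "M \<in> mod_cat A" for M
  proof -
    have "?rep (iso_class A M) \<in> mod_cat A \<and> iso_class A (?rep (iso_class A M)) = iso_class A M"
      by (rule someI[of _ M]) (use M in simp)
    then show "?rep (iso_class A M) \<in> mod_cat A" "mod_iso A M (?rep (iso_class A M))"
      using mod_iso_refl unfolding iso_class_def by blast+
  qed
  have f: "f (iso_class A M) = K0_class A (syzygy A M)" if "M \<in> mod_cat A" for M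
    unfolding f_def using K0_class_syzygy_iso[OF that rep[OF that]] by simp
  have "f ` iso_class A ` mod_cat A \<subseteq> carrier (K0 A)"
    using syzygy_mod_cat by (auto simp: f intro!: K0_class_closed)
  then obtain h where h: "h \<in> hom (K0_free A) (K0 A)"
    and hf: "\<And>X. X \<in> iso_class A ` mod_cat A \<Longrightarrow> h (frag_of X) = f X"
    unfolding K0_free_def by (rule K.free_Abelian_group_universal) metis
  interpret h: group_hom "K0_free A" "K0 A" h
    using h K0_comm_group K0_free_comm_group
    by (intro group_hom.intro group_hom_axioms.intro) (auto simp: comm_group_def)
  have hM: "h (frag_of (iso_class A M)) = K0_class A (syzygy A M)" if "M \<in> mod_cat A" for M
    using hf f that by blast
  have hdiff: "h (x - y) = h x \<otimes>\<^bsub>K0 A\<^esub> inv\<^bsub>K0 A\<^esub> h y" if "x \<in> carrier (K0_free A)" "y \<in> carrier (K0_free A)" for x y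
  proof -
    have "x - y = x \<otimes>\<^bsub>K0_free A\<^esub> inv\<^bsub>K0_free A\<^esub> y"
      using that by (simp add: K0_free_def)
    then show ?thesis using that by (simp del: mult_free_Abelian_group)
  qed
  have "h r = \<one>\<^bsub>K0 A\<^esub>" if "r \<in> K0_relations A" for r
    using that unfolding K0_relations_def
  proof (elim UnE CollectE exE conjE)
    fix M M' M'' assume M: "M \<in> mod_cat A" "M' \<in> mod_cat A" "M'' \<in> mod_cat A" "mod_iso A M (mod_sum M' M'')"
      and r: "r = frag_of (iso_class A M) - frag_of (iso_class A M') - frag_of (iso_class A M'')"
    have "K0_class A (syzygy A X) \<in> carrier (K0 A)" if "X \<in> mod_cat A" for X
      using K0_class_closed syzygy_mod_cat that by blast
    \<comment> \<open>This expression is the image of a direct sum relation once the syzygy of the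
      sum has been expanded as the product of \<open>a\<close> and \<open>b\<close>.\<close>
    moreover have "a \<otimes>\<^bsub>K0 A\<^esub> b \<otimes>\<^bsub>K0 A\<^esub> inv\<^bsub>K0 A\<^esub> a \<otimes>\<^bsub>K0 A\<^esub> inv\<^bsub>K0 A\<^esub> b = \<one>\<^bsub>K0 A\<^esub>"
      if "a \<in> carrier (K0 A)" "b \<in> carrier (K0 A)" for a b
    proof -
      have "a \<otimes>\<^bsub>K0 A\<^esub> b \<otimes>\<^bsub>K0 A\<^esub> inv\<^bsub>K0 A\<^esub> a \<otimes>\<^bsub>K0 A\<^esub> inv\<^bsub>K0 A\<^esub> b =
          (a \<otimes>\<^bsub>K0 A\<^esub> b) \<otimes>\<^bsub>K0 A\<^esub> inv\<^bsub>K0 A\<^esub> (a \<otimes>\<^bsub>K0 A\<^esub> b)"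
        using that by (simp add: K.inv_mult K.m_assoc del: K.r_inv)
      then show ?thesis using that by simp
    qed
    ultimately show ?thesis
      using M by (simp add: r hdiff K0_free_diff frag_of_iso_class hM K0_class_syzygy_mod_sum)
  next
    fix P assume "r = frag_of (iso_class A P)" "projective A P"
    then show ?thesis using hM[of P] K0_class_syzygy_projective by (simp add: projective_def)
  qed
  then have "K0_relations A \<subseteq> kernel (K0_free A) (K0 A) h"
    using K0_relations_subset by (auto simp: kernel_def)
  then have "generate (K0_free A) (K0_relations A) \<subseteq> kernel (K0_free A) (K0 A) h"
    by (rule h.generate_subgroup_incl[OF _ h.subgroup_kernel])
  then obtain g where "g \<in> hom (K0_free A Mod generate (K0_free A) (K0_relations A)) (K0 A)"
    "\<And>x. x \<in> carrier (K0_free A) \<Longrightarrow> g (generate (K0_free A) (K0_relations A) #>\<^bsub>K0_free A\<^esub> x) = h x"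
    by (rule h.FactGroup_universal_kernel[OF K0_relations_normal]) metis
  then have "g \<in> hom (K0 A) (K0 A)" "\<And>x. x \<in> carrier (K0_free A) \<Longrightarrow> g (K0_proj A x) = h x"
    by (simp_all only: K0_def K0_proj_def)
  then have "\<exists>h. h \<in> hom (K0 A) (K0 A) \<and> (\<forall>M \<in> mod_cat A. h (K0_class A M) = K0_class A (syzygy A M))"
    using hM frag_of_iso_class unfolding K0_class_proj by metis
  then have "Omega_bar A \<in> hom (K0 A) (K0 A) \<and>
    (\<forall>M \<in> mod_cat A. Omega_bar A (K0_class A M) = K0_class A (syzygy A M))"
    unfolding Omega_bar_def by (rule someI_ex)
  then show "Omega_bar A \<in> hom (K0 A) (K0 A)"
    "M \<in> mod_cat A \<Longrightarrow> Omega_bar A (K0_class A M) = K0_class A (syzygy A M)" by blast+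
qed

end

section \<open>Rings with radical square zero\<close>

text \<open>
  The properties of \<open>KQ/J\<^sup>2\<close> on which the argument rests: \<open>I\<close> is the radical, \<open>e\<close> the family of
  vertex idempotents, \<open>G\<close> the set of arrows, and \<open>e_unit\<close> says that \<open>e\<^sub>v A / e\<^sub>v I\<close> is simple.
\<close>

locale rad_sq_zero_ring = ring A for A :: "('a, 'x) ring_scheme" (structure) +
  fixes I :: "'a set" and V :: "'v set" and e :: "'v \<Rightarrow> 'a" and G :: "'a set"
  assumes I_ideal: "ideal I A"
    and I_sq: "\<And>n m. n \<in> I \<Longrightarrow> m \<in> I \<Longrightarrow> n \<otimes> m = \<zero>"
    and V_finite: "finite V"
    and e_closed: "\<And>v. v \<in> V \<Longrightarrow> e v \<in> carrier A"
    and e_idem: "\<And>v. v \<in> V \<Longrightarrow> e v \<otimes> e v = e v"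
    and e_sum: "finsum A e V = \<one>"
    and e_notin: "\<And>v. v \<in> V \<Longrightarrow> e v \<notin> I"
    and e_unit: "\<And>v a. v \<in> V \<Longrightarrow> a \<in> carrier A \<Longrightarrow> e v \<otimes> a \<notin> I \<Longrightarrow>
      \<exists>b \<in> carrier A. e v \<otimes> a \<otimes> b \<ominus> e v \<in> I"
    and G_finite: "finite G" and G_subset: "G \<subseteq> I"
    and I_generated: "\<And>W. W \<subseteq> carrier A \<Longrightarrow> \<zero> \<in> W \<Longrightarrow> (\<And>x y. x \<in> W \<Longrightarrow> y \<in> W \<Longrightarrow> x \<oplus> y \<in> W) \<Longrightarrow>
      (\<And>x a. x \<in> W \<Longrightarrow> a \<in> carrier A \<Longrightarrow> x \<otimes> a \<in> W) \<Longrightarrow> G \<subseteq> W \<Longrightarrow> I \<subseteq> W"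
begin

lemma I_closed: "n \<in> I \<Longrightarrow> n \<in> carrier A"
  using ideal.Icarr[OF I_ideal] .

lemma I_l_closed: "n \<in> I \<Longrightarrow> a \<in> carrier A \<Longrightarrow> a \<otimes> n \<in> I"
  using ideal.I_l_closed[OF I_ideal] .

lemma I_r_closed: "n \<in> I \<Longrightarrow> a \<in> carrier A \<Longrightarrow> n \<otimes> a \<in> I"
  using ideal.I_r_closed[OF I_ideal] .

lemma I_zero: "\<zero> \<in> I"
  using additive_subgroup.zero_closed[OF ideal.axioms(1)[OF I_ideal]] .

lemma I_add: "n \<in> I \<Longrightarrow> m \<in> I \<Longrightarrow> n \<oplus> m \<in> I"
  using additive_subgroup.a_closed[OF ideal.axioms(1)[OF I_ideal]] .

lemma e_inverse:
  assumes "v \<in> V" "a \<in> carrier A" "e v \<otimes> a \<notin> I"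
  obtains b n where "b \<in> carrier A" "n \<in> I" "e v \<otimes> a \<otimes> b = e v \<oplus> n"
proof -
  obtain b where b: "b \<in> carrier A" "e v \<otimes> a \<otimes> b \<ominus> e v \<in> I" using e_unit[OF assms] by blast
  have "e v \<otimes> a \<otimes> b = e v \<oplus> (e v \<otimes> a \<otimes> b \<ominus> e v)"
    using b(1) assms e_closed by (simp add: a_minus_def a_ac r_neg r_neg1 r_neg2)
  then show thesis using that b by blast
qed

text \<open>These are the modules over \<open>A / I\<close>, which is a sum of simple modules by
  \<open>e_sum\<close> and \<open>e_unit\<close>.\<close>

definition annihilated :: "('a, 'm) module \<Rightarrow> bool" where
  "annihilated M \<longleftrightarrow> (\<forall>n \<in> I. \<forall>x \<in> carrier M. n \<odot>\<^bsub>M\<^esub> x = \<zero>\<^bsub>M\<^esub>)"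

text \<open>Such an \<open>x\<close> is the image of \<open>e v\<close> under a homomorphism from
  \<open>e v A\<close>. In an annihilated module it generates a simple submodule unless it is zero,
  so generating sets are chosen among these elements.\<close>

definition homogeneous :: "('a, 'm) module \<Rightarrow> 'm set" where
  "homogeneous M = {x \<in> carrier M. \<exists>v \<in> V. e v \<odot>\<^bsub>M\<^esub> x = x}"

lemma annihilated_submodule:
  "right_module A M \<Longrightarrow> annihilated M \<Longrightarrow> submodule U A M \<Longrightarrow> annihilated (M\<lparr>carrier := U\<rparr>)"
  using right_module.right_submoduleD(1)[of A M U] by (auto simp: annihilated_def)

lemma annihilated_iso:
  assumes "right_module A M" "right_module A L" "mod_iso A M L" "annihilated M"
  shows "annihilated L"
proof -
  obtain f where f: "f \<in> mod_hom A M L" "bij_betw f (carrier M) (carrier L)"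
    using assms(3) unfolding mod_iso_def by blast
  then interpret module_hom A M L f using assms by (simp add: module_hom_intro)
  show ?thesis
    unfolding annihilated_def
  proof (intro ballI)
    fix n y assume n: "n \<in> I" and "y \<in> carrier L"
    then obtain x where x: "x \<in> carrier M" "y = f x" using f(2) unfolding bij_betw_def by blast
    then show "n \<odot>\<^bsub>L\<^esub> y = \<zero>\<^bsub>L\<^esub>"
      using hom_smult[OF I_closed[OF n] x(1)] hom_zero assms(4) n by (simp add: annihilated_def)
  qed
qed

text \<open>Each generator is the sum of its components at the vertices, because the idempotents add
  up to one; the finitely many components generate the same module.\<close>

lemma homogeneous_generators:
  assumes "right_module A M" "fin_gen A M"
  obtains S where "finite S" "S \<subseteq> homogeneous M" "submodule_hull A M S = carrier M"
proof -
  interpret M: right_module A M by fact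
  obtain T where T: "finite T" "T \<subseteq> carrier M" "submodule_hull A M T = carrier M"
    using assms(2) unfolding M.fin_gen_iff_hull by blast
  let ?S = "(\<lambda>(v, x). e v \<odot>\<^bsub>M\<^esub> x) ` (V \<times> T)"
  have hom: "e v \<odot>\<^bsub>M\<^esub> x \<in> homogeneous M" if "v \<in> V" "x \<in> T" for v x
    unfolding homogeneous_def using that T(2) e_closed
    by (auto simp: M.smult_mult[symmetric] e_idem M.smult_closed intro!: bexI[of _ v])
  then have S: "?S \<subseteq> homogeneous M" by auto
  then have Sc: "?S \<subseteq> carrier M" by (auto simp: homogeneous_def)
  let ?H = "submodule_hull A M ?S"
  note H = M.right_submoduleD[OF M.submodule_hull_submodule[OF Sc]]
  have "T \<subseteq> ?H"
  proof
    fix x assume x: "x \<in> T"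
    then have xc: "x \<in> carrier M" using T(2) by blast
    have "finsum A e W \<odot>\<^bsub>M\<^esub> x \<in> ?H" if "finite W" "W \<subseteq> V" for W
      using that
    proof (induction W rule: finite_induct)
      case empty
      then show ?case using xc H(3) by (simp add: M.smult_zero_left)
    next
      case (insert v W)
      then have "e \<in> W \<rightarrow> carrier A" "e v \<in> carrier A" using e_closed by auto
      moreover have "e v \<odot>\<^bsub>M\<^esub> x \<in> ?H"
        using insert x submodule_hull_superset[of ?S A M] by auto
      ultimately show ?case using insert H(4) xc by (simp add: M.smult_add)
    qed
    from this[OF V_finite] show "x \<in> ?H" using xc by (simp add: e_sum M.smult_one)
  qed
  then have "?H = carrier M"
    using submodule_hull_least[OF M.submodule_hull_submodule[OF Sc]] T(3) H(2) by blast
  then show thesis using that[of ?S] S T(1) V_finite by blast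
qed

text \<open>Since \<open>e v\<close> fixes \<open>x\<close>, only the residue of
  \<open>e v \<otimes> a\<close> modulo \<open>I\<close> matters, and by \<open>e_unit\<close> this
  residue is zero or can be multiplied back to that of \<open>e v\<close>.\<close>

lemma annihilated_smult:
  assumes "right_module A M" "annihilated M" "v \<in> V" "x \<in> carrier M" "e v \<odot>\<^bsub>M\<^esub> x = x" "a \<in> carrier A"
  shows "a \<odot>\<^bsub>M\<^esub> x = (e v \<otimes> a) \<odot>\<^bsub>M\<^esub> x" "e v \<otimes> a \<in> I \<Longrightarrow> a \<odot>\<^bsub>M\<^esub> x = \<zero>\<^bsub>M\<^esub>"
    "e v \<otimes> a \<notin> I \<Longrightarrow> \<exists>b \<in> carrier A. b \<odot>\<^bsub>M\<^esub> (a \<odot>\<^bsub>M\<^esub> x) = x"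
proof -
  interpret M: right_module A M by fact
  show eq: "a \<odot>\<^bsub>M\<^esub> x = (e v \<otimes> a) \<odot>\<^bsub>M\<^esub> x"
    using assms e_closed by (simp add: M.smult_mult)
  show "e v \<otimes> a \<in> I \<Longrightarrow> a \<odot>\<^bsub>M\<^esub> x = \<zero>\<^bsub>M\<^esub>"
    unfolding eq using assms by (simp add: annihilated_def)
  assume "e v \<otimes> a \<notin> I"
  then obtain b n where b: "b \<in> carrier A" "n \<in> I" "e v \<otimes> a \<otimes> b = e v \<oplus> n"
    using e_inverse assms by metis
  have "b \<odot>\<^bsub>M\<^esub> (a \<odot>\<^bsub>M\<^esub> x) = (e v \<otimes> a \<otimes> b) \<odot>\<^bsub>M\<^esub> x"
    unfolding eq using assms b e_closed by (simp add: M.smult_mult[symmetric])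
  also have "\<dots> = x"
    unfolding b(3) using assms b e_closed I_closed by (simp add: M.smult_add annihilated_def)
  finally show "\<exists>b \<in> carrier A. b \<odot>\<^bsub>M\<^esub> (a \<odot>\<^bsub>M\<^esub> x) = x" using b(1) by blast
qed

text \<open>The exchange step of linear algebra: if the \<open>x\<close>-part of an element does not
  vanish, a scalar restores \<open>x\<close> itself modulo \<open>W\<close>.\<close>

lemma annihilated_exchange:
  assumes M: "right_module A M" "annihilated M" and x: "x \<in> homogeneous M"
    and W: "submodule W A M" "w \<in> W" and a: "a \<in> carrier A" and u: "a \<odot>\<^bsub>M\<^esub> x \<oplus>\<^bsub>M\<^esub> w \<notin> W"
  shows "\<exists>b \<in> carrier A. \<exists>w' \<in> W. b \<odot>\<^bsub>M\<^esub> (a \<odot>\<^bsub>M\<^esub> x \<oplus>\<^bsub>M\<^esub> w) = x \<oplus>\<^bsub>M\<^esub> w'"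
proof -
  interpret M: right_module A M by fact
  obtain v where v: "v \<in> V" "e v \<odot>\<^bsub>M\<^esub> x = x" and xc: "x \<in> carrier M"
    using x by (auto simp: homogeneous_def)
  note D = M.right_submoduleD[OF W(1)]
  have "e v \<otimes> a \<notin> I"
  proof
    assume "e v \<otimes> a \<in> I"
    then have "a \<odot>\<^bsub>M\<^esub> x = \<zero>\<^bsub>M\<^esub>" using annihilated_smult(2)[OF M v(1) xc v(2) a] by blast
    then show False using u W(2) D(1) by simp
  qed
  then obtain b where b: "b \<in> carrier A" "b \<odot>\<^bsub>M\<^esub> (a \<odot>\<^bsub>M\<^esub> x) = x"
    using annihilated_smult(3)[OF M v(1) xc v(2) a] by blast
  then have "b \<odot>\<^bsub>M\<^esub> (a \<odot>\<^bsub>M\<^esub> x \<oplus>\<^bsub>M\<^esub> w) = x \<oplus>\<^bsub>M\<^esub> b \<odot>\<^bsub>M\<^esub> w"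
    using D(1)[OF W(2)] a xc by (simp add: M.smult_add_right M.smult_closed)
  then show ?thesis using b(1) D(7)[OF b(1) W(2)] by blast
qed

text \<open>Induction as for subspaces of a finite dimensional space: \<open>U\<close> meets the
  hull of the smaller set in a finitely generated submodule, and at most one further generator is
  required, an element of \<open>U\<close> congruent to \<open>x\<close> modulo that hull.\<close>

lemma annihilated_submodule_generators:
  assumes M: "right_module A M" "annihilated M" and S: "finite S" "S \<subseteq> homogeneous M"
    and U: "submodule U A M" "U \<subseteq> submodule_hull A M S"
  shows "\<exists>T. finite T \<and> T \<subseteq> U \<and> submodule_hull A M T = U"
  using S U
proof (induction S arbitrary: U rule: finite_induct)
  interpret M: right_module A M by fact
  case empty
  then have "U = {\<zero>\<^bsub>M\<^esub>}" using M.submodule_hull_empty M.right_submoduleD(3) by blast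
  then show ?case using M.submodule_hull_empty by blast
next
  interpret M: right_module A M by fact
  case (insert x S)
  let ?H = "submodule_hull A M S"
  have xS: "x \<in> homogeneous M" "x \<in> carrier M" "S \<subseteq> homogeneous M" "S \<subseteq> carrier M"
    using insert.prems by (auto simp: homogeneous_def)
  note H = M.submodule_hull_submodule[OF xS(4)]
  note HD = M.right_submoduleD[OF H] and UD = M.right_submoduleD[OF insert.prems(2)]
  have dec: "\<exists>a \<in> carrier A. \<exists>w \<in> ?H. u = a \<odot>\<^bsub>M\<^esub> x \<oplus>\<^bsub>M\<^esub> w" if "u \<in> U" for u
    using that insert.prems(3) M.submodule_hull_insert[OF xS(2,4)]
    by (auto simp: mem_set_add cyclic_def subset_iff)
  show ?case
  proof (cases "U \<subseteq> ?H")
    case True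
    then show ?thesis using insert.IH[OF xS(3) insert.prems(2)] by blast
  next
    case False
    then obtain u where u: "u \<in> U" "u \<notin> ?H" by blast
    then obtain a w where aw: "a \<in> carrier A" "w \<in> ?H" "u = a \<odot>\<^bsub>M\<^esub> x \<oplus>\<^bsub>M\<^esub> w" using dec by blast
    then obtain b w' where b: "b \<in> carrier A" "w' \<in> ?H" "b \<odot>\<^bsub>M\<^esub> u = x \<oplus>\<^bsub>M\<^esub> w'"
      using annihilated_exchange[OF M xS(1) H aw(2,1)] u(2) by blast
    define z where "z = x \<oplus>\<^bsub>M\<^esub> w'"
    have z: "z \<in> U" using UD(7)[OF b(1) u(1)] b(3) by (simp add: z_def)
    obtain T where T: "finite T" "T \<subseteq> U \<inter> ?H" "submodule_hull A M T = U \<inter> ?H"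
      using insert.IH[OF xS(3) M.submodule_Int[OF insert.prems(2) H]] by blast
    have Tc: "T \<subseteq> carrier M" using T(2) UD(2) by blast
    \<comment> \<open>Subtracting a multiple of \<open>z\<close> removes the \<open>x\<close>-part
      of \<open>y\<close> and leaves an element of \<open>U \<inter> ?H\<close>, which
      \<open>T\<close> generates.\<close>
    have "y \<in> submodule_hull A M (insert z T)" if y: "y \<in> U" for y
    proof -
      obtain c w'' where c: "c \<in> carrier A" "w'' \<in> ?H" "y = c \<odot>\<^bsub>M\<^esub> x \<oplus>\<^bsub>M\<^esub> w''" using dec y by blast
      have cz: "c \<odot>\<^bsub>M\<^esub> z = c \<odot>\<^bsub>M\<^esub> x \<oplus>\<^bsub>M\<^esub> c \<odot>\<^bsub>M\<^esub> w'"
        unfolding z_def using c b xS HD(1) by (simp add: M.smult_add_right)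
      have "y \<ominus>\<^bsub>M\<^esub> c \<odot>\<^bsub>M\<^esub> z = w'' \<ominus>\<^bsub>M\<^esub> c \<odot>\<^bsub>M\<^esub> w'"
        unfolding cz c(3) using c b xS HD(1)
        by (simp add: a_minus_def M.smult_closed M.M.a_ac M.M.minus_add M.M.r_neg M.M.r_neg1 M.M.r_neg2)
      moreover have "w'' \<ominus>\<^bsub>M\<^esub> c \<odot>\<^bsub>M\<^esub> w' \<in> ?H" using HD(6)[OF c(2) HD(7)[OF c(1) b(2)]] .
      moreover have "y \<ominus>\<^bsub>M\<^esub> c \<odot>\<^bsub>M\<^esub> z \<in> U" using UD(6)[OF y UD(7)[OF c(1) z]] .
      ultimately have "y \<ominus>\<^bsub>M\<^esub> c \<odot>\<^bsub>M\<^esub> z \<in> submodule_hull A M T" using T(3) by simp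
      moreover have "y = c \<odot>\<^bsub>M\<^esub> z \<oplus>\<^bsub>M\<^esub> (y \<ominus>\<^bsub>M\<^esub> c \<odot>\<^bsub>M\<^esub> z)"
        using UD(1)[OF y] UD(1)[OF z] c(1)
        by (simp add: a_minus_def M.smult_closed M.M.a_ac M.M.r_neg M.M.r_neg1 M.M.r_neg2)
      ultimately show ?thesis
        unfolding M.submodule_hull_insert[OF UD(1)[OF z] Tc] mem_set_add cyclic_def using c(1) by blast
    qed
    moreover have "submodule_hull A M (insert z T) \<subseteq> U"
      by (rule submodule_hull_least[OF insert.prems(2)]) (use z T(2) in auto)
    ultimately have "submodule_hull A M (insert z T) = U" by blast
    then show ?thesis using T(1,2) z by (intro exI[of _ "insert z T"]) auto
  qed
qed

text \<open>Plays the part of the noetherian property when kernels of covers are shown to be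
  finitely generated.\<close>

lemma annihilated_fin_gen_submodule:
  assumes M: "right_module A M" "annihilated M" "fin_gen A M" and U: "submodule U A M"
  shows "fin_gen A (M\<lparr>carrier := U\<rparr>)"
proof -
  interpret M: right_module A M by fact
  obtain S where "finite S" "S \<subseteq> homogeneous M" "submodule_hull A M S = carrier M"
    using homogeneous_generators[OF M(1,3)] .
  then show ?thesis
    unfolding M.fin_gen_submodule_iff[OF U]
    using annihilated_submodule_generators[OF M(1,2)] U M.right_submoduleD(2)[OF U] by metis
qed

text \<open>The submodule \<open>M I\<close>; the hull is taken because the set of products need not
  be closed under addition.\<close>

definition rad_part :: "('a, 'm) module \<Rightarrow> 'm set" where
  "rad_part M = submodule_hull A M {n \<odot>\<^bsub>M\<^esub> x | n x. n \<in> I \<and> x \<in> carrier M}"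

lemma rad_part_submodule:
  assumes "right_module A M" shows "submodule (rad_part M) A M"
proof -
  interpret M: right_module A M by fact
  show ?thesis unfolding rad_part_def
    by (rule M.submodule_hull_submodule) (auto intro: M.smult_closed I_closed)
qed

lemma smult_mem_rad_part: "n \<in> I \<Longrightarrow> x \<in> carrier M \<Longrightarrow> n \<odot>\<^bsub>M\<^esub> x \<in> rad_part M"
  unfolding rad_part_def by (rule subsetD[OF submodule_hull_superset]) blast

text \<open>As \<open>I\<close> squares to zero, it kills \<open>M I\<close>. Multiplying
  \<open>x = u \<oplus> t\<close> by an element of \<open>I\<close> therefore leaves only the
  contribution of \<open>u\<close>, so \<open>M I\<close> is contained in \<open>U\<close> and both
  parts of \<open>x\<close> lie in \<open>U\<close>.\<close>

lemma nakayama: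
  assumes M: "right_module A M" and U: "submodule U A M"
    and eq: "\<And>x. x \<in> carrier M \<Longrightarrow> \<exists>u \<in> U. \<exists>t \<in> rad_part M. x = u \<oplus>\<^bsub>M\<^esub> t"
  shows "U = carrier M"
proof -
  interpret M: right_module A M by fact
  note D = M.right_submoduleD[OF U] and R = M.right_submoduleD[OF rad_part_submodule[OF M]]
  let ?K = "{t \<in> carrier M. \<forall>m \<in> I. m \<odot>\<^bsub>M\<^esub> t = \<zero>\<^bsub>M\<^esub>}"
  have "rad_part M \<subseteq> ?K"
    unfolding rad_part_def
  proof (rule submodule_hull_least)
    show "submodule ?K A M"
      by (rule M.right_submoduleI)
        (auto simp: M.smult_zero_right M.smult_add_right M.smult_closed M.smult_mult[symmetric] I_closed I_l_closed)
    show "{n \<odot>\<^bsub>M\<^esub> x | n x. n \<in> I \<and> x \<in> carrier M} \<subseteq> ?K"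
      by (auto simp: M.smult_closed I_closed M.smult_mult[symmetric] I_sq M.smult_zero_left)
  qed
  then have kill: "m \<odot>\<^bsub>M\<^esub> t = \<zero>\<^bsub>M\<^esub>" if "m \<in> I" "t \<in> rad_part M" for m t using that by blast
  have "m \<odot>\<^bsub>M\<^esub> x \<in> U" if m: "m \<in> I" and x: "x \<in> carrier M" for m x
  proof -
    obtain u t where ut: "u \<in> U" "t \<in> rad_part M" "x = u \<oplus>\<^bsub>M\<^esub> t" using eq[OF x] by blast
    then have "m \<odot>\<^bsub>M\<^esub> x = m \<odot>\<^bsub>M\<^esub> u"
      using m kill D(1) R(1) by (simp add: M.smult_add_right I_closed M.smult_closed)
    then show ?thesis using D(7)[OF I_closed[OF m] ut(1)] by simp
  qed
  then have "rad_part M \<subseteq> U" unfolding rad_part_def by (intro submodule_hull_least[OF U]) blast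
  then show ?thesis using eq D(2,4) by blast
qed

end

text \<open>
  The projective module \<open>w\<^sub>0 A \<oplus> w\<^sub>1 A \<oplus> \<cdots>\<close>, a submodule of \<open>A\<^sup>n\<close> padded with zeros.
\<close>

locale idempotent_family = ring A for A :: "('a, 'x) ring_scheme" (structure) +
  fixes w :: "nat \<Rightarrow> 'a" and n :: nat
  assumes w_closed: "\<And>i. w i \<in> carrier A"
    and w_idem: "\<And>i. w i \<otimes> w i = w i"
    and w_zero: "\<And>i. n \<le> i \<Longrightarrow> w i = \<zero>"
begin

definition P :: "('a, nat \<Rightarrow> 'a) module" where
  "P = \<lparr>carrier = {f. \<forall>i. f i \<in> carrier A \<and> w i \<otimes> f i = f i},
    monoid.mult = undefined, one = undefined, zero = (\<lambda>_. \<zero>),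
    add = (\<lambda>f g i. f i \<oplus> g i), smult = (\<lambda>a f i. f i \<otimes> a)\<rparr>"

lemma P_simps:
  "f \<in> carrier P \<longleftrightarrow> (\<forall>i. f i \<in> carrier A \<and> w i \<otimes> f i = f i)"
  "\<zero>\<^bsub>P\<^esub> = (\<lambda>_. \<zero>)" "f \<oplus>\<^bsub>P\<^esub> g = (\<lambda>i. f i \<oplus> g i)" "a \<odot>\<^bsub>P\<^esub> f = (\<lambda>i. f i \<otimes> a)"
  by (simp_all add: P_def)

lemma P_right_module: "right_module A P"
proof -
  have "abelian_group P"
  proof (rule abelian_groupI)
    show "\<exists>y \<in> carrier P. y \<oplus>\<^bsub>P\<^esub> x = \<zero>\<^bsub>P\<^esub>" if "x \<in> carrier P" for x
      using that by (intro bexI[of _ "\<lambda>i. \<ominus> x i"]) (auto simp: P_simps l_neg r_minus w_closed)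
  qed (auto simp: P_simps r_distr w_closed a_ac)
  then show ?thesis
    by (intro right_module.intro right_module_axioms.intro ring_axioms)
      (auto simp: P_simps l_distr r_distr w_closed m_assoc[symmetric])
qed

sublocale P: right_module A P by (rule P_right_module)

lemma P_nth_zero: "f \<in> carrier P \<Longrightarrow> n \<le> i \<Longrightarrow> f i = \<zero>"
  using w_zero[of i] by (metis P_simps(1) l_null)

text \<open>The generator of the \<open>i\<close>-th summand. Its entry is \<open>w i\<close> and
  not one, because one need not lie in \<open>w i A\<close>.\<close>

definition \<delta> :: "nat \<Rightarrow> nat \<Rightarrow> 'a" where "\<delta> i = (\<lambda>j. if j = i then w i else \<zero>)"

lemma \<delta>_closed: "\<delta> i \<in> carrier P"
  by (auto simp: P_simps \<delta>_def w_closed w_idem)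

text \<open>\<open>f\<close> is the sum of the elements in the last premise, so membership in a
  submodule can be tested coordinatewise. The submodule will be a hull, a radical part, or the
  equalizer of two homomorphisms.\<close>

lemma P_span:
  assumes W: "submodule W A P" and f: "f \<in> carrier P" and mem: "\<And>i. i < n \<Longrightarrow> f i \<odot>\<^bsub>P\<^esub> \<delta> i \<in> W"
  shows "f \<in> W"
proof -
  note D = P.right_submoduleD[OF W]
  have "(\<lambda>i. if i < m then f i else \<zero>) \<in> W" if "m \<le> n" for m
    using that
  proof (induction m)
    case 0
    then show ?case using D(3) by (simp add: P_simps)
  next
    case (Suc m)
    have "(\<lambda>i. if i < Suc m then f i else \<zero>) = (\<lambda>i. if i < m then f i else \<zero>) \<oplus>\<^bsub>P\<^esub> f m \<odot>\<^bsub>P\<^esub> \<delta> m"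
      using f by (auto simp: fun_eq_iff P_simps \<delta>_def less_Suc_eq)
    then show ?case using D(4)[OF Suc.IH mem[of m]] Suc.prems by simp
  qed
  from this[OF order_refl] have "(\<lambda>i. if i < n then f i else \<zero>) \<in> W" .
  moreover have "(\<lambda>i. if i < n then f i else \<zero>) = f" using P_nth_zero[OF f] by auto
  ultimately show ?thesis by simp
qed

lemma P_mod_cat: "P \<in> mod_cat A"
proof -
  have "U = carrier P" if "submodule U A P" "\<delta> ` {..<n} \<subseteq> U" for U
  proof
    show "U \<subseteq> carrier P" using P.right_submoduleD(2)[OF that(1)] .
    show "carrier P \<subseteq> U"
    proof
      fix f assume f: "f \<in> carrier P"
      show "f \<in> U"
      proof (rule P_span[OF that(1) f])
        fix i assume "i < n"
        then have "\<delta> i \<in> U" using that(2) by blast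
        then show "f i \<odot>\<^bsub>P\<^esub> \<delta> i \<in> U" using f P.right_submoduleD(7)[OF that(1)] by (simp add: P_simps(1))
      qed
    qed
  qed
  then have "fin_gen A P"
    unfolding fin_gen_def using \<delta>_closed by (intro exI[of _ "\<delta> ` {..<n}"]) auto
  then show ?thesis using P_right_module by (simp add: mod_cat_def)
qed

text \<open>The homomorphism out of \<open>P\<close> that takes \<open>\<delta> i\<close> to
  \<open>y i\<close>, provided \<open>w i\<close> fixes \<open>y i\<close>.\<close>

definition lift :: "('a, 'm) module \<Rightarrow> (nat \<Rightarrow> 'm) \<Rightarrow> (nat \<Rightarrow> 'a) \<Rightarrow> 'm" where
  "lift M y f = finsum M (\<lambda>i. f i \<odot>\<^bsub>M\<^esub> y i) {..<n}"

lemma lift_hom: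
  assumes "right_module A M" "\<And>i. i < n \<Longrightarrow> y i \<in> carrier M"
  shows "lift M y \<in> mod_hom A P M"
proof -
  interpret M: right_module A M by fact
  have fc: "(\<lambda>i. f i \<odot>\<^bsub>M\<^esub> y i) \<in> {..<n} \<rightarrow> carrier M" if "f \<in> carrier P" for f
    using that assms(2) by (auto simp: P_simps intro: M.smult_closed)
  show ?thesis
  proof (rule mod_homI)
    show "lift M y f \<in> carrier M" if "f \<in> carrier P" for f
      unfolding lift_def using fc[OF that] by (rule M.M.finsum_closed)
    show "lift M y (f \<oplus>\<^bsub>P\<^esub> g) = lift M y f \<oplus>\<^bsub>M\<^esub> lift M y g" if "f \<in> carrier P" "g \<in> carrier P" for f g
    proof -
      have "lift M y f \<oplus>\<^bsub>M\<^esub> lift M y g = finsum M (\<lambda>i. f i \<odot>\<^bsub>M\<^esub> y i \<oplus>\<^bsub>M\<^esub> g i \<odot>\<^bsub>M\<^esub> y i) {..<n}"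
        unfolding lift_def using M.M.finsum_addf[OF fc[OF that(1)] fc[OF that(2)]] by simp
      also have "\<dots> = lift M y (f \<oplus>\<^bsub>P\<^esub> g)"
        unfolding lift_def using that assms(2)
        by (intro M.M.add.finprod_cong') (auto simp: P_simps M.smult_add intro!: M.smult_closed)
      finally show ?thesis by simp
    qed
    show "lift M y (a \<odot>\<^bsub>P\<^esub> f) = a \<odot>\<^bsub>M\<^esub> lift M y f" if "a \<in> carrier A" "f \<in> carrier P" for a f
    proof -
      have "a \<odot>\<^bsub>M\<^esub> lift M y f = finsum M (\<lambda>i. a \<odot>\<^bsub>M\<^esub> (f i \<odot>\<^bsub>M\<^esub> y i)) {..<n}"
        unfolding lift_def using M.smult_finsum[OF _ that(1) fc[OF that(2)]] by simp
      also have "\<dots> = lift M y (a \<odot>\<^bsub>P\<^esub> f)"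
        unfolding lift_def using that assms(2)
        by (intro M.M.add.finprod_cong') (auto simp: P_simps M.smult_mult intro!: M.smult_closed)
      finally show ?thesis by simp
    qed
  qed
qed

lemma lift_\<delta>:
  assumes "right_module A M" "\<And>i. i < n \<Longrightarrow> y i \<in> carrier M" "\<And>i. i < n \<Longrightarrow> w i \<odot>\<^bsub>M\<^esub> y i = y i" "j < n"
  shows "lift M y (\<delta> j) = y j"
proof -
  interpret M: right_module A M by fact
  have "lift M y (\<delta> j) = finsum M (\<lambda>i. if j = i then y i else \<zero>\<^bsub>M\<^esub>) {..<n}"
    unfolding lift_def using assms
    by (intro M.M.add.finprod_cong') (auto simp: \<delta>_def M.smult_zero_left)
  also have "\<dots> = y j"
    using assms(2,4) M.M.add.finprod_singleton[of j "{..<n}" y] by auto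
  finally show ?thesis .
qed

lemma P_lifts_epis: "lifts_epis A P"
  unfolding lifts_epis_def
proof (intro ballI impI)
  fix M N g f assume M: "M \<in> mod_cat A" and N: "N \<in> mod_cat A" and g: "g \<in> mod_hom A M N"
    and f: "f \<in> mod_hom A P N" and s: "g ` carrier M = carrier N"
  interpret g: module_hom A M N g using g M N mod_catD(1) by (blast intro: module_hom_intro)
  interpret f: module_hom A P N f using f N P_right_module mod_catD(1) by (blast intro: module_hom_intro)
  have "\<exists>m \<in> carrier M. g m = f (\<delta> i)" for i
  proof -
    have "f (\<delta> i) \<in> g ` carrier M" unfolding s using f.hom_closed \<delta>_closed by blast
    then show ?thesis by (metis imageE)
  qed
  then obtain m where m: "\<And>i. m i \<in> carrier M" "\<And>i. g (m i) = f (\<delta> i)" by metis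
  \<comment> \<open>A preimage of \<open>f (\<delta> i)\<close> need not be fixed by
    \<open>w i\<close>; multiplying it by \<open>w i\<close> repairs this and keeps its image, since
    \<open>w i\<close> fixes \<open>\<delta> i\<close>.\<close>
  define y where "y i = w i \<odot>\<^bsub>M\<^esub> m i" for i
  have yc: "y i \<in> carrier M" and yw: "w i \<odot>\<^bsub>M\<^esub> y i = y i" for i
    using m(1) w_closed by (simp_all add: y_def g.dom.smult_closed g.dom.smult_mult[symmetric] w_idem)
  have gy: "g (y i) = f (\<delta> i)" for i
  proof -
    have "w i \<odot>\<^bsub>P\<^esub> \<delta> i = \<delta> i" using w_closed by (auto simp: P_simps \<delta>_def w_idem)
    then show ?thesis
      using m w_closed f.hom_smult[OF w_closed \<delta>_closed, of i i] by (simp add: y_def g.hom_smult)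
  qed
  note L = lift_hom[OF g.dom.right_module_axioms yc]
  interpret gl: module_hom A P N "\<lambda>p. g (lift M y p)"
    by (intro module_hom_intro P_right_module g.cod.right_module_axioms mod_hom_compose[OF L g])
  \<comment> \<open>The equalizer of two homomorphisms is a submodule, and this one contains every
    \<open>\<delta> i\<close>.\<close>
  have E: "submodule {p \<in> carrier P. g (lift M y p) = f p} A P"
    by (rule P.right_submoduleI)
      (auto simp: gl.hom_zero f.hom_zero gl.hom_add f.hom_add gl.hom_smult f.hom_smult P.smult_closed)
  have "p \<in> {p \<in> carrier P. g (lift M y p) = f p}" if p: "p \<in> carrier P" for p
  proof (rule P_span[OF E p])
    fix i assume "i < n"
    then have "\<delta> i \<in> {p \<in> carrier P. g (lift M y p) = f p}"
      using lift_\<delta>[OF g.dom.right_module_axioms yc yw, of i] gy by (simp add: \<delta>_closed)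
    then show "p i \<odot>\<^bsub>P\<^esub> \<delta> i \<in> {p \<in> carrier P. g (lift M y p) = f p}"
      using P.right_submoduleD(7)[OF E] p unfolding P_simps(1) by blast
  qed
  then have "\<forall>p \<in> carrier P. g (lift M y p) = f p" by simp
  then show "\<exists>h \<in> mod_hom A P M. \<forall>x \<in> carrier P. g (h x) = f x" by (rule bexI[OF _ L])
qed

lemma P_projective: "projective A P"
  using P_mod_cat P_lifts_epis by (simp add: projective_iff)

end

section \<open>Existence of projective covers with annihilated kernel\<close>

context rad_sq_zero_ring
begin

lemma cover_exists:
  assumes M: "M \<in> mod_cat A"
  shows "\<exists>P p. projective_cover A M P p \<and> fin_gen A (P\<lparr>carrier := mod_kernel P M p\<rparr>) \<and>
    annihilated (P\<lparr>carrier := mod_kernel P M p\<rparr>)"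
proof -
  interpret M: right_module A M using mod_catD(1)[OF M] .
  let ?gen = "\<lambda>S. finite S \<and> S \<subseteq> homogeneous M \<and> submodule_hull A M S = carrier M"
  obtain S0 where "finite S0" "S0 \<subseteq> homogeneous M" "submodule_hull A M S0 = carrier M"
    using homogeneous_generators[OF mod_catD[OF M]] .
  then have "?gen S0" by simp
  from ex_has_least_nat[of ?gen, OF this, of card]
  obtain S where least: "?gen S \<and> (\<forall>T. ?gen T \<longrightarrow> card S \<le> card T)" by (rule exE)
  note S = least[THEN conjunct1] and min = least[THEN conjunct2, rule_format]
  define n where "n = card S"
  obtain x where x: "bij_betw x {..<n} S"
    using ex_bij_betw_nat_finite[of S] S unfolding n_def lessThan_atLeast0 by blast
  have xS: "x i \<in> S" if "i < n" for i using x that by (auto simp: bij_betw_def)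
  have Sc: "S \<subseteq> carrier M" using S by (auto simp: homogeneous_def)
  have "\<exists>v \<in> V. e v \<odot>\<^bsub>M\<^esub> x i = x i" if "i < n" for i
    using xS[OF that] S by (auto simp: homogeneous_def)
  then obtain v where v: "\<And>i. i < n \<Longrightarrow> v i \<in> V" "\<And>i. i < n \<Longrightarrow> e (v i) \<odot>\<^bsub>M\<^esub> x i = x i" by metis
  define w where "w i = (if i < n then e (v i) else \<zero>)" for i
  interpret F: idempotent_family A w n
    by unfold_locales (use v e_closed e_idem in \<open>auto simp: w_def\<close>)
  let ?P = "F.P" and ?p = "F.lift M x"
  have xc: "x i \<in> carrier M" if "i < n" for i using xS[OF that] Sc by blast
  have xw: "w i \<odot>\<^bsub>M\<^esub> x i = x i" if "i < n" for i using v(2)[OF that] that by (simp add: w_def)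
  interpret p: module_hom A ?P M ?p
    by (intro module_hom_intro F.P_right_module M.right_module_axioms F.lift_hom xc)
  let ?K = "mod_kernel ?P M ?p"
  have surj: "?p ` carrier ?P = carrier M"
  proof -
    have "S \<subseteq> ?p ` carrier ?P"
    proof
      fix s assume "s \<in> S"
      then obtain i where i: "i < n" "s = x i" using x unfolding bij_betw_def by (metis imageE lessThan_iff)
      then have "?p (F.\<delta> i) = s" using F.lift_\<delta>[OF M.right_module_axioms xc xw] by blast
      then show "s \<in> ?p ` carrier ?P" using F.\<delta>_closed by blast
    qed
    then show ?thesis
      using submodule_hull_least[OF p.submodule_image[OF F.P.submodule_carrier]] S p.hom_closed by blast
  qed
  \<comment> \<open>A coordinate outside \<open>I\<close> can be inverted modulo \<open>I\<close>.
    The relation given by \<open>f\<close> then expresses \<open>x j\<close> through the other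
    generators up to \<open>M I\<close>, so by \<open>nakayama\<close> the others already generate
    \<open>M\<close>, against the choice of \<open>S\<close>.\<close>
  have ker: "f j \<in> I" if f: "f \<in> ?K" for f j
  proof (rule ccontr)
    assume fj: "f j \<notin> I"
    have fP: "f \<in> carrier ?P" and f0: "?p f = \<zero>\<^bsub>M\<^esub>" using f by (auto simp: p.mem_kernel)
    have fc: "f i \<in> carrier A" and wf: "w i \<otimes> f i = f i" for i using fP by (auto simp: F.P_simps)
    have j: "j < n" using F.P_nth_zero[OF fP] fj I_zero by (metis not_le)
    then have ej: "e (v j) \<otimes> f j = f j" using wf[of j] by (simp add: w_def)
    obtain b m where b: "b \<in> carrier A" "m \<in> I" "f j \<otimes> b = e (v j) \<oplus> m"
      using e_inverse[OF v(1)[OF j] fc[of j]] fj ej by metis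
    let ?W = "submodule_hull A M (S - {x j})"
    have W: "submodule ?W A M" using Sc by (intro M.submodule_hull_submodule) auto
    note WD = M.right_submoduleD[OF W] and RD = M.right_submoduleD[OF rad_part_submodule[OF M.right_module_axioms]]
    let ?t = "\<lambda>i. f i \<odot>\<^bsub>M\<^esub> x i"
    let ?r = "finsum M ?t ({..<n} - {j})"
    have tc: "?t i \<in> carrier M" if "i < n" for i using M.smult_closed[OF fc xc[OF that]] .
    have tW: "finsum M ?t T \<in> ?W" if "finite T" "T \<subseteq> {..<n} - {j}" for T
      using that
    proof (induction T rule: finite_induct)
      case empty
      then show ?case using WD(3) by simp
    next
      case (insert i T)
      have "x i \<noteq> x j" using insert.prems j x by (auto simp: bij_betw_def inj_on_def)
      then have "x i \<in> S - {x j}" using insert.prems xS by auto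
      then have "x i \<in> ?W" using submodule_hull_superset[of "S - {x j}" A M] by blast
      then have "?t i \<in> ?W" using WD(7)[OF fc] by blast
      moreover have "?t \<in> T \<rightarrow> carrier M" using insert.prems tc by auto
      ultimately show ?case using insert WD(1,4) by simp
    qed
    have r: "?r \<in> ?W" by (rule tW) auto
    have "?p f = ?t j \<oplus>\<^bsub>M\<^esub> ?r"
    proof -
      have "{..<n} = insert j ({..<n} - {j})" using j by auto
      then have "?p f = finsum M ?t (insert j ({..<n} - {j}))" by (simp add: F.lift_def)
      also have "\<dots> = ?t j \<oplus>\<^bsub>M\<^esub> ?r" using tc j by (intro M.M.finsum_insert) auto
      finally show ?thesis .
    qed
    then have "?t j \<oplus>\<^bsub>M\<^esub> ?r = \<zero>\<^bsub>M\<^esub>" using f0 by (rule trans[OF sym])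
    \<comment> \<open>Multiplication by \<open>b\<close> turns the coefficient of \<open>x j\<close>
      into \<open>e (v j) \<oplus> m\<close>, and \<open>e (v j)\<close> fixes
      \<open>x j\<close>.\<close>
    then have "\<zero>\<^bsub>M\<^esub> = b \<odot>\<^bsub>M\<^esub> (?t j \<oplus>\<^bsub>M\<^esub> ?r)" using b(1) by (simp only: M.smult_zero_right)
    also have "\<dots> = (f j \<otimes> b) \<odot>\<^bsub>M\<^esub> x j \<oplus>\<^bsub>M\<^esub> b \<odot>\<^bsub>M\<^esub> ?r"
      using b(1) fc xc[OF j] WD(1)[OF r] tc[OF j] by (simp add: M.smult_add_right M.smult_mult)
    also have "\<dots> = x j \<oplus>\<^bsub>M\<^esub> (m \<odot>\<^bsub>M\<^esub> x j \<oplus>\<^bsub>M\<^esub> b \<odot>\<^bsub>M\<^esub> ?r)"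
      unfolding b(3) using b fc xc[OF j] WD(1)[OF r] e_closed v(1)[OF j] v(2)[OF j]
      by (simp add: M.smult_add I_closed M.smult_closed M.M.a_assoc)
    finally have x0: "\<zero>\<^bsub>M\<^esub> = x j \<oplus>\<^bsub>M\<^esub> (m \<odot>\<^bsub>M\<^esub> x j \<oplus>\<^bsub>M\<^esub> b \<odot>\<^bsub>M\<^esub> ?r)" .
    have "m \<odot>\<^bsub>M\<^esub> x j \<oplus>\<^bsub>M\<^esub> b \<odot>\<^bsub>M\<^esub> ?r \<in> carrier M"
      using M.smult_closed[OF I_closed[OF b(2)] xc[OF j]] M.smult_closed[OF b(1) WD(1)[OF r]] by simp
    then have "x j = \<ominus>\<^bsub>M\<^esub> (m \<odot>\<^bsub>M\<^esub> x j \<oplus>\<^bsub>M\<^esub> b \<odot>\<^bsub>M\<^esub> ?r)"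
      using M.M.minus_equality[OF x0[symmetric] _ xc[OF j]] by simp
    also have "\<dots> = \<ominus>\<^bsub>M\<^esub> (b \<odot>\<^bsub>M\<^esub> ?r) \<oplus>\<^bsub>M\<^esub> \<ominus>\<^bsub>M\<^esub> (m \<odot>\<^bsub>M\<^esub> x j)"
      using b xc[OF j] WD(1)[OF r]
      by (simp add: I_closed M.smult_closed M.M.minus_add M.M.a_comm)
    finally have xj: "x j = \<ominus>\<^bsub>M\<^esub> (b \<odot>\<^bsub>M\<^esub> ?r) \<oplus>\<^bsub>M\<^esub> \<ominus>\<^bsub>M\<^esub> (m \<odot>\<^bsub>M\<^esub> x j)" .
    have "\<ominus>\<^bsub>M\<^esub> (b \<odot>\<^bsub>M\<^esub> ?r) \<in> ?W" "\<ominus>\<^bsub>M\<^esub> (m \<odot>\<^bsub>M\<^esub> x j) \<in> rad_part M"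
      using WD(5)[OF WD(7)[OF b(1) r]] RD(5)[OF smult_mem_rad_part[OF b(2) xc[OF j]]] .
    with xj have xjW: "x j \<in> ?W <+>\<^bsub>M\<^esub> rad_part M" unfolding mem_set_add by blast
    note sum = M.submodule_sum[OF W rad_part_submodule[OF M.right_module_axioms]]
    have "S \<subseteq> ?W <+>\<^bsub>M\<^esub> rad_part M"
      using xjW submodule_hull_superset[of "S - {x j}" A M]
        M.subset_submodule_sum(1)[OF W rad_part_submodule[OF M.right_module_axioms]] by blast
    then have "carrier M \<subseteq> ?W <+>\<^bsub>M\<^esub> rad_part M" using submodule_hull_least[OF sum] S by blast
    then have "?W = carrier M"
      by (intro nakayama[OF M.right_module_axioms W]) (auto simp: mem_set_add subset_iff)
    then have "card S \<le> card (S - {x j})" using S by (intro min) auto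
    then show False using card_Diff1_less[OF S[THEN conjunct1] xS[OF j]] by linarith
  qed
  have sup: "superfluous A ?P ?K"
    unfolding superfluous_def
  proof (intro allI impI, elim conjE)
    fix U assume U: "submodule U A ?P" "U <+>\<^bsub>?P\<^esub> ?K = carrier ?P"
    \<comment> \<open>Every coordinate of \<open>f\<close> lies in \<open>I\<close>, so the
      components of \<open>f\<close> along the \<open>\<delta> i\<close> are products with elements
      of \<open>I\<close>.\<close>
    have "?K \<subseteq> rad_part ?P"
    proof
      fix f assume f: "f \<in> ?K"
      show "f \<in> rad_part ?P"
        by (rule F.P_span[OF rad_part_submodule[OF F.P_right_module]])
          (use f ker[OF f] in \<open>auto simp: p.mem_kernel intro!: smult_mem_rad_part F.\<delta>_closed\<close>)
    qed
    then have "\<exists>u \<in> U. \<exists>t \<in> rad_part ?P. y = u \<oplus>\<^bsub>?P\<^esub> t" if "y \<in> carrier ?P" for y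
      using that mem_set_add[of y ?P U ?K] unfolding U(2) by blast
    then show "U = carrier ?P" by (rule nakayama[OF F.P_right_module U(1)])
  qed
  have cover: "projective_cover A M ?P ?p"
    using F.P_projective p.hom surj sup by (simp add: projective_cover_iff)
  \<comment> \<open>\<open>?R\<close> is the submodule \<open>P I\<close>. It is annihilated, so
    once it is finitely generated its submodule \<open>?K\<close> is finitely generated too.\<close>
  let ?R = "{f \<in> carrier ?P. \<forall>i. f i \<in> I}"
  have R: "submodule ?R A ?P"
    by (rule F.P.right_submoduleI)
      (auto simp: F.P_simps I_zero I_add I_r_closed r_distr F.w_closed m_assoc[symmetric])
  have KR: "?K \<subseteq> ?R" using ker by (auto simp: p.mem_kernel)
  have "fin_gen A (?P\<lparr>carrier := ?R\<rparr>)"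
    unfolding F.P.fin_gen_submodule_iff[OF R]
  proof (intro exI conjI)
    \<comment> \<open>One generator for each position and each element of \<open>G\<close>, as
      \<open>G\<close> generates \<open>I\<close> as a right ideal.\<close>
    let ?T = "(\<lambda>(i, g). g \<odot>\<^bsub>?P\<^esub> F.\<delta> i) ` ({..<n} \<times> G)"
    show "finite ?T" using G_finite by simp
    show T: "?T \<subseteq> ?R"
      using G_subset F.P.smult_closed[OF I_closed F.\<delta>_closed] I_l_closed[OF _ F.w_closed]
      by (auto simp: subset_iff) (auto simp: F.P_simps F.\<delta>_def I_zero I_closed)
    then have Tc: "?T \<subseteq> carrier ?P" by blast
    note H = F.P.submodule_hull_submodule[OF Tc]
    note HD = F.P.right_submoduleD[OF H]
    have "f \<in> submodule_hull A ?P ?T" if f: "f \<in> ?R" for f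
    proof (rule F.P_span[OF H])
      show "f \<in> carrier ?P" using f by blast
      fix i assume i: "i < n"
      \<comment> \<open>The scalars that carry \<open>\<delta> i\<close> into the hull form a right
        ideal containing \<open>G\<close>, so they include all of \<open>I\<close>.\<close>
      let ?X = "{a \<in> carrier A. a \<odot>\<^bsub>?P\<^esub> F.\<delta> i \<in> submodule_hull A ?P ?T}"
      have "I \<subseteq> ?X"
      proof (rule I_generated)
        show "\<zero> \<in> ?X" using HD(3) F.P.smult_zero_left[OF F.\<delta>_closed] by simp
        show "a \<oplus> b \<in> ?X" if "a \<in> ?X" "b \<in> ?X" for a b
          using that HD(4) F.P.smult_add[OF _ _ F.\<delta>_closed] by simp
        show "a \<otimes> b \<in> ?X" if "a \<in> ?X" "b \<in> carrier A" for a b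
          using that HD(7) F.P.smult_mult[OF _ _ F.\<delta>_closed] by simp
        show "G \<subseteq> ?X"
        proof
          fix g assume g: "g \<in> G"
          then have "g \<odot>\<^bsub>?P\<^esub> F.\<delta> i \<in> ?T" using i by (intro image_eqI[of _ _ "(i, g)"]) auto
          then show "g \<in> ?X"
            using g G_subset I_closed submodule_hull_superset[of ?T A ?P] by blast
        qed
      qed auto
      then show "f i \<odot>\<^bsub>?P\<^esub> F.\<delta> i \<in> submodule_hull A ?P ?T" using f by blast
    qed
    then show "submodule_hull A ?P ?T = ?R" using submodule_hull_least[OF R T] by blast
  qed
  moreover have ann: "annihilated (?P\<lparr>carrier := ?R\<rparr>)"
    by (auto simp: annihilated_def F.P_simps I_sq)
  moreover have "submodule ?K A (?P\<lparr>carrier := ?R\<rparr>)"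
    unfolding F.P.submodule_restrict_iff[OF R] using p.submodule_kernel KR by blast
  ultimately have "fin_gen A (?P\<lparr>carrier := ?K\<rparr>)" "annihilated (?P\<lparr>carrier := ?K\<rparr>)"
    using annihilated_fin_gen_submodule[of "?P\<lparr>carrier := ?R\<rparr>" ?K]
      annihilated_submodule[of "?P\<lparr>carrier := ?R\<rparr>" ?K] F.P.right_module_submodule[OF R] by simp_all
  with cover show ?thesis by blast
qed

sublocale syzygy_ring A
  by unfold_locales (use cover_exists in blast)

text \<open>The cover chosen by \<open>syzygy\<close> need not be the one constructed above, but
  their kernels are isomorphic.\<close>

lemma syzygy_annihilated:
  assumes "M \<in> mod_cat A" shows "annihilated (syzygy A M)"
proof -
  obtain P p where P: "projective_cover A M P p" "annihilated (P\<lparr>carrier := mod_kernel P M p\<rparr>)"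
    using cover_exists[OF assms] by blast
  then interpret p: module_hom A P M p
    using assms mod_catD(1) by (auto simp: projective_cover_iff projective_iff intro: module_hom_intro)
  note r = p.dom.right_module_submodule[OF p.submodule_kernel]
  note s = syzygy_right_module[OF assms]
  show ?thesis
    by (rule annihilated_iso[OF r s mod_iso_sym[OF s] P(2)])
      (rule syzygy_iso_kernel[OF assms assms mod_iso_refl P(1)])
qed

end

text \<open>Both modules are \<open>A\<close> modulo the same right ideal, the common annihilator of
  the two generators.\<close>

lemma cyclic_iso:
  assumes X: "right_module A X" "x \<in> carrier X" "carrier X = cyclic A X x"
    and Y: "right_module A Y" "y \<in> carrier Y" "carrier Y = cyclic A Y y"
    and ann: "\<And>a. a \<in> carrier A \<Longrightarrow> a \<odot>\<^bsub>X\<^esub> x = \<zero>\<^bsub>X\<^esub> \<longleftrightarrow> a \<odot>\<^bsub>Y\<^esub> y = \<zero>\<^bsub>Y\<^esub>"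
  shows "mod_iso A X Y"
proof -
  interpret X: right_module A X by fact
  interpret Y: right_module A Y by fact
  have eq: "a \<odot>\<^bsub>X\<^esub> x = b \<odot>\<^bsub>X\<^esub> x \<longleftrightarrow> a \<odot>\<^bsub>Y\<^esub> y = b \<odot>\<^bsub>Y\<^esub> y" if "a \<in> carrier A" "b \<in> carrier A" for a b
    using ann[of "a \<ominus>\<^bsub>A\<^esub> b"] that X(2) Y(2)
    by (simp add: X.smult_diff Y.smult_diff X.diff_eq_zero_iff Y.diff_eq_zero_iff X.smult_closed Y.smult_closed)
  \<comment> \<open>A coefficient is chosen for every element; by \<open>eq\<close> the resulting
    image does not depend on the choice.\<close>
  define k where "k u = (SOME a. a \<in> carrier A \<and> u = a \<odot>\<^bsub>X\<^esub> x)" for u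
  have k: "k u \<in> carrier A \<and> u = k u \<odot>\<^bsub>X\<^esub> x" if "u \<in> carrier X" for u
    unfolding k_def by (rule someI_ex) (use that X(3) in \<open>auto simp: cyclic_def\<close>)
  define f where "f u = k u \<odot>\<^bsub>Y\<^esub> y" for u
  have f: "f (a \<odot>\<^bsub>X\<^esub> x) = a \<odot>\<^bsub>Y\<^esub> y" if "a \<in> carrier A" for a
    unfolding f_def using k[of "a \<odot>\<^bsub>X\<^esub> x"] eq[of "k (a \<odot>\<^bsub>X\<^esub> x)" a] that X(2) X.smult_closed by metis
  have dec: "\<exists>a \<in> carrier A. u = a \<odot>\<^bsub>X\<^esub> x" if "u \<in> carrier X" for u using k[OF that] by blast
  have "f \<in> mod_hom A X Y"
  proof (rule mod_homI)
    show "f u \<in> carrier Y" if "u \<in> carrier X" for u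
      using dec[OF that] f Y(2) Y.smult_closed by auto
    show "f (u \<oplus>\<^bsub>X\<^esub> u') = f u \<oplus>\<^bsub>Y\<^esub> f u'" if u: "u \<in> carrier X" "u' \<in> carrier X" for u u'
    proof -
      obtain a b where "a \<in> carrier A" "u = a \<odot>\<^bsub>X\<^esub> x" "b \<in> carrier A" "u' = b \<odot>\<^bsub>X\<^esub> x"
        using dec u by meson
      then show ?thesis using f[of "a \<oplus>\<^bsub>A\<^esub> b"] X(2) Y(2) by (simp add: X.smult_add Y.smult_add f)
    qed
    show "f (c \<odot>\<^bsub>X\<^esub> u) = c \<odot>\<^bsub>Y\<^esub> f u" if c: "c \<in> carrier A" and u: "u \<in> carrier X" for c u
    proof -
      obtain a where "a \<in> carrier A" "u = a \<odot>\<^bsub>X\<^esub> x" using dec u by meson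
      then show ?thesis using f[of "a \<otimes>\<^bsub>A\<^esub> c"] c X(2) Y(2) by (simp add: X.smult_mult Y.smult_mult f)
    qed
  qed
  moreover have "inj_on f (carrier X)"
  proof (rule inj_onI)
    fix u u' assume "u \<in> carrier X" "u' \<in> carrier X" "f u = f u'"
    moreover obtain a b where "a \<in> carrier A" "u = a \<odot>\<^bsub>X\<^esub> x" "b \<in> carrier A" "u' = b \<odot>\<^bsub>X\<^esub> x"
      using dec calculation(1,2) by meson
    ultimately show "u = u'" using eq by (simp add: f)
  qed
  moreover have "f ` carrier X = carrier Y"
    unfolding X(3) Y(3) cyclic_def image_image using f by (auto simp: image_iff)
  ultimately show ?thesis unfolding mod_iso_def bij_betw_def by blast
qed

section \<open>Simple modules and their classes\<close>

context rad_sq_zero_ring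
begin

text \<open>The simple module at the vertex \<open>v\<close>, described by a generator because the
  annihilator of the generator decides the isomorphism type.\<close>

definition simple_at :: "'v \<Rightarrow> ('a, 'm) module \<Rightarrow> bool" where
  "simple_at v X \<longleftrightarrow> annihilated X \<and>
     (\<exists>x \<in> carrier X. x \<noteq> \<zero>\<^bsub>X\<^esub> \<and> e v \<odot>\<^bsub>X\<^esub> x = x \<and> carrier X = cyclic A X x)"

text \<open>The right-hand side mentions only the vertex, which is why a vertex determines its
  simple module up to isomorphism.\<close>

lemma smult_eq_zero_iff:
  assumes "right_module A X" "annihilated X" "v \<in> V" "x \<in> carrier X" "e v \<odot>\<^bsub>X\<^esub> x = x" "x \<noteq> \<zero>\<^bsub>X\<^esub>"
    and "a \<in> carrier A"
  shows "a \<odot>\<^bsub>X\<^esub> x = \<zero>\<^bsub>X\<^esub> \<longleftrightarrow> e v \<otimes> a \<in> I"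
proof
  interpret X: right_module A X by fact
  assume "a \<odot>\<^bsub>X\<^esub> x = \<zero>\<^bsub>X\<^esub>"
  then show "e v \<otimes> a \<in> I"
    using annihilated_smult(3)[OF assms(1-5,7)] assms(6) X.smult_zero_right by metis
qed (rule annihilated_smult(2)[OF assms(1-5,7)])

lemma simple_at_iso:
  assumes "right_module A X" "right_module A Y" "v \<in> V" "simple_at v X" "simple_at v Y"
  shows "mod_iso A X Y"
proof -
  obtain x where x: "annihilated X" "x \<in> carrier X" "x \<noteq> \<zero>\<^bsub>X\<^esub>" "e v \<odot>\<^bsub>X\<^esub> x = x" "carrier X = cyclic A X x"
    using assms(4) by (auto simp: simple_at_def)
  obtain y where y: "annihilated Y" "y \<in> carrier Y" "y \<noteq> \<zero>\<^bsub>Y\<^esub>" "e v \<odot>\<^bsub>Y\<^esub> y = y" "carrier Y = cyclic A Y y"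
    using assms(5) by (auto simp: simple_at_def)
  show ?thesis
    by (rule cyclic_iso[OF assms(1) x(2,5) assms(2) y(2,5)])
      (simp add: smult_eq_zero_iff[OF assms(1) x(1) assms(3) x(2,4,3)]
        smult_eq_zero_iff[OF assms(2) y(1) assms(3) y(2,4,3)])
qed

text \<open>Any nonzero element can be multiplied back to the generator \<open>x\<close>, so a
  nonzero submodule contains \<open>x\<close>.\<close>

lemma simple_at_submodule:
  assumes "right_module A X" "v \<in> V" "simple_at v X" "submodule U A X"
  shows "U = {\<zero>\<^bsub>X\<^esub>} \<or> U = carrier X"
proof (rule disjCI)
  interpret X: right_module A X by fact
  obtain x where x: "annihilated X" "x \<in> carrier X" "x \<noteq> \<zero>\<^bsub>X\<^esub>" "e v \<odot>\<^bsub>X\<^esub> x = x" "carrier X = cyclic A X x"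
    using assms(3) by (auto simp: simple_at_def)
  note D = X.right_submoduleD[OF assms(4)]
  assume "U \<noteq> carrier X"
  then have xU: "x \<notin> U" using X.cyclic_subset[OF assms(4)] D(2) x(5) by blast
  have "u = \<zero>\<^bsub>X\<^esub>" if u: "u \<in> U" for u
  proof -
    obtain a where a: "a \<in> carrier A" "u = a \<odot>\<^bsub>X\<^esub> x" using D(1)[OF u] x(5) by (auto simp: cyclic_def)
    show ?thesis
    proof (cases "e v \<otimes> a \<in> I")
      case True
      then show ?thesis using annihilated_smult(2)[OF assms(1) x(1) assms(2) x(2,4) a(1)] a(2) by simp
    next
      case False
      then show ?thesis
        using annihilated_smult(3)[OF assms(1) x(1) assms(2) x(2,4) a(1)] a(2) D(7)[OF _ u] xU by metis
    qed
  qed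
  then show "U = {\<zero>\<^bsub>X\<^esub>}" using D(3) by blast
qed

text \<open>The kernel of the projection to the second summand is zero or everything; in the first
  case the first summand vanishes, in the other the second one.\<close>

lemma simple_at_indecomposable:
  assumes X: "X \<in> mod_cat A" and v: "v \<in> V" "simple_at v X"
  shows "indecomposable A X"
  unfolding indecomposable_def
proof (intro conjI ballI impI)
  show "carrier X \<noteq> {\<zero>\<^bsub>X\<^esub>}" using v(2) by (auto simp: simple_at_def)
  fix N N' assume N: "N \<in> mod_cat A" "N' \<in> mod_cat A" and iso: "mod_iso A X (mod_sum N N')"
  obtain f where f: "f \<in> mod_hom A X (mod_sum N N')" "bij_betw f (carrier X) (carrier (mod_sum N N'))"
    using iso unfolding mod_iso_def by blast
  have surj: "f ` carrier X = carrier (mod_sum N N')" using f(2) by (simp add: bij_betw_def)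
  interpret N: right_module A N using mod_catD(1)[OF N(1)] .
  interpret N': right_module A N' using mod_catD(1)[OF N(2)] .
  interpret f: module_hom A X "mod_sum N N'" f
    using X f(1) mod_catD(1) N right_module_mod_sum by (blast intro: module_hom_intro)
  interpret g: module_hom A X N' "\<lambda>x. snd (f x)"
    by (intro module_hom_intro f.dom.right_module_axioms N'.right_module_axioms
        mod_hom_compose[OF f(1) mod_hom_projections(2)])
  from simple_at_submodule[OF f.dom.right_module_axioms v g.submodule_kernel]
  show "carrier N = {\<zero>\<^bsub>N\<^esub>} \<or> carrier N' = {\<zero>\<^bsub>N'\<^esub>}"
  proof
    assume K: "mod_kernel X N' (\<lambda>x. snd (f x)) = {\<zero>\<^bsub>X\<^esub>}"
    have "y = \<zero>\<^bsub>N\<^esub>" if y: "y \<in> carrier N" for y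
    proof -
      have "(y, \<zero>\<^bsub>N'\<^esub>) \<in> f ` carrier X" using y by (simp add: surj mod_sum_simps)
      then obtain u where u: "u \<in> carrier X" "f u = (y, \<zero>\<^bsub>N'\<^esub>)" by (metis imageE)
      then have "u \<in> mod_kernel X N' (\<lambda>x. snd (f x))" by (simp add: g.mem_kernel)
      then have "u = \<zero>\<^bsub>X\<^esub>" using K by simp
      then show ?thesis using u(2) f.hom_zero by (simp add: mod_sum_simps)
    qed
    then show ?thesis using N.M.zero_closed by blast
  next
    assume K: "mod_kernel X N' (\<lambda>x. snd (f x)) = carrier X"
    have "y = \<zero>\<^bsub>N'\<^esub>" if y: "y \<in> carrier N'" for y
    proof -
      have "(\<zero>\<^bsub>N\<^esub>, y) \<in> f ` carrier X" using y by (simp add: surj mod_sum_simps)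
      then obtain u where u: "u \<in> carrier X" "f u = (\<zero>\<^bsub>N\<^esub>, y)" by (metis imageE)
      then show ?thesis using K g.mem_kernel[of u] by simp
    qed
    then show ?thesis using N'.M.zero_closed by blast
  qed
qed

definition simple_classes :: "(('a, nat \<Rightarrow> 'a) module set \<Rightarrow>\<^sub>0 int) set set" where
  "simple_classes = {K0_class A X | X v. X \<in> mod_cat A \<and> v \<in> V \<and> simple_at v X}"

text \<open>Each of the finitely many vertices contributes at most one class, by
  \<open>simple_at_iso\<close>.\<close>

lemma simple_classes_finite: "finite simple_classes"
proof -
  let ?C = "\<lambda>v. {K0_class A X | X. X \<in> mod_cat A \<and> simple_at v X}"
  have "finite (?C v)" if v: "v \<in> V" for v
  proof (cases "?C v = {}")
    case True
    then show ?thesis by (simp only: finite.emptyI)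
  next
    case False
    then obtain Y where Y: "Y \<in> mod_cat A" "simple_at v Y" by blast
    have "K0_class A X = K0_class A Y" if "X \<in> mod_cat A" "simple_at v X" for X
      using K0_class_iso simple_at_iso[OF _ _ v that(2) Y(2)] mod_catD(1) that(1) Y(1) by metis
    then have "?C v \<subseteq> {K0_class A Y}" by auto
    then show ?thesis by (rule finite_subset) simp
  qed
  moreover have "simple_classes = (\<Union>v \<in> V. ?C v)" by (auto simp: simple_classes_def)
  ultimately show ?thesis using V_finite by simp
qed

lemma simple_classes_subset: "simple_classes \<subseteq> carrier (K0 A)"
  using K0_class_closed by (auto simp: simple_classes_def)

lemma generate_simple_classes_subgroup: "subgroup (generate (K0 A) simple_classes) (K0 A)"
  using group.generate_is_subgroup[OF comm_group.axioms(2)[OF K0_comm_group] simple_classes_subset] .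

text \<open>A generator \<open>x\<close> outside the hull of the others generates a simple module
  meeting that hull in zero, since a nonzero common element could be multiplied back to
  \<open>x\<close>. Thus every new generator either changes nothing or splits off a simple
  summand.\<close>

lemma annihilated_hull_class:
  assumes M: "M \<in> mod_cat A" "annihilated M" and S: "finite S" "S \<subseteq> homogeneous M"
  shows "K0_class A (M\<lparr>carrier := submodule_hull A M S\<rparr>) \<in> generate (K0 A) simple_classes"
  using S
proof (induction S rule: finite_induct)
  interpret M: right_module A M using mod_catD(1)[OF M(1)] .
  note sg = generate_simple_classes_subgroup
  {
    case empty
    have "K0_class A (M\<lparr>carrier := {\<zero>\<^bsub>M\<^esub>}\<rparr>) = \<one>\<^bsub>K0 A\<^esub>"
      using mod_cat_submodule[OF M(1) M.submodule_zero M.fin_gen_zero] by (intro K0_class_zero) auto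
    then show ?case using subgroup.one_closed[OF sg] by (simp add: M.submodule_hull_empty)
  next
    case (insert x S)
    let ?H = "submodule_hull A M S" and ?B = "submodule_hull A M (insert x S)" and ?C = "cyclic A M x"
    have xS: "x \<in> carrier M" "S \<subseteq> carrier M" "x \<in> homogeneous M" "S \<subseteq> homogeneous M"
      using insert.prems by (auto simp: homogeneous_def)
    then obtain v where v: "v \<in> V" "e v \<odot>\<^bsub>M\<^esub> x = x" by (auto simp: homogeneous_def)
    have H: "submodule ?H A M" and B: "submodule ?B A M" and C: "submodule ?C A M"
      using xS M.cyclic_submodule by (auto intro!: M.submodule_hull_submodule)
    have B_eq: "?B = ?C <+>\<^bsub>M\<^esub> ?H" by (rule M.submodule_hull_insert[OF xS(1,2)])
    have IH: "K0_class A (M\<lparr>carrier := ?H\<rparr>) \<in> generate (K0 A) simple_classes"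
      using insert.IH xS(4) .
    show ?case
    proof (cases "x \<in> ?H")
      case True
      then have "?B = ?H"
        using submodule_hull_least[OF H, of "insert x S"] submodule_hull_superset[of S A M]
          M.submodule_hull_mono[of S "insert x S"] by blast
      then show ?thesis using IH by simp
    next
      case False
      have HB: "?C \<subseteq> ?B" "?H \<subseteq> ?B" unfolding B_eq by (rule M.subset_submodule_sum[OF C H])+
      have fg: "fin_gen A (M\<lparr>carrier := ?H\<rparr>)" "fin_gen A (M\<lparr>carrier := ?B\<rparr>)"
        by (rule iffD2[OF M.fin_gen_submodule_iff[OF H]] iffD2[OF M.fin_gen_submodule_iff[OF B]];
            intro exI[of _ S] exI[of _ "insert x S"] conjI finite.insertI submodule_hull_superset refl
              insert.hyps(1))+
      have mc: "M\<lparr>carrier := ?H\<rparr> \<in> mod_cat A" "M\<lparr>carrier := ?B\<rparr> \<in> mod_cat A" "M\<lparr>carrier := ?C\<rparr> \<in> mod_cat A"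
        by (rule mod_cat_submodule[OF M(1)]; rule H B C fg M.fin_gen_cyclic[OF xS(1)])+
      have "y = \<zero>\<^bsub>M\<^esub>" if y: "y \<in> ?C" "y \<in> ?H" for y
      proof -
        obtain a where a: "a \<in> carrier A" "y = a \<odot>\<^bsub>M\<^esub> x" using y(1) by (auto simp: cyclic_def)
        show ?thesis
        proof (cases "e v \<otimes> a \<in> I")
          case True
          then show ?thesis
            using annihilated_smult(2)[OF M.right_module_axioms M(2) v(1) xS(1) v(2) a(1)] a(2) by simp
        next
          case False
          then obtain b where b: "b \<in> carrier A" "b \<odot>\<^bsub>M\<^esub> y = x"
            using annihilated_smult(3)[OF M.right_module_axioms M(2) v(1) xS(1) v(2) a(1)] a(2) by blast
          then have "x \<in> ?H" using M.right_submoduleD(7)[OF H b(1) y(2)] by simp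
          with \<open>x \<notin> ?H\<close> show ?thesis by contradiction
        qed
      qed
      then have int: "?C \<inter> ?H = {\<zero>\<^bsub>M\<^esub>}"
        using M.right_submoduleD(3)[OF C] M.right_submoduleD(3)[OF H] by blast
      interpret B: right_module A "M\<lparr>carrier := ?B\<rparr>" using mod_catD(1)[OF mc(2)] .
      \<comment> \<open>The decomposition takes place inside \<open>?B\<close>, hence the doubly
        updated records, which then simplify to submodules of \<open>M\<close>.\<close>
      have "mod_iso A (M\<lparr>carrier := ?B\<rparr>) (mod_sum (M\<lparr>carrier := ?B, carrier := ?C\<rparr>) (M\<lparr>carrier := ?B, carrier := ?H\<rparr>))"
      proof (rule B.internal_direct_sum)
        show "submodule ?C A (M\<lparr>carrier := ?B\<rparr>)" "submodule ?H A (M\<lparr>carrier := ?B\<rparr>)"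
          unfolding M.submodule_restrict_iff[OF B] using C H HB by blast+
        show "?C \<inter> ?H = {\<zero>\<^bsub>M\<lparr>carrier := ?B\<rparr>\<^esub>}" using int by simp
        have "?C <+>\<^bsub>M\<lparr>carrier := ?B\<rparr>\<^esub> ?H = ?C <+>\<^bsub>M\<^esub> ?H" by (simp add: set_add_def')
        then show "?C <+>\<^bsub>M\<lparr>carrier := ?B\<rparr>\<^esub> ?H = carrier (M\<lparr>carrier := ?B\<rparr>)" using B_eq by simp
      qed
      then have "mod_iso A (M\<lparr>carrier := ?B\<rparr>) (mod_sum (M\<lparr>carrier := ?C\<rparr>) (M\<lparr>carrier := ?H\<rparr>))" by simp
      from K0_class_mod_sum[OF mc(2,3,1) this]
      have eq: "K0_class A (M\<lparr>carrier := ?B\<rparr>) =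
        K0_class A (M\<lparr>carrier := ?C\<rparr>) \<otimes>\<^bsub>K0 A\<^esub> K0_class A (M\<lparr>carrier := ?H\<rparr>)" .
      have "x \<noteq> \<zero>\<^bsub>M\<^esub>" using \<open>x \<notin> ?H\<close> M.right_submoduleD(3)[OF H] by blast
      then have "simple_at v (M\<lparr>carrier := ?C\<rparr>)"
        unfolding simple_at_def using v(2) M.mem_cyclic[OF xS(1)]
          annihilated_submodule[OF M.right_module_axioms M(2) C]
        by (intro conjI bexI[of _ x]) (auto simp: cyclic_def)
      then have "K0_class A (M\<lparr>carrier := ?C\<rparr>) \<in> simple_classes"
        unfolding simple_classes_def using mc(3) v(1) by blast
      then have "K0_class A (M\<lparr>carrier := ?C\<rparr>) \<in> generate (K0 A) simple_classes"
        by (rule generate.incl)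
      then show ?thesis unfolding eq using IH by (rule subgroup.m_closed[OF sg])
    qed
  }
qed

lemma annihilated_class:
  assumes M: "M \<in> mod_cat A" "annihilated M"
  shows "K0_class A M \<in> generate (K0 A) simple_classes"
proof -
  obtain S where S: "finite S" "S \<subseteq> homogeneous M" "submodule_hull A M S = carrier M"
    using homogeneous_generators[OF mod_catD[OF M(1)]] .
  have "M\<lparr>carrier := carrier M\<rparr> = M" by simp
  then show ?thesis using annihilated_hull_class[OF M S(1,2)] S(3) by simp
qed

text \<open>On classes of modules this holds because syzygies are annihilated; the elements with
  this property form a subgroup, so \<open>K0_induct\<close> applies.\<close>

lemma Omega_bar_image:
  assumes "x \<in> carrier (K0 A)" shows "Omega_bar A x \<in> generate (K0 A) simple_classes"
proof -
  interpret K: comm_group "K0 A" by (rule K0_comm_group)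
  interpret h: group_hom "K0 A" "K0 A" "Omega_bar A"
    using Omega_bar(1) by unfold_locales
  note sg = generate_simple_classes_subgroup
  have "subgroup {x \<in> carrier (K0 A). Omega_bar A x \<in> generate (K0 A) simple_classes} (K0 A)"
    using subgroup.m_closed[OF sg] subgroup.m_inv_closed[OF sg] subgroup.one_closed[OF sg]
    by (intro K.subgroupI) (auto intro!: exI[of _ "\<one>\<^bsub>K0 A\<^esub>"])
  then have "carrier (K0 A) \<subseteq> {x \<in> carrier (K0 A). Omega_bar A x \<in> generate (K0 A) simple_classes}"
    by (rule K0_induct)
      (simp add: K0_class_closed Omega_bar(2) annihilated_class syzygy_mod_cat syzygy_annihilated)
  then show ?thesis using assms by blast
qed

end

text \<open>
  The hypotheses on \<open>M\<close> and \<open>z\<close> say that \<open>M\<close> is isomorphic to the right module \<open>A / I\<close>.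
\<close>

locale rad_quotient = rad_sq_zero_ring A I V e G + M: right_module A M
  for A :: "('a, 'x) ring_scheme" (structure) and I :: "'a set" and V :: "'v set" and e G
    and M :: "('a, 'm) module" +
  fixes z
  assumes z_closed: "z \<in> carrier M" and z_generates: "carrier M = cyclic A M z"
    and z_annihilator: "\<And>a. a \<in> carrier A \<Longrightarrow> a \<odot>\<^bsub>M\<^esub> z = \<zero>\<^bsub>M\<^esub> \<longleftrightarrow> a \<in> I"
begin

text \<open>On \<open>z\<close> multiplied by \<open>a\<close>, the scalar \<open>n\<close> acts
  through \<open>a \<otimes> n\<close>, which lies in \<open>I\<close> because \<open>I\<close> is
  also a left ideal.\<close>

lemma quotient_annihilated: "annihilated M"
  unfolding annihilated_def
proof (intro ballI)
  fix n x assume n: "n \<in> I" and "x \<in> carrier M"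
  then obtain a where a: "a \<in> carrier A" "x = a \<odot>\<^bsub>M\<^esub> z" using z_generates by (auto simp: cyclic_def)
  then show "n \<odot>\<^bsub>M\<^esub> x = \<zero>\<^bsub>M\<^esub>"
    using n z_closed z_annihilator[of "a \<otimes> n"] I_l_closed
    by (simp add: M.smult_mult[symmetric] I_closed)
qed

lemma summand_annihilated:
  assumes "N \<in> mod_cat A" "direct_summand A N M" shows "annihilated N"
proof -
  obtain N' where N': "N' \<in> mod_cat A" "mod_iso A M (mod_sum N N')"
    using assms(2) by (auto simp: direct_summand_def)
  interpret N': right_module A N' using mod_catD(1)[OF N'(1)] .
  have "annihilated (mod_sum N N')"
    using annihilated_iso[OF M.right_module_axioms right_module_mod_sum N'(2) quotient_annihilated]
      mod_catD(1) assms(1) N'(1) by blast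
  then have "n \<odot>\<^bsub>mod_sum N N'\<^esub> (x, \<zero>\<^bsub>N'\<^esub>) = \<zero>\<^bsub>mod_sum N N'\<^esub>" if "n \<in> I" "x \<in> carrier N" for n x
    using that unfolding annihilated_def by (auto simp: mod_sum_simps(1))
  then show ?thesis by (simp add: annihilated_def mod_sum_simps)
qed

text \<open>The idempotent \<open>e v\<close> and its complement \<open>d\<close> split
  \<open>A / I\<close> into two cyclic parts; the part of \<open>e v\<close> is simple at
  \<open>v\<close>, hence isomorphic to \<open>X\<close>.\<close>

lemma simple_at_summand:
  assumes X: "X \<in> mod_cat A" and v: "v \<in> V" "simple_at v X"
  shows "direct_summand A X M"
proof -
  define d where "d = \<one> \<ominus> e v"
  have ev: "e v \<in> carrier A" and d: "d \<in> carrier A" using e_closed[OF v(1)] by (simp_all add: d_def)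
  have ed: "e v \<otimes> d = \<zero>"
    using ev by (simp add: d_def a_minus_def r_distr r_minus e_idem[OF v(1)] r_neg)
  have split: "a = e v \<otimes> a \<oplus> d \<otimes> a" if "a \<in> carrier A" for a
    using that ev by (simp add: d_def a_minus_def l_distr[symmetric] a_ac r_neg)
  define x where "x = e v \<odot>\<^bsub>M\<^esub> z"
  define y where "y = d \<odot>\<^bsub>M\<^esub> z"
  have x: "x \<in> carrier M" "a \<in> carrier A \<Longrightarrow> a \<odot>\<^bsub>M\<^esub> x = (e v \<otimes> a) \<odot>\<^bsub>M\<^esub> z" for a
    using ev z_closed by (simp_all add: x_def M.smult_closed M.smult_mult)
  have y: "y \<in> carrier M" "a \<in> carrier A \<Longrightarrow> a \<odot>\<^bsub>M\<^esub> y = (d \<otimes> a) \<odot>\<^bsub>M\<^esub> z" for a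
    using d z_closed by (simp_all add: y_def M.smult_closed M.smult_mult)
  let ?U = "cyclic A M x" and ?W = "cyclic A M y"
  have U: "submodule ?U A M" and W: "submodule ?W A M" using M.cyclic_submodule x(1) y(1) by auto
  have "u = \<zero>\<^bsub>M\<^esub>" if u: "u \<in> ?U" "u \<in> ?W" for u
  proof -
    obtain a where a: "a \<in> carrier A" "u = (e v \<otimes> a) \<odot>\<^bsub>M\<^esub> z" using u(1) x(2) by (auto simp: cyclic_def)
    obtain c where c: "c \<in> carrier A" "u = (d \<otimes> c) \<odot>\<^bsub>M\<^esub> z" using u(2) y(2) by (auto simp: cyclic_def)
    have "(e v \<otimes> a \<ominus> d \<otimes> c) \<odot>\<^bsub>M\<^esub> z = \<zero>\<^bsub>M\<^esub>"
      using a c ev d z_closed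
      by (simp add: M.smult_diff M.diff_eq_zero_iff M.smult_closed)
    then have "e v \<otimes> a \<ominus> d \<otimes> c \<in> I" using z_annihilator ev d a(1) c(1) by simp
    \<comment> \<open>Left multiplication by \<open>e v\<close> kills \<open>d \<otimes> c\<close>
      and fixes \<open>e v \<otimes> a\<close>, which separates the two parts.\<close>
    then have "e v \<otimes> (e v \<otimes> a \<ominus> d \<otimes> c) \<in> I" using I_l_closed ev by blast
    also have "e v \<otimes> (e v \<otimes> a \<ominus> d \<otimes> c) = e v \<otimes> a"
      using ev d a(1) c(1) by (simp add: a_minus_def r_distr r_minus m_assoc[symmetric] e_idem[OF v(1)] ed)
    finally show ?thesis using z_annihilator[of "e v \<otimes> a"] a ev by simp
  qed
  then have int: "?U \<inter> ?W = {\<zero>\<^bsub>M\<^esub>}"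
    using M.right_submoduleD(3)[OF U] M.right_submoduleD(3)[OF W] by blast
  have sum: "?U <+>\<^bsub>M\<^esub> ?W = carrier M"
  proof
    show "?U <+>\<^bsub>M\<^esub> ?W \<subseteq> carrier M" using M.right_submoduleD(2)[OF M.submodule_sum[OF U W]] .
    show "carrier M \<subseteq> ?U <+>\<^bsub>M\<^esub> ?W"
    proof
      fix m assume "m \<in> carrier M"
      then obtain a where a: "a \<in> carrier A" "m = a \<odot>\<^bsub>M\<^esub> z" using z_generates by (auto simp: cyclic_def)
      then have "m = (e v \<otimes> a) \<odot>\<^bsub>M\<^esub> z \<oplus>\<^bsub>M\<^esub> (d \<otimes> a) \<odot>\<^bsub>M\<^esub> z"
        using split[OF a(1)] M.smult_add[of "e v \<otimes> a" "d \<otimes> a" z] ev d z_closed by simp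
      then have "m = a \<odot>\<^bsub>M\<^esub> x \<oplus>\<^bsub>M\<^esub> a \<odot>\<^bsub>M\<^esub> y" using x(2) y(2) a(1) by simp
      then show "m \<in> ?U <+>\<^bsub>M\<^esub> ?W" unfolding mem_set_add cyclic_def using a(1) by blast
    qed
  qed
  have xn: "x \<noteq> \<zero>\<^bsub>M\<^esub>" unfolding x_def using z_annihilator[OF ev] e_notin[OF v(1)] by simp
  have xe: "e v \<odot>\<^bsub>M\<^esub> x = x" using x(2)[OF ev] by (simp add: e_idem[OF v(1)] x_def)
  have "simple_at v (M\<lparr>carrier := ?U\<rparr>)"
    unfolding simple_at_def using xe xn M.mem_cyclic[OF x(1)]
      annihilated_submodule[OF M.right_module_axioms quotient_annihilated U]
    by (intro conjI bexI[of _ x]) (auto simp: cyclic_def)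
  then have iX: "mod_iso A (M\<lparr>carrier := ?U\<rparr>) X"
    using simple_at_iso[OF M.right_module_submodule[OF U] mod_catD(1)[OF X] v(1)] v(2) by blast
  \<comment> \<open>The complement \<open>?W\<close> lives on the carrier type of \<open>M\<close>,
    whereas \<open>direct_summand\<close> asks for a complement in \<open>mod_cat\<close>.\<close>
  obtain N' where N': "N' \<in> mod_cat A" "mod_iso A (M\<lparr>carrier := ?W\<rparr>) N'"
    using mod_cat_representative[OF M.right_module_submodule[OF W] M.fin_gen_cyclic[OF y(1)]] by blast
  have "mod_iso A M (mod_sum X N')"
    by (rule mod_iso_trans[OF M.internal_direct_sum[OF U W int sum] mod_iso_mod_sum[OF iX N'(2)]])
  then show ?thesis unfolding direct_summand_def using N'(1) by blast
qed

text \<open>Summands of an annihilated module are annihilated, so their classes are generated by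
  those of simples; conversely each simple module at a vertex is an indecomposable summand.\<close>

lemma add_subgroup_eq: "add_subgroup A M = generate (K0 A) simple_classes"
proof
  interpret K: comm_group "K0 A" by (rule K0_comm_group)
  show "add_subgroup A M \<subseteq> generate (K0 A) simple_classes"
    unfolding add_subgroup_def
    by (rule K.generate_subgroup_incl[OF _ generate_simple_classes_subgroup])
      (auto intro: annihilated_class summand_annihilated)
  show "generate (K0 A) simple_classes \<subseteq> add_subgroup A M"
    unfolding add_subgroup_def
    by (rule K.mono_generate)
      (use simple_at_indecomposable simple_at_summand in \<open>unfold simple_classes_def, blast\<close>)
qed

theorem phi_dim_le: "phi_dim A \<le> enat (phi A M) + 1"
proof -
  interpret K: comm_group "K0 A" by (rule K0_comm_group)
  let ?H = "generate (K0 A) simple_classes" and ?\<Omega> = "Omega_bar A"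
  have "\<exists>l. \<forall>s. inj_on ?\<Omega> ((?\<Omega> ^^ (l + s)) ` add_subgroup A M)"
    unfolding add_subgroup_eq
    by (rule K.endomorphism_eventually_injective[OF Omega_bar(1) simple_classes_finite simple_classes_subset])
  then have inj: "\<forall>s. inj_on ?\<Omega> ((?\<Omega> ^^ (phi A M + s)) ` add_subgroup A M)"
    unfolding phi_def by (rule LeastI_ex)
  have "phi A X \<le> phi A M + 1" if X: "X \<in> mod_cat A" for X
    unfolding phi_def[of A X]
  \<comment> \<open>An upper bound for a least number asks only for a witness:
    \<open>phi A M + 1\<close> has the defining property for \<open>X\<close>.\<close>
  proof (rule Least_le, rule allI)
    fix s
    have "add_subgroup A X \<subseteq> carrier (K0 A)"
      unfolding add_subgroup_def by (rule K.generate_incl) (auto intro: K0_class_closed)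
    then have "?\<Omega> ` add_subgroup A X \<subseteq> add_subgroup A M"
      unfolding add_subgroup_eq using Omega_bar_image by blast
    \<comment> \<open>The power is split so that the single syzygy is applied first; the remaining
      exponent \<open>phi A M + s\<close> is the one in \<open>inj\<close>.\<close>
    then have "(?\<Omega> ^^ (phi A M + 1 + s)) ` add_subgroup A X \<subseteq> (?\<Omega> ^^ (phi A M + s)) ` add_subgroup A M"
      using image_mono[of "?\<Omega> ` add_subgroup A X" _ "?\<Omega> ^^ (phi A M + s)"]
      by (simp add: funpow_Suc_right image_comp del: funpow.simps)
    then show "inj_on ?\<Omega> ((?\<Omega> ^^ (phi A M + 1 + s)) ` add_subgroup A X)"
      using inj inj_on_subset by blast
  qed
  then have "enat (phi A X) \<le> enat (phi A M) + 1" if "X \<in> mod_cat A" for X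
    using that by (simp add: one_enat_def)
  then show ?thesis unfolding phi_dim_def by (rule SUP_least)
qed

end

section \<open>The path algebra\<close>

lemma poly_mapping_sum_singles:
  fixes f :: "'a \<Rightarrow>\<^sub>0 'b::comm_monoid_add"
  shows
  "(\<Sum>k \<in> Poly_Mapping.keys f. Poly_Mapping.single k (Poly_Mapping.lookup f k)) = f"
  by (rule poly_mapping_eqI)
    (auto simp: lookup_sum lookup_single when_def sum.delta' in_keys_iff)

text \<open>The support condition is carried along, so that in the case of a single basis element
  this element is known to lie in \<open>S\<close>, for instance to be a path.\<close>

lemma poly_mapping_single_induct [consumes 1, case_names zero add single]:
  fixes f :: "'a \<Rightarrow>\<^sub>0 'b::comm_monoid_add"
  assumes "Poly_Mapping.keys f \<subseteq> S" "P 0"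
    and "\<And>f g. Poly_Mapping.keys f \<subseteq> S \<Longrightarrow> Poly_Mapping.keys g \<subseteq> S \<Longrightarrow> P f \<Longrightarrow> P g \<Longrightarrow> P (f + g)"
    and "\<And>k c. k \<in> S \<Longrightarrow> P (Poly_Mapping.single k c)"
  shows "P f"
proof -
  have "Poly_Mapping.keys (\<Sum>k \<in> K. Poly_Mapping.single k (Poly_Mapping.lookup f k)) \<subseteq> S \<and>
    P (\<Sum>k \<in> K. Poly_Mapping.single k (Poly_Mapping.lookup f k))"
    if "finite K" "K \<subseteq> S" for K
    using that
  proof (induction K rule: finite_induct)
    case empty
    then show ?case using assms(2) by simp
  next
    case (insert k K)
    have k: "Poly_Mapping.keys (Poly_Mapping.single k (Poly_Mapping.lookup f k)) \<subseteq> S"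
      using insert.prems by simp
    let ?s = "Poly_Mapping.single k (Poly_Mapping.lookup f k)"
      and ?r = "\<Sum>k \<in> K. Poly_Mapping.single k (Poly_Mapping.lookup f k)"
    have r: "Poly_Mapping.keys ?r \<subseteq> S" "P ?r" and "k \<in> S" using insert by simp_all
    then have "P (?s + ?r)" using assms(3)[OF k r(1)] assms(4) by simp
    moreover have "Poly_Mapping.keys (?s + ?r) \<subseteq> S"
      using Poly_Mapping.keys_add[of ?s ?r] k r(1) by (meson Un_least order_trans)
    ultimately show ?case using insert.hyps by simp
  qed
  from this[OF finite_keys assms(1)] show ?thesis by (simp add: poly_mapping_sum_singles)
qed

text \<open>A summand of \<open>path_mult\<close> with its two coefficients made explicit arguments,
  so that additivity in each can be stated.\<close>

definition path_term :: "('v, 'e) qpath \<Rightarrow> ('v, 'e) qpath \<Rightarrow> 'k \<Rightarrow> 'k \<Rightarrow> (('v, 'e) qpath \<Rightarrow>\<^sub>0 'k::field)" where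
  "path_term x y a b = (case x of (u, p, v) \<Rightarrow> case y of (v', q, w) \<Rightarrow>
     if v = v' then Poly_Mapping.single (u, p @ q, w) (a * b) else 0)"

lemma path_term_simps:
  "path_term x y 0 b = 0" "path_term x y a 0 = 0"
  "path_term x y (a + a') b = path_term x y a b + path_term x y a' b"
  "path_term x y a (b + b') = path_term x y a b + path_term x y a b'"
  by (auto simp: path_term_def distrib_left distrib_right single_add split: prod.splits)

text \<open>The supports of \<open>f\<close>, \<open>f'\<close> and \<open>f + f'\<close> can
  differ. Summing over a common finite superset adds only zero terms and reduces distributivity to
  single terms.\<close>

lemma path_mult_eq:
  assumes "finite X" "Poly_Mapping.keys f \<subseteq> X" "finite Y" "Poly_Mapping.keys g \<subseteq> Y"
  shows "path_mult f g = (\<Sum>x \<in> X. \<Sum>y \<in> Y. path_term x y (Poly_Mapping.lookup f x) (Poly_Mapping.lookup g y))"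
proof -
  have "path_mult f g = (\<Sum>x \<in> Poly_Mapping.keys f. \<Sum>y \<in> Poly_Mapping.keys g.
      path_term x y (Poly_Mapping.lookup f x) (Poly_Mapping.lookup g y))"
    unfolding path_mult_def path_term_def by (intro sum.cong refl) (auto split: prod.splits intro!: sum.cong)
  also have "\<dots> = (\<Sum>x \<in> Poly_Mapping.keys f. \<Sum>y \<in> Y.
      path_term x y (Poly_Mapping.lookup f x) (Poly_Mapping.lookup g y))"
    using assms(3,4)
    by (intro sum.cong refl sum.mono_neutral_left) (auto simp: path_term_simps in_keys_iff)
  also have "\<dots> = (\<Sum>x \<in> X. \<Sum>y \<in> Y. path_term x y (Poly_Mapping.lookup f x) (Poly_Mapping.lookup g y))"
    using assms(1,2)
    by (intro sum.mono_neutral_left) (auto simp: path_term_simps in_keys_iff)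
  finally show ?thesis .
qed

lemma path_mult_zero: "path_mult 0 g = 0" "path_mult f 0 = 0"
  by (simp_all add: path_mult_def case_prod_beta)

lemma path_mult_add_left: "path_mult (f + f') g = path_mult f g + path_mult f' g"
proof -
  let ?X = "Poly_Mapping.keys f \<union> Poly_Mapping.keys f'" and ?Y = "Poly_Mapping.keys g"
  have "path_mult (f + f') g =
    (\<Sum>x \<in> ?X. \<Sum>y \<in> ?Y. path_term x y (Poly_Mapping.lookup (f + f') x) (Poly_Mapping.lookup g y))"
    by (rule path_mult_eq) (use Poly_Mapping.keys_add[of f f'] in auto)
  also have "\<dots> = (\<Sum>x \<in> ?X. \<Sum>y \<in> ?Y. path_term x y (Poly_Mapping.lookup f x) (Poly_Mapping.lookup g y)) +
      (\<Sum>x \<in> ?X. \<Sum>y \<in> ?Y. path_term x y (Poly_Mapping.lookup f' x) (Poly_Mapping.lookup g y))"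
    by (simp add: lookup_add path_term_simps sum.distrib)
  also have "\<dots> = path_mult f g + path_mult f' g"
    by (simp add: path_mult_eq[of ?X _ ?Y])
  finally show ?thesis .
qed

lemma path_mult_add_right: "path_mult f (g + g') = path_mult f g + path_mult f g'"
proof -
  let ?Y = "Poly_Mapping.keys g \<union> Poly_Mapping.keys g'" and ?X = "Poly_Mapping.keys f"
  have "path_mult f (g + g') =
    (\<Sum>x \<in> ?X. \<Sum>y \<in> ?Y. path_term x y (Poly_Mapping.lookup f x) (Poly_Mapping.lookup (g + g') y))"
    by (rule path_mult_eq) (use Poly_Mapping.keys_add[of g g'] in auto)
  also have "\<dots> = (\<Sum>x \<in> ?X. \<Sum>y \<in> ?Y. path_term x y (Poly_Mapping.lookup f x) (Poly_Mapping.lookup g y)) +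
      (\<Sum>x \<in> ?X. \<Sum>y \<in> ?Y. path_term x y (Poly_Mapping.lookup f x) (Poly_Mapping.lookup g' y))"
    by (simp add: lookup_add path_term_simps sum.distrib)
  also have "\<dots> = path_mult f g + path_mult f g'"
    by (simp add: path_mult_eq[of ?X _ ?Y])
  finally show ?thesis .
qed

lemma path_mult_single:
  "path_mult (Poly_Mapping.single (u, p, v) a) (Poly_Mapping.single (v', q, w) b) =
     (if v = v' then Poly_Mapping.single (u, p @ q, w) (a * b) else 0)"
  by (subst path_mult_eq[of "{(u, p, v)}" _ "{(v', q, w)}"]) (auto simp: path_term_def)

lemma path_mult_sum_left: "path_mult (sum F I) g = (\<Sum>i \<in> I. path_mult (F i) g)"
  by (induction I rule: infinite_finite_induct) (simp_all add: path_mult_zero path_mult_add_left)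

lemma path_mult_sum_right: "path_mult g (sum F I) = (\<Sum>i \<in> I. path_mult g (F i))"
  by (induction I rule: infinite_finite_induct) (simp_all add: path_mult_zero path_mult_add_right)

text \<open>Additivity in all three arguments reduces the claim to single paths, where it is
  associativity of list concatenation and of the product of coefficients.\<close>

lemma path_mult_assoc: "path_mult (path_mult f g) h = path_mult f (path_mult g h)"
using subset_UNIV
proof (induction f rule: poly_mapping_single_induct[where S = UNIV])
  case (single x a)
  show ?case
  using subset_UNIV
proof (induction g rule: poly_mapping_single_induct[where S = UNIV])
    case (single y b)
    show ?case
    using subset_UNIV
proof (induction h rule: poly_mapping_single_induct[where S = UNIV])
      case (single z c)
      show ?case
        by (cases x; cases y; cases z) (simp add: path_mult_single path_mult_zero mult.assoc)
    qed (simp_all add: path_mult_zero path_mult_add_right)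
  qed (simp_all add: path_mult_zero path_mult_add_left path_mult_add_right)
qed (simp_all add: path_mult_zero path_mult_add_left)

text \<open>\<open>K\<close> is a type token: it fixes the coefficient field, which the type of
  \<open>Q\<close> does not mention.\<close>

locale quiver = fin_digraph Q for Q :: "('v, 'e) pre_digraph" +
  fixes K :: "'k::field itself"
begin

abbreviation R :: "(('v, 'e) qpath \<Rightarrow>\<^sub>0 'k) ring" where "R \<equiv> path_algebra Q"

definition vertex :: "'v \<Rightarrow> (('v, 'e) qpath \<Rightarrow>\<^sub>0 'k)" where
  "vertex v = Poly_Mapping.single (v, [], v) 1"

definition arrow :: "'e \<Rightarrow> (('v, 'e) qpath \<Rightarrow>\<^sub>0 'k)" where
  "arrow a = Poly_Mapping.single (tail Q a, [a], head Q a) 1"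

lemma qpaths_iff: "(u, p, v) \<in> qpaths Q \<longleftrightarrow> awalk u p v"
  by (simp add: qpaths_def)

lemma R_simps:
  "f \<in> carrier R \<longleftrightarrow> Poly_Mapping.keys f \<subseteq> qpaths Q"
  "f \<otimes>\<^bsub>R\<^esub> g = path_mult f g" "\<one>\<^bsub>R\<^esub> = (\<Sum>v \<in> verts Q. vertex v)" "\<zero>\<^bsub>R\<^esub> = 0" "f \<oplus>\<^bsub>R\<^esub> g = f + g"
  by (simp_all add: path_algebra_def vertex_def)

lemma path_mult_keys:
  assumes "Poly_Mapping.keys f \<subseteq> qpaths Q" "Poly_Mapping.keys g \<subseteq> qpaths Q"
  shows "Poly_Mapping.keys (path_mult f g) \<subseteq> qpaths Q"
  using assms(1)
proof (induction f rule: poly_mapping_single_induct[where S = "qpaths Q"])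
  case (add f f')
  then show ?case using Poly_Mapping.keys_add[of "path_mult f g" "path_mult f' g"]
    by (auto simp: path_mult_add_left)
next
  case (single x a)
  show ?case
    using assms(2)
  proof (induction g rule: poly_mapping_single_induct[where S = "qpaths Q"])
    case (add g g')
    then show ?case
      using Poly_Mapping.keys_add[of "path_mult (Poly_Mapping.single x a) g" "path_mult (Poly_Mapping.single x a) g'"]
      by (auto simp: path_mult_add_right)
  next
    case (single y b)
    with \<open>x \<in> qpaths Q\<close> show ?case
      by (cases x; cases y) (auto simp: path_mult_single qpaths_iff intro: awalk_appendI)
  qed (auto simp: path_mult_zero)
qed (auto simp: path_mult_zero)

lemma vertex_mult:
  "path_mult (vertex u) (Poly_Mapping.single (v, p, w) a) = (if u = v then Poly_Mapping.single (v, p, w) a else 0)"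
  "path_mult (Poly_Mapping.single (v, p, w) a) (vertex u) = (if w = u then Poly_Mapping.single (v, p, w) a else 0)"
  by (auto simp: vertex_def path_mult_single)

lemma R_one_left:
  assumes "Poly_Mapping.keys f \<subseteq> qpaths Q" shows "path_mult (\<Sum>v \<in> verts Q. vertex v) f = f"
  using assms
proof (induction f rule: poly_mapping_single_induct[where S = "qpaths Q"])
  case (single x a)
  then show ?case
    by (cases x) (auto simp: path_mult_sum_left vertex_mult qpaths_iff sum.delta' dest: awalk_hd_in_verts)
qed (auto simp: path_mult_zero path_mult_add_right)

lemma R_one_right:
  assumes "Poly_Mapping.keys f \<subseteq> qpaths Q" shows "path_mult f (\<Sum>v \<in> verts Q. vertex v) = f"
  using assms
proof (induction f rule: poly_mapping_single_induct[where S = "qpaths Q"])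
  case (single x a)
  then show ?case
    by (cases x) (auto simp: path_mult_sum_right vertex_mult qpaths_iff sum.delta dest: awalk_last_in_verts)
qed (auto simp: path_mult_zero path_mult_add_left)

lemma vertex_closed: "v \<in> verts Q \<Longrightarrow> vertex v \<in> carrier R"
  by (simp add: R_simps vertex_def qpaths_iff awalk_Nil_iff)

lemma arrow_closed: "a \<in> arcs Q \<Longrightarrow> arrow a \<in> carrier R"
  by (simp add: R_simps arrow_def qpaths_iff awalk_Cons_iff awalk_Nil_iff)

lemma one_keys: "Poly_Mapping.keys (\<Sum>v \<in> verts Q. vertex v) \<subseteq> qpaths Q"
proof -
  have "Poly_Mapping.keys (\<Sum>v \<in> W. vertex v) \<subseteq> qpaths Q" if "finite W" "W \<subseteq> verts Q" for W
    using that
  proof (induction W rule: finite_induct)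
    case (insert v W)
    then show ?case
      using Poly_Mapping.keys_add[of "vertex v" "\<Sum>v \<in> W. vertex v"] vertex_closed[of v]
      by (auto simp: R_simps)
  qed simp
  then show ?thesis by simp
qed

lemma R_ring: "ring R"
proof (rule ringI)
  show "abelian_group R"
  proof (rule abelian_groupI)
    show "x \<oplus>\<^bsub>R\<^esub> y \<in> carrier R" if "x \<in> carrier R" "y \<in> carrier R" for x y
      using that Poly_Mapping.keys_add[of x y] by (auto simp: R_simps)
    show "\<exists>y \<in> carrier R. y \<oplus>\<^bsub>R\<^esub> x = \<zero>\<^bsub>R\<^esub>" if "x \<in> carrier R" for x
      using that by (intro bexI[of _ "- x"]) (auto simp: R_simps)
  qed (auto simp: R_simps add.assoc add.commute)
  show "monoid R"
    by (rule monoidI) (use path_mult_keys R_one_left R_one_right one_keys in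
        \<open>simp_all add: R_simps path_mult_assoc\<close>)
qed (simp_all add: R_simps path_mult_add_left path_mult_add_right)

sublocale R: ring R by (rule R_ring)

lemma a_inv_R: "f \<in> carrier R \<Longrightarrow> \<ominus>\<^bsub>R\<^esub> f = - f"
  by (rule R.minus_equality) (auto simp: R_simps)

text \<open>The coefficient of the trivial path at \<open>u\<close>. Over all vertices these are the
  components of the projection of the path algebra onto a product of copies of the field, with
  kernel \<open>J\<close>.\<close>

definition vertex_coeff :: "'v \<Rightarrow> (('v, 'e) qpath \<Rightarrow>\<^sub>0 'k) \<Rightarrow> 'k" where
  "vertex_coeff u f = Poly_Mapping.lookup f (u, [], u)"

lemma vertex_coeff_add: "vertex_coeff u (f + g) = vertex_coeff u f + vertex_coeff u g"
  by (simp add: vertex_coeff_def lookup_add)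

lemma vertex_coeff_diff: "vertex_coeff u (f - g) = vertex_coeff u f - vertex_coeff u g"
  by (simp add: vertex_coeff_def lookup_minus)

lemma vertex_coeff_simps:
  "vertex_coeff u 0 = 0" "vertex_coeff u (- f) = - vertex_coeff u f"
  "vertex_coeff u (vertex v) = (if u = v then 1 else 0)" "vertex_coeff u (arrow a) = 0"
  by (auto simp: vertex_coeff_def vertex_def arrow_def lookup_single when_def)

text \<open>A trivial path factors only into trivial paths at the same vertex. The support
  conditions exclude triples \<open>(u, [], v)\<close> with \<open>u \<noteq> v\<close>, for which
  this would fail.\<close>

lemma vertex_coeff_mult:
  assumes "Poly_Mapping.keys f \<subseteq> qpaths Q" "Poly_Mapping.keys g \<subseteq> qpaths Q"
  shows "vertex_coeff u (path_mult f g) = vertex_coeff u f * vertex_coeff u g"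
  using assms(1)
proof (induction f rule: poly_mapping_single_induct[where S = "qpaths Q"])
  case (single x a)
  show ?case
    using assms(2)
  proof (induction g rule: poly_mapping_single_induct[where S = "qpaths Q"])
    case (single y b)
    with \<open>x \<in> qpaths Q\<close> show ?case
      by (cases x; cases y)
        (auto simp: path_mult_single vertex_coeff_def lookup_single when_def qpaths_iff awalk_Nil_iff)
  qed (auto simp: path_mult_zero path_mult_add_right vertex_coeff_simps vertex_coeff_add distrib_left)
qed (auto simp: path_mult_zero path_mult_add_left vertex_coeff_simps vertex_coeff_add distrib_right)

section \<open>The ideal generated by the arrows\<close>

abbreviation J :: "(('v, 'e) qpath \<Rightarrow>\<^sub>0 'k) set" where "J \<equiv> arrow_ideal Q"

lemma J_genideal: "J = genideal R (arrow ` arcs Q)"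
  unfolding arrow_ideal_def arrow_def ..

lemma arrows_subset: "arrow ` arcs Q \<subseteq> carrier R"
  using arrow_closed by blast

lemma J_ideal: "ideal J R"
  unfolding J_genideal by (rule R.genideal_ideal[OF arrows_subset])

sublocale J: ideal J R by (rule J_ideal)

lemma arrow_mem_J: "a \<in> arcs Q \<Longrightarrow> arrow a \<in> J"
  unfolding J_genideal using R.genideal_self[OF arrows_subset] by blast

text \<open>Splitting off the first arrow places the path in the right ideal generated by the
  arrows. Hence \<open>J\<close>, and later its image \<open>rad\<close>, is reached from the arrows
  by sums and right multiplication.\<close>

lemma nontrivial_path:
  assumes "(u, a # p, w) \<in> qpaths Q"
  shows "a \<in> arcs Q" "Poly_Mapping.single (head Q a, p, w) c \<in> carrier R"
    "Poly_Mapping.single (u, a # p, w) c = arrow a \<otimes>\<^bsub>R\<^esub> Poly_Mapping.single (head Q a, p, w) c"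
  using assms by (auto simp: qpaths_iff awalk_Cons_iff R_simps arrow_def path_mult_single)

definition nontrivial_paths :: "('v, 'e) qpath set" where
  "nontrivial_paths = {(u, p, w). (u, p, w) \<in> qpaths Q \<and> p \<noteq> []}"

text \<open>The common kernel of the vertex coefficients is an ideal containing the arrows, so it
  contains \<open>J\<close> by minimality. Conversely its members involve only paths of positive
  length, each an arrow times a path.\<close>

lemma J_iff: "f \<in> J \<longleftrightarrow> f \<in> carrier R \<and> (\<forall>u. vertex_coeff u f = 0)"
  and J_keys: "f \<in> J \<Longrightarrow> Poly_Mapping.keys f \<subseteq> nontrivial_paths"
proof -
  let ?J = "{f \<in> carrier R. \<forall>u. vertex_coeff u f = 0}"
  have "ideal ?J R"
  proof (rule idealI[OF R_ring])
    show "subgroup ?J (add_monoid R)"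
    proof (rule R.add.subgroupI)
      show "?J \<noteq> {}" using R.zero_closed by (auto simp: R_simps(4) vertex_coeff_simps)
    qed (use R.a_closed in \<open>auto simp: a_inv_R vertex_coeff_simps R_simps(5) vertex_coeff_add\<close>,
        use R.a_inv_closed a_inv_R in metis)
  qed (use R.m_closed in \<open>auto simp: R_simps(1,2) vertex_coeff_mult\<close>)
  then have "J \<subseteq> ?J"
    unfolding J_genideal by (rule R.genideal_minimal) (use arrow_closed in \<open>auto simp: vertex_coeff_simps\<close>)
  have keys: "Poly_Mapping.keys f \<subseteq> nontrivial_paths" if "f \<in> ?J" for f
  proof
    fix x assume x: "x \<in> Poly_Mapping.keys f"
    obtain u p w where upw: "x = (u, p, w)" by (cases x)
    have q: "(u, p, w) \<in> qpaths Q" using that x upw by (auto simp: R_simps(1))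
    have "p \<noteq> []"
    proof
      assume "p = []"
      then have "x = (u, [], u)" using q upw by (auto simp: qpaths_iff awalk_Nil_iff)
      then show False using that x by (auto simp: vertex_coeff_def in_keys_iff)
    qed
    then show "x \<in> nontrivial_paths" using q upw by (simp add: nontrivial_paths_def)
  qed
  have "f \<in> J" if "f \<in> ?J" for f
    using keys[OF that]
  proof (induction f rule: poly_mapping_single_induct[where S = nontrivial_paths])
    case zero
    then show ?case using J.zero_closed by (simp add: R_simps)
  next
    case (add f g)
    then show ?case using J.a_closed[of f g] by (simp add: R_simps)
  next
    case (single x c)
    then obtain u a p w where "x = (u, a # p, w)" "(u, a # p, w) \<in> qpaths Q"
      by (cases x) (auto simp: nontrivial_paths_def neq_Nil_conv)
    then show ?case using nontrivial_path(1)[of u a p w] nontrivial_path(2,3)[of u a p w c] J.I_r_closed[OF arrow_mem_J] by simp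
  qed
  with \<open>J \<subseteq> ?J\<close> show "f \<in> J \<longleftrightarrow> f \<in> carrier R \<and> (\<forall>u. vertex_coeff u f = 0)" by blast
  show "f \<in> J \<Longrightarrow> Poly_Mapping.keys f \<subseteq> nontrivial_paths" using keys \<open>J \<subseteq> ?J\<close> by blast
qed

lemma vertex_notin_J: "vertex v \<notin> J"
  using vertex_coeff_simps(3)[of v v] unfolding J_iff by (metis one_neq_zero)

text \<open>Modulo \<open>J\<close>, the product of \<open>vertex v\<close> and \<open>r\<close> is
  \<open>vertex v\<close> scaled by \<open>vertex_coeff v r\<close>. Outside \<open>J\<close> this
  scalar is nonzero, and its reciprocal placed at \<open>v\<close> is the required factor.\<close>

lemma vertex_inverse_mod_J:
  assumes v: "v \<in> verts Q" and r: "r \<in> carrier R" and n: "vertex v \<otimes>\<^bsub>R\<^esub> r \<notin> J"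
  shows "\<exists>s \<in> carrier R. \<exists>j \<in> J. vertex v \<otimes>\<^bsub>R\<^esub> r \<otimes>\<^bsub>R\<^esub> s = vertex v \<oplus>\<^bsub>R\<^esub> j"
proof -
  have vr: "vertex v \<otimes>\<^bsub>R\<^esub> r \<in> carrier R" using vertex_closed[OF v] r by simp
  have cv: "vertex_coeff u (vertex v \<otimes>\<^bsub>R\<^esub> r) = (if u = v then vertex_coeff v r else 0)" for u
    using vertex_closed[OF v] r by (simp add: R_simps(1,2) vertex_coeff_mult vertex_coeff_simps)
  have nz: "vertex_coeff v r \<noteq> 0"
  proof
    assume "vertex_coeff v r = 0"
    then have "\<forall>u. vertex_coeff u (vertex v \<otimes>\<^bsub>R\<^esub> r) = 0" by (simp only: cv if_cancel) simp
    then show False using n vr J_iff by blast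
  qed
  define s :: "('v, 'e) qpath \<Rightarrow>\<^sub>0 'k" where "s = Poly_Mapping.single (v, [], v) (1 / vertex_coeff v r)"
  have s: "s \<in> carrier R" using v by (simp add: s_def R_simps(1) qpaths_iff awalk_Nil_iff)
  have cs: "vertex_coeff u s = (if u = v then 1 / vertex_coeff v r else 0)" for u
    by (simp add: s_def vertex_coeff_def lookup_single when_def)
  define j where "j = vertex v \<otimes>\<^bsub>R\<^esub> r \<otimes>\<^bsub>R\<^esub> s \<ominus>\<^bsub>R\<^esub> vertex v"
  have p: "vertex v \<otimes>\<^bsub>R\<^esub> r \<otimes>\<^bsub>R\<^esub> s \<in> carrier R" using vr s by simp
  have "j \<in> carrier R" using p vertex_closed[OF v] by (simp add: j_def)
  moreover have "vertex_coeff u j = 0" for u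
    using vr s cv cs nz vertex_coeff_mult[of "vertex v \<otimes>\<^bsub>R\<^esub> r" s u]
    by (simp add: j_def a_minus_def a_inv_R[OF vertex_closed[OF v]] R_simps(1,5) R_simps(2)[of "vertex v \<otimes>\<^bsub>R\<^esub> r" s]
        vertex_coeff_diff vertex_coeff_simps)
  ultimately have "j \<in> J" by (simp add: J_iff)
  moreover have "vertex v \<otimes>\<^bsub>R\<^esub> r \<otimes>\<^bsub>R\<^esub> s = vertex v \<oplus>\<^bsub>R\<^esub> j"
    by (simp add: j_def a_inv_R[OF vertex_closed[OF v]] a_minus_def R_simps(5))
  ultimately show ?thesis using s by blast
qed

end

section \<open>The radical square zero algebra of a quiver\<close>

context quiver
begin

abbreviation J2 :: "(('v, 'e) qpath \<Rightarrow>\<^sub>0 'k) set" where "J2 \<equiv> ideal_prod R J J"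

abbreviation A :: "(('v, 'e) qpath \<Rightarrow>\<^sub>0 'k) set ring" where "A \<equiv> rad_sq_zero_algebra Q"

abbreviation S :: "(('v, 'e) qpath \<Rightarrow>\<^sub>0 'k) set ring" where "S \<equiv> R Quot J"

abbreviation A0 :: "((('v, 'e) qpath \<Rightarrow>\<^sub>0 'k) set, (('v, 'e) qpath \<Rightarrow>\<^sub>0 'k) set) module" where
  "A0 \<equiv> semisimple_quotient Q"

sublocale J2: ideal J2 R by (rule R.ideal_prod_is_ideal[OF J_ideal J_ideal])

lemma J2_subset: "J2 \<subseteq> J"
  using R.ideal_prod_inter[OF J_ideal J_ideal] by blast

lemma A_eq: "A = R Quot J2"
  by (simp add: rad_sq_zero_algebra_def)

sublocale A: ring A unfolding A_eq by (rule J2.quotient_is_ring)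

sublocale S: ring S by (rule J.quotient_is_ring)

definition proj :: "(('v, 'e) qpath \<Rightarrow>\<^sub>0 'k) \<Rightarrow> (('v, 'e) qpath \<Rightarrow>\<^sub>0 'k) set" where
  "proj r = J2 +>\<^bsub>R\<^esub> r"

lemma proj_hom: "proj \<in> ring_hom R A"
  using J2.rcos_ring_hom unfolding A_eq proj_def[abs_def] .

lemma proj_simps:
  "r \<in> carrier R \<Longrightarrow> proj r \<in> carrier A"
  "r \<in> carrier R \<Longrightarrow> s \<in> carrier R \<Longrightarrow> proj r \<oplus>\<^bsub>A\<^esub> proj s = proj (r \<oplus>\<^bsub>R\<^esub> s)"
  "r \<in> carrier R \<Longrightarrow> s \<in> carrier R \<Longrightarrow> proj r \<otimes>\<^bsub>A\<^esub> proj s = proj (r \<otimes>\<^bsub>R\<^esub> s)"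
  "proj \<one>\<^bsub>R\<^esub> = \<one>\<^bsub>A\<^esub>" "proj \<zero>\<^bsub>R\<^esub> = \<zero>\<^bsub>A\<^esub>"
  using ring_hom_closed[OF proj_hom] ring_hom_add[OF proj_hom] ring_hom_mult[OF proj_hom]
    ring_hom_one[OF proj_hom] ring_hom_zero[OF proj_hom R_ring A.ring_axioms] by auto

lemma A_carrier: "carrier A = proj ` carrier R"
  unfolding A_eq proj_def by (auto simp: FactRing_def A_RCOSETS_def RCOSETS_def a_r_coset_def)

definition rad :: "(('v, 'e) qpath \<Rightarrow>\<^sub>0 'k) set set" where "rad = proj ` J"

text \<open>Membership in \<open>J\<close> is constant on cosets of \<open>J2\<close>, because
  \<open>J2 \<subseteq> J\<close>.\<close>

lemma proj_mem_rad: "r \<in> carrier R \<Longrightarrow> proj r \<in> rad \<longleftrightarrow> r \<in> J"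
proof
  assume r: "r \<in> carrier R" and "proj r \<in> rad"
  then obtain j where j: "j \<in> J" "proj r = proj j" by (auto simp: rad_def)
  have "r \<in> J2 +>\<^bsub>R\<^esub> j" using J2.a_rcos_self[OF r] j(2) by (simp add: proj_def)
  then obtain i where "i \<in> J2" "r = i \<oplus>\<^bsub>R\<^esub> j" by (auto simp: a_r_coset_def')
  then show "r \<in> J" using J2_subset J.a_closed j(1) by blast
qed (simp add: rad_def)

lemma rad_ideal: "ideal rad A"
proof (rule idealI[OF A.ring_axioms])
  note Jc = J.Icarr
  show "subgroup rad (add_monoid A)"
  proof (rule A.add.subgroupI)
    show "rad \<subseteq> carrier A" using Jc proj_simps(1) by (auto simp: rad_def)
    show "rad \<noteq> {}" using J.zero_closed unfolding rad_def by blast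
    show "\<ominus>\<^bsub>A\<^esub> x \<in> rad" if x: "x \<in> rad" for x
    proof -
      obtain j where j: "j \<in> J" "x = proj j" using x by (auto simp: rad_def)
      have "\<ominus>\<^bsub>R\<^esub> j \<in> J" using J.a_inv_closed[OF j(1)] .
      moreover have "\<ominus>\<^bsub>A\<^esub> x = proj (\<ominus>\<^bsub>R\<^esub> j)"
        using Jc[OF j(1)] j(2) by (intro A.minus_equality) (simp_all add: proj_simps R.l_neg)
      ultimately show ?thesis by (simp add: rad_def)
    qed
    show "x \<oplus>\<^bsub>A\<^esub> y \<in> rad" if "x \<in> rad" "y \<in> rad" for x y
      using that J.a_closed Jc by (auto simp: rad_def proj_simps)
  qed
  show "x \<otimes>\<^bsub>A\<^esub> n \<in> rad" "n \<otimes>\<^bsub>A\<^esub> x \<in> rad" if nx: "n \<in> rad" "x \<in> carrier A" for n x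
  proof -
    obtain j r where jr: "j \<in> J" "n = proj j" "r \<in> carrier R" "x = proj r"
      using nx by (auto simp: rad_def A_carrier)
    then have "x \<otimes>\<^bsub>A\<^esub> n = proj (r \<otimes>\<^bsub>R\<^esub> j)" "n \<otimes>\<^bsub>A\<^esub> x = proj (j \<otimes>\<^bsub>R\<^esub> r)"
      using Jc by (simp_all add: proj_simps)
    then show "x \<otimes>\<^bsub>A\<^esub> n \<in> rad" "n \<otimes>\<^bsub>A\<^esub> x \<in> rad"
      using J.I_l_closed[OF jr(1,3)] J.I_r_closed[OF jr(1,3)] by (simp_all add: rad_def)
  qed
qed

lemma rad_sq_zero: "rad_sq_zero_ring A rad (verts Q) (\<lambda>v. proj (vertex v)) (proj ` arrow ` arcs Q)"
proof (intro rad_sq_zero_ring.intro rad_sq_zero_ring_axioms.intro A.ring_axioms rad_ideal)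
  show "n \<otimes>\<^bsub>A\<^esub> m = \<zero>\<^bsub>A\<^esub>" if nm: "n \<in> rad" "m \<in> rad" for n m
  proof -
    obtain j k where jk: "j \<in> J" "n = proj j" "k \<in> J" "m = proj k" using nm by (auto simp: rad_def)
    have jk2: "j \<otimes>\<^bsub>R\<^esub> k \<in> J2" using ideal_prod.prod[OF jk(1,3)] .
    have "n \<otimes>\<^bsub>A\<^esub> m = J2 +>\<^bsub>R\<^esub> (j \<otimes>\<^bsub>R\<^esub> k)" using jk J.Icarr by (simp add: proj_simps) (simp add: proj_def)
    also have "\<dots> = J2" using R.a_coset_join2[OF J2.Icarr[OF jk2] J2.a_subgroup jk2] .
    finally show ?thesis by (simp add: A_eq FactRing_def)
  qed
  show "finite (verts Q)" by simp
  show "proj (vertex v) \<in> carrier A" if "v \<in> verts Q" for v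
    using proj_simps(1)[OF vertex_closed[OF that]] .
  show "proj (vertex v) \<otimes>\<^bsub>A\<^esub> proj (vertex v) = proj (vertex v)" if "v \<in> verts Q" for v
    using vertex_closed[OF that] by (simp add: proj_simps R_simps vertex_def path_mult_single)
  \<comment> \<open>\<open>proj\<close> commutes with finite sums; membership of the partial sums in
    the carrier is proved along with it because \<open>proj_simps\<close> requires it.\<close>
  have "finsum A (\<lambda>v. proj (vertex v)) W = proj (\<Sum>v \<in> W. vertex v) \<and> (\<Sum>v \<in> W. vertex v) \<in> carrier R"
    if "finite W" "W \<subseteq> verts Q" for W
    using that
  proof (induction W rule: finite_induct)
    case empty
    then show ?case using proj_simps(5) R.zero_closed by (simp add: R_simps(4))
  next
    case (insert v W)
    then have v: "vertex v \<in> carrier R" and "(\<lambda>v. proj (vertex v)) \<in> W \<rightarrow> carrier A"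
      using vertex_closed proj_simps(1) by auto
    moreover have "(\<Sum>v \<in> W. vertex v) \<in> carrier R" using insert by blast
    ultimately show ?case
      using insert R.a_closed[of "vertex v" "\<Sum>v \<in> W. vertex v"] proj_simps(2)[of "vertex v" "\<Sum>v \<in> W. vertex v"]
        proj_simps(1)
      by (simp add: R_simps(5))
  qed
  from this[of "verts Q"] show "finsum A (\<lambda>v. proj (vertex v)) (verts Q) = \<one>\<^bsub>A\<^esub>"
    using proj_simps(4) by (simp add: R_simps(3))
  show "proj (vertex v) \<notin> rad" if "v \<in> verts Q" for v
    using proj_mem_rad[OF vertex_closed[OF that]] vertex_notin_J by blast
  show "\<exists>b \<in> carrier A. proj (vertex v) \<otimes>\<^bsub>A\<^esub> a \<otimes>\<^bsub>A\<^esub> b \<ominus>\<^bsub>A\<^esub> proj (vertex v) \<in> rad"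
    if v: "v \<in> verts Q" and a: "a \<in> carrier A" and n: "proj (vertex v) \<otimes>\<^bsub>A\<^esub> a \<notin> rad" for v a
  proof -
    obtain r where r: "r \<in> carrier R" "a = proj r" using a by (auto simp: A_carrier)
    note vc = vertex_closed[OF v]
    have "vertex v \<otimes>\<^bsub>R\<^esub> r \<notin> J"
      using n r(2) proj_simps(3)[OF vc r(1)] proj_mem_rad[OF R.m_closed[OF vc r(1)]] by simp
    then obtain s j where s: "s \<in> carrier R" "j \<in> J" "vertex v \<otimes>\<^bsub>R\<^esub> r \<otimes>\<^bsub>R\<^esub> s = vertex v \<oplus>\<^bsub>R\<^esub> j"
      using vertex_inverse_mod_J[OF v r(1)] by blast
    have pv: "proj (vertex v) \<in> carrier A" and pj: "proj j \<in> carrier A"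
      using proj_simps(1) vc J.Icarr[OF s(2)] by blast+
    have "proj (vertex v) \<otimes>\<^bsub>A\<^esub> a \<otimes>\<^bsub>A\<^esub> proj s = proj (vertex v \<otimes>\<^bsub>R\<^esub> r \<otimes>\<^bsub>R\<^esub> s)"
      unfolding r(2) using proj_simps(3)[OF vc r(1)] proj_simps(3)[OF R.m_closed[OF vc r(1)] s(1)] by simp
    also have "\<dots> = proj (vertex v) \<oplus>\<^bsub>A\<^esub> proj j"
      unfolding s(3) using proj_simps(2)[OF vc J.Icarr[OF s(2)]] by simp
    finally have "proj (vertex v) \<otimes>\<^bsub>A\<^esub> a \<otimes>\<^bsub>A\<^esub> proj s \<ominus>\<^bsub>A\<^esub> proj (vertex v) = proj j"
      using pv pj by (simp add: a_minus_def A.a_ac A.r_neg A.r_neg1 A.r_neg2)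
    then show ?thesis using s proj_simps(1) by (intro bexI[of _ "proj s"]) (auto simp: rad_def)
  qed
  show "finite (proj ` arrow ` arcs Q)" by simp
  show "proj ` arrow ` arcs Q \<subseteq> rad" using arrow_mem_J by (auto simp: rad_def)
  show "rad \<subseteq> W"
    if W: "W \<subseteq> carrier A" "\<zero>\<^bsub>A\<^esub> \<in> W" "\<And>x y. x \<in> W \<Longrightarrow> y \<in> W \<Longrightarrow> x \<oplus>\<^bsub>A\<^esub> y \<in> W"
      "\<And>x a. x \<in> W \<Longrightarrow> a \<in> carrier A \<Longrightarrow> x \<otimes>\<^bsub>A\<^esub> a \<in> W" "proj ` arrow ` arcs Q \<subseteq> W" for W
  proof -
    have np: "nontrivial_paths \<subseteq> qpaths Q" by (auto simp: nontrivial_paths_def)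
    \<comment> \<open>\<open>W\<close> absorbs factors only on the right, so each path is written
      with its first arrow on the left.\<close>
    have "proj f \<in> W" if "f \<in> J" for f
      using J_keys[OF that]
    proof (induction f rule: poly_mapping_single_induct)
      case zero
      then show ?case using proj_simps(5) W(2) by (simp add: R_simps(4))
    next
      case (add f g)
      then have "f \<in> carrier R" "g \<in> carrier R" using np by (auto simp: R_simps(1))
      from proj_simps(2)[OF this] show ?case using W(3)[OF add.IH] by (simp add: R_simps(5))
    next
      case (single x c)
      then obtain u a p w where x: "x = (u, a # p, w)" "(u, a # p, w) \<in> qpaths Q"
        by (cases x) (auto simp: nontrivial_paths_def neq_Nil_conv)
      note np = nontrivial_path(1)[OF x(2)] nontrivial_path(2,3)[OF x(2), of c]
      have "proj (arrow a) \<otimes>\<^bsub>A\<^esub> proj (Poly_Mapping.single (head Q a, p, w) c) \<in> W"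
        using W(4,5) np(1) proj_simps(1)[OF np(2)] by blast
      then show ?case using proj_simps(3)[OF arrow_closed[OF np(1)] np(2)] np(3) x(1) by simp
    qed
    then show ?thesis by (auto simp: rad_def)
  qed
qed

section \<open>The right module \<open>KQ/J\<close>\<close>

definition cls :: "(('v, 'e) qpath \<Rightarrow>\<^sub>0 'k) \<Rightarrow> (('v, 'e) qpath \<Rightarrow>\<^sub>0 'k) set" where
  "cls r = J +>\<^bsub>R\<^esub> r"

lemma cls_hom: "cls \<in> ring_hom R S"
  using J.rcos_ring_hom unfolding cls_def[abs_def] .

lemma cls_simps:
  "r \<in> carrier R \<Longrightarrow> cls r \<in> carrier S"
  "r \<in> carrier R \<Longrightarrow> s \<in> carrier R \<Longrightarrow> cls (r \<oplus>\<^bsub>R\<^esub> s) = cls r \<oplus>\<^bsub>S\<^esub> cls s"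
  "r \<in> carrier R \<Longrightarrow> s \<in> carrier R \<Longrightarrow> cls (r \<otimes>\<^bsub>R\<^esub> s) = cls r \<otimes>\<^bsub>S\<^esub> cls s"
  "cls \<one>\<^bsub>R\<^esub> = \<one>\<^bsub>S\<^esub>"
  using ring_hom_closed[OF cls_hom] ring_hom_add[OF cls_hom] ring_hom_mult[OF cls_hom]
    ring_hom_one[OF cls_hom] by auto

lemma A0_simps:
  "carrier A0 = carrier S" "\<zero>\<^bsub>A0\<^esub> = \<zero>\<^bsub>S\<^esub>" "x \<oplus>\<^bsub>A0\<^esub> y = x \<oplus>\<^bsub>S\<^esub> y"
  "a \<odot>\<^bsub>A0\<^esub> x = x \<otimes>\<^bsub>S\<^esub> (J <+>\<^bsub>R\<^esub> a)"
  by (simp_all add: semisimple_quotient_def Let_def)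

text \<open>The action on \<open>A0\<close> adds \<open>J\<close> to a coset of \<open>J2\<close>;
  as \<open>J2 \<subseteq> J\<close>, this yields a full coset of \<open>J\<close> with the same
  representative.\<close>

lemma J_add_proj:
  assumes r: "r \<in> carrier R" shows "J <+>\<^bsub>R\<^esub> proj r = cls r"
proof (intro equalityI subsetI)
  fix x assume "x \<in> J <+>\<^bsub>R\<^esub> proj r"
  then obtain j i where ji: "j \<in> J" "i \<in> J2" "x = j \<oplus>\<^bsub>R\<^esub> (i \<oplus>\<^bsub>R\<^esub> r)"
    by (auto simp: set_add_def' proj_def a_r_coset_def')
  then have "x = (j \<oplus>\<^bsub>R\<^esub> i) \<oplus>\<^bsub>R\<^esub> r" using J.Icarr J2.Icarr r by (simp add: R.a_assoc)
  moreover have "j \<oplus>\<^bsub>R\<^esub> i \<in> J" using ji J2_subset J.a_closed by blast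
  ultimately show "x \<in> cls r" by (auto simp: cls_def a_r_coset_def')
next
  fix x assume "x \<in> cls r"
  then obtain j where j: "j \<in> J" "x = j \<oplus>\<^bsub>R\<^esub> r" by (auto simp: cls_def a_r_coset_def')
  have "r \<in> proj r" unfolding proj_def by (rule J2.a_rcos_self[OF r])
  then show "x \<in> J <+>\<^bsub>R\<^esub> proj r" using j by (auto simp: set_add_def')
qed

lemma A0_right_module: "right_module A A0"
proof (intro right_module.intro right_module_axioms.intro A.ring_axioms)
  show "abelian_group A0"
  proof (rule abelian_groupI)
    show "\<exists>y \<in> carrier A0. y \<oplus>\<^bsub>A0\<^esub> x = \<zero>\<^bsub>A0\<^esub>" if "x \<in> carrier A0" for x
      using that by (intro bexI[of _ "\<ominus>\<^bsub>S\<^esub> x"]) (auto simp: A0_simps S.l_neg)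
  qed (auto simp: A0_simps S.a_ac)
qed (auto simp: A_carrier A0_simps J_add_proj proj_simps cls_simps S.r_distr S.l_distr S.m_assoc
    proj_simps(4)[symmetric] simp del: proj_simps(4))

text \<open>The generator is the unit of \<open>KQ/J\<close>: \<open>proj r\<close> takes it to
  \<open>cls r\<close>, which is zero exactly when \<open>r \<in> J\<close>.\<close>

lemma A0_rad_quotient:
  "rad_quotient A rad (verts Q) (\<lambda>v. proj (vertex v)) (proj ` arrow ` arcs Q) A0 \<one>\<^bsub>S\<^esub>"
proof (intro rad_quotient.intro rad_quotient_axioms.intro rad_sq_zero A0_right_module)
  have smult: "proj r \<odot>\<^bsub>A0\<^esub> \<one>\<^bsub>S\<^esub> = cls r" if "r \<in> carrier R" for r
    using that by (simp add: A0_simps J_add_proj cls_simps)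
  show "\<one>\<^bsub>S\<^esub> \<in> carrier A0" by (simp add: A0_simps)
  have "carrier S = cls ` carrier R" unfolding cls_def by (auto simp: FactRing_def A_RCOSETS_def RCOSETS_def a_r_coset_def)
  then show "carrier A0 = cyclic A A0 \<one>\<^bsub>S\<^esub>"
    by (auto simp: A0_simps(1) cyclic_def A_carrier smult image_image)
  show "a \<odot>\<^bsub>A0\<^esub> \<one>\<^bsub>S\<^esub> = \<zero>\<^bsub>A0\<^esub> \<longleftrightarrow> a \<in> rad" if a: "a \<in> carrier A" for a
  proof -
    obtain r where r: "r \<in> carrier R" "a = proj r" using a by (auto simp: A_carrier)
    have "cls r = J \<longleftrightarrow> r \<in> J"
      unfolding cls_def using R.a_coset_join2[OF r(1) J.a_subgroup] J.a_rcos_self[OF r(1)] by auto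
    then show ?thesis using smult[OF r(1)] proj_mem_rad[OF r(1)] r(2) by (simp add: A0_simps(2) FactRing_def)
  qed
qed

end

theorem proposition4p12:
  fixes Q :: "('v, 'e) pre_digraph"
    and A :: "(('v, 'e) qpath \<Rightarrow>\<^sub>0 'k::field) set ring"
    and A0 :: "((('v, 'e) qpath \<Rightarrow>\<^sub>0 'k) set, (('v, 'e) qpath \<Rightarrow>\<^sub>0 'k) set) module"
  assumes "fin_digraph Q"
    and "Digraph_Component.connected Q"
    and "A = rad_sq_zero_algebra Q"
    and "A0 = semisimple_quotient Q"
  shows "phi_dim A \<le> enat (phi A A0) + 1"
proof -
  interpret quiver Q "TYPE('k)"
    by (intro quiver.intro assms(1))
  show ?thesis
    unfolding assms(3,4) by (rule rad_quotient.phi_dim_le[OF A0_rad_quotient])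
qed

end
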